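(* Let $\alpha,\beta>-1$. Then $$H_t^{\alpha,\beta}(\theta,\varphi)\simeq\mathbb{H}_t^{\alpha,\beta}(\theta,\varphi)\simeq\big(t^2+\theta^2+\varphi^2\big)^{-\alpha-1/2}\big(t^2+(\pi-\theta)^2+(\pi-\varphi)^2\big)^{-\beta-1/2}\frac{t}{t^2+(\theta-\varphi)^2},$$ uniformly in $0<t\le1$ and $\theta,\varphi\in[0,\pi]$, and $$H_t^{\alpha,\beta}(\theta,\varphi)\simeq\exp\Big(-t\,\frac{|\alpha+\beta+1|}{2}\Big),\qquad\mathbb{H}_t^{\alpha,\beta}(\theta,\varphi)\simeq\exp\Big(-t\,\frac{\alpha+\beta+1}{2}\Big),$$ uniformly in $t\ge1$ and $\theta,\varphi\in[0,\pi]$.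
   Context: For $\alpha,\beta>-1$ let $d\mu_{\alpha,\beta}(\theta)=(\sin\frac{\theta}{2})^{2\alpha+1}(\cos\frac{\theta}{2})^{2\beta+1}\,d\theta$ on $[0,\pi]$. Let $\mathcal{P}_n^{\alpha,\beta}(\theta)$, $n\ge 0$, be the classical Jacobi trigonometric polynomials (the Jacobi polynomial of degree $n$ and type $(\alpha,\beta)$ evaluated at $\cos\theta$), normalized in $L^2(d\mu_{\alpha,\beta})$. The Jacobi-Poisson kernel and the auxiliary kernel are, for $t>0$ and $\theta,\varphi\in[0,\pi]$, $$H_t^{\alpha,\beta}(\theta,\varphi)=\sum_{n=0}^\infty e^{-t\left|n+\frac{\alpha+\beta+1}{2}\right|}\mathcal{P}_n^{\alpha,\beta}(\theta)\mathcal{P}_n^{\alpha,\beta}(\varphi),\qquad\mathbb{H}_t^{\alpha,\beta}(\theta,\varphi)=\sum_{n=0}^\infty e^{-t\left(n+\frac{\alpha+\beta+1}{2}\right)}\mathcal{P}_n^{\alpha,\beta}(\theta)\mathcal{P}_n^{\alpha,\beta}(\varphi).$$ $X\simeq Y$ means $C^{-1}Y\le X\le CY$ with a constant $C>0$ independent of $t,\theta,\varphi$ in the indicated range (it may depend on $\alpha,\beta$). *)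

theory Defs
  imports "HOL-Analysis.Analysis" "HOL-Computational_Algebra.Polynomial"
begin

(* Jacobi polynomial P_n^(a,b) in the classical normalization P_n^(a,b)(1) = (n+a choose n):
   the sum over k of (n+a choose n-k) (n+b choose k) ((x-1)/2)^k ((x+1)/2)^(n-k). This form is
   valid for all a, b > -1, including a + b = -1. *)
definition jacobi_poly :: "real \<Rightarrow> real \<Rightarrow> nat \<Rightarrow> real poly" where
  "jacobi_poly \<alpha> \<beta> n =
     (\<Sum>k\<le>n. smult (((real n + \<alpha>) gchoose (n - k)) * ((real n + \<beta>) gchoose k))
                   ([:-1/2, 1/2:] ^ k * [:1/2, 1/2:] ^ (n - k)))"

(* Since 0 powr a = 0 for every a, the density is off at an endpoint of the interval when the
   corresponding exponent is nonpositive; this affects only a null set. *)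
definition jacobi_measure :: "real \<Rightarrow> real \<Rightarrow> real measure" where
  "jacobi_measure \<alpha> \<beta> =
     density (restrict_space lborel {0..pi})
       (\<lambda>\<theta>. ennreal (sin (\<theta> / 2) powr (2 * \<alpha> + 1) * cos (\<theta> / 2) powr (2 * \<beta> + 1)))"

definition jacobi_norm :: "real \<Rightarrow> real \<Rightarrow> nat \<Rightarrow> real" where
  "jacobi_norm \<alpha> \<beta> n =
     sqrt (\<integral>\<theta>. (poly (jacobi_poly \<alpha> \<beta> n) (cos \<theta>))\<^sup>2 \<partial>jacobi_measure \<alpha> \<beta>)"

definition jacobi_trig :: "real \<Rightarrow> real \<Rightarrow> nat \<Rightarrow> real \<Rightarrow> real" where
  "jacobi_trig \<alpha> \<beta> n \<theta> = poly (jacobi_poly \<alpha> \<beta> n) (cos \<theta>) / jacobi_norm \<alpha> \<beta> n"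

definition jacobi_poisson_kernel :: "real \<Rightarrow> real \<Rightarrow> real \<Rightarrow> real \<Rightarrow> real \<Rightarrow> real" where
  "jacobi_poisson_kernel \<alpha> \<beta> t \<theta> \<phi> =
     (\<Sum>n. exp (- t * \<bar>real n + (\<alpha> + \<beta> + 1) / 2\<bar>) * jacobi_trig \<alpha> \<beta> n \<theta> * jacobi_trig \<alpha> \<beta> n \<phi>)"

definition aux_jacobi_poisson_kernel :: "real \<Rightarrow> real \<Rightarrow> real \<Rightarrow> real \<Rightarrow> real \<Rightarrow> real" where
  "aux_jacobi_poisson_kernel \<alpha> \<beta> t \<theta> \<phi> =
     (\<Sum>n. exp (- t * (real n + (\<alpha> + \<beta> + 1) / 2)) * jacobi_trig \<alpha> \<beta> n \<theta> * jacobi_trig \<alpha> \<beta> n \<phi>)"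

(* X \<simeq> Y uniformly in t \<in> T and \<theta>, \<phi> \<in> [0, pi]. *)
definition comparable_on ::
    "real set \<Rightarrow> (real \<Rightarrow> real \<Rightarrow> real \<Rightarrow> real) \<Rightarrow> (real \<Rightarrow> real \<Rightarrow> real \<Rightarrow> real) \<Rightarrow> bool" where
  "comparable_on T X Y \<longleftrightarrow>
     (\<exists>C>0. \<forall>t\<in>T. \<forall>\<theta>\<in>{0..pi}. \<forall>\<phi>\<in>{0..pi}.
        inverse C * Y t \<theta> \<phi> \<le> X t \<theta> \<phi> \<and> X t \<theta> \<phi> \<le> C * Y t \<theta> \<phi>)"

end

theory Submission
  imports Defs
begin

text \<open>Put \<open>A = sin (\<theta> / 2)\<^sup>2\<close>, \<open>A' = sin (\<phi> / 2)\<^sup>2\<close>, \<open>s = \<alpha> + \<beta> + 1\<close>, \<open>r = exp (- t)\<close>. By Bailey's formula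
  the auxiliary kernel is a constant times \<open>(1 - r) * (1 + r) powr (- s - 1) * r powr (s / 2)\<close> times the
  Appell series \<open>\<Sum>N. z ^ N * e N\<close> with \<open>z = r / (1 + r)\<^sup>2\<close> and
  \<open>e N = (\<Sum>m + k = N. pochhammer (s + 1) (2 * N) / (pochhammer (\<alpha> + 1) m * m! * pochhammer (\<beta> + 1) k * k!)
  * (A * A') ^ m * ((1 - A) * (1 - A')) ^ k)\<close>, whose terms are nonnegative for all \<open>\<alpha>, \<beta> > -1\<close>. The formula
  follows from the finite expansion of \<open>e N\<close> in products of Jacobi polynomials with coefficients
  \<open>2 * N + s gchoose (N - n)\<close>. On the diagonal the terms of that expansion are nonnegative, so the double series
  may be summed in either order for every \<open>r < 1\<close>, without analytic continuation.

  After Stirling-type bounds, \<open>e N\<close> is a moment of a binomial distribution with weights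
  \<open>(m + 1) powr (- \<alpha> - 1/2) * (k + 1) powr (- \<beta> - 1/2)\<close>, which concentrates at its mean. If \<open>s < 0\<close>, the
  Poisson kernel differs from the auxiliary one by a function of \<open>t\<close> alone, which is dominated by the first term of
  the series because \<open>1 - r powr d < (1 - r) * (1 + r) powr (d - 1)\<close> for \<open>0 < d < 1\<close>.\<close>

subsection \<open>Comparability up to constants\<close>

text \<open>The products of Jacobi functions in the kernel change sign, so no termwise estimate of
  the original series can give a lower bound; this is what forces the detour through a series with
  nonnegative terms. The quantities of the final estimate arise as follows. By the addition theorem
  the products of the half-angle sines and of the half-angle cosines add up to
  \<open>c = cos ((\<theta> - \<phi>) / 2)\<close>; dividing them by \<open>c\<close> gives
  \<open>p + q = 1\<close>, hence a binomial law. The level \<open>N\<close> then has exponential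
  order \<open>(4 * c^2) ^ N\<close>, so the series is governed by
  \<open>d = 1 - 4 * z * c^2\<close>. Since \<open>1 - 4 * z = ((1 - r) / (1 + r))^2\<close> is of
  order \<open>t^2\<close>, \<open>d\<close> is of order \<open>t^2 + (\<theta> - \<phi>)^2\<close>.
  The levels near \<open>N = 1 / d\<close> dominate, and there \<open>p + 1 / N\<close> is about
  \<open>p + d\<close>, which produces the other two factors. For negative index and large
  \<open>t\<close> the two kernels have different sizes: the first term nearly cancels in the
  Poisson kernel, so the inequality that closes the overview is needed with explicit
  margins.\<close>

definition comparable :: "real \<Rightarrow> real \<Rightarrow> real \<Rightarrow> bool" where
  "comparable C x y \<longleftrightarrow> 1 \<le> C \<and> 0 \<le> x \<and> 0 \<le> y \<and> x \<le> C * y \<and> y \<le> C * x"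

lemma comparableI:
  assumes "0 \<le> x" "0 \<le> y" "x \<le> C * y" "y \<le> D * x"
  shows "comparable (max 1 (max C D)) x y"
proof -
  have "C * y \<le> max 1 (max C D) * y" "D * x \<le> max 1 (max C D) * x"
    using assms by (intro mult_right_mono; simp)+
  with assms show ?thesis unfolding comparable_def by linarith
qed

lemma comparable_sym: "comparable C x y \<Longrightarrow> comparable C y x"
  unfolding comparable_def by auto

lemma comparable_refl: "0 \<le> x \<Longrightarrow> comparable 1 x x"
  unfolding comparable_def by auto

lemma comparable_trans [trans]:
  assumes "comparable C x y" "comparable D y z"
  shows "comparable (C * D) x z"
proof -
  have "x \<le> C * y" "C * y \<le> C * (D * z)" "z \<le> D * y" "D * y \<le> D * (C * x)"
    using assms unfolding comparable_def by (auto intro!: mult_left_mono)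
  moreover have "1 \<le> C * D" using assms mult_mono[of 1 C 1 D] unfolding comparable_def by auto
  moreover have "D * (C * x) = C * D * x" "C * (D * z) = C * D * z" by simp_all
  ultimately show ?thesis using assms unfolding comparable_def by linarith
qed

lemma comparable_mult:
  assumes "comparable C x y" "comparable D x' y'"
  shows "comparable (C * D) (x * x') (y * y')"
proof -
  have "x * x' \<le> (C * y) * (D * y')" "y * y' \<le> (C * x) * (D * x')"
    using assms unfolding comparable_def by (auto intro!: mult_mono)
  moreover have "1 \<le> C * D" using assms mult_mono[of 1 C 1 D] unfolding comparable_def by auto
  ultimately show ?thesis using assms unfolding comparable_def by (auto simp: algebra_simps)
qed

lemma comparable_inverse:
  assumes "comparable C x y"
  shows "comparable C (inverse x) (inverse y)"
\<comment> \<open>The relation forces both numbers to vanish together, and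
  \<open>inverse 0 = 0\<close> then preserves it.\<close>
proof (cases "x = 0 \<or> y = 0")
  case True
  then show ?thesis using assms unfolding comparable_def by auto
next
  case False
  have *: "inverse u \<le> C * inverse v" if "0 < u" "0 < v" "v \<le> C * u" for u v :: real
    using that by (simp add: divide_simps mult.commute)
  show ?thesis using *[of x y] *[of y x] False assms unfolding comparable_def by auto
qed

lemma comparable_powr:
  assumes "comparable C x y"
  shows "comparable (C powr \<bar>a\<bar>) (x powr a) (y powr a)"
proof (cases "x = 0 \<or> y = 0")
  case True
  then show ?thesis using assms unfolding comparable_def by (auto simp: ge_one_powr_ge_zero)
next
  case False
  have *: "u powr a \<le> C powr \<bar>a\<bar> * v powr a" if "0 < u" "0 < v" "1 \<le> C" "u \<le> C * v" "v \<le> C * u" for u v :: real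
  proof (cases "a \<ge> 0")
    case True
    then have "u powr a \<le> (C * v) powr a" using that by (intro powr_mono2) auto
    then show ?thesis using that True by (simp add: powr_mult)
  next
    case False
    then have "(C * u) powr a \<le> v powr a" using that by (intro powr_mono2') auto
    then have "C powr a * u powr a \<le> v powr a" using that by (simp add: powr_mult)
    moreover have "C powr \<bar>a\<bar> = inverse (C powr a)" using False by (simp add: powr_minus)
    ultimately have "u powr a \<le> v powr a / C powr a" using that by (simp add: pos_le_divide_eq mult.commute)
    then show ?thesis using \<open>C powr \<bar>a\<bar> = _\<close> by (simp add: divide_inverse mult.commute)
  qed
  show ?thesis using *[of x y] *[of y x] False assms unfolding comparable_def
    by (auto simp: ge_one_powr_ge_zero)
qed

lemma comparable_sum:
  assumes "\<And>i. i \<in> I \<Longrightarrow> comparable C (f i) (g i)" "1 \<le> C"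
  shows "comparable C (sum f I) (sum g I)"
  using assms unfolding comparable_def by (auto simp: sum_distrib_left intro!: sum_mono sum_nonneg)

lemma comparable_suminf:
  assumes "\<And>i. comparable C (f i) (g i)" "summable g"
  shows "summable f" "comparable C (suminf f) (suminf g)"
proof -
  have fg: "\<And>i. f i \<le> C * g i" "\<And>i. g i \<le> C * f i" "\<And>i. 0 \<le> f i" "\<And>i. 0 \<le> g i" "1 \<le> C"
    using assms unfolding comparable_def by auto
  have Cg: "summable (\<lambda>i. C * g i)" by (rule summable_mult[OF assms(2)])
  show f: "summable f" by (rule summable_comparison_test'[OF Cg, of 0]) (use fg in auto)
  have Cf: "summable (\<lambda>i. C * f i)" by (rule summable_mult[OF f])
  have "suminf f \<le> C * suminf g"
    using suminf_le[OF fg(1) f Cg] suminf_mult[OF assms(2)] by simp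
  moreover have "suminf g \<le> C * suminf f"
    using suminf_le[OF fg(2) assms(2) Cf] suminf_mult[OF f] by simp
  ultimately show "comparable C (suminf f) (suminf g)"
    using fg suminf_nonneg[OF f] suminf_nonneg[OF assms(2)] unfolding comparable_def by auto
qed

section \<open>Growth of Pochhammer symbols and power series with power weights\<close>

lemma comparable_of_convergent:
  fixes f :: "nat \<Rightarrow> real"
  assumes "f \<longlonglongrightarrow> l" "0 < l" "\<And>n. 0 < f n"
  shows "\<exists>C. \<forall>n. comparable C (f n) 1"
proof -
  have "Bseq f" using assms(1) convergent_def convergent_imp_Bseq by blast
  then obtain K where K: "\<And>n. norm (f n) \<le> K" unfolding Bseq_def by blast
  have "Bseq (\<lambda>n. inverse (f n))"
    using assms by (intro convergent_imp_Bseq convergentI[of _ "inverse l"] tendsto_inverse) auto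
  then obtain L where L: "\<And>n. norm (inverse (f n)) \<le> L" unfolding Bseq_def by blast
  have "comparable (max 1 (max K L)) (f n) 1" for n
    using K[of n] L[of n] assms(3)[of n] by (intro comparableI) (auto simp: field_simps)
  then show ?thesis by blast
qed

text \<open>By the limit formula for the Gamma function the quotient of the two sides tends to
  \<open>1 / Gamma x\<close>. The base is \<open>n + 1\<close> rather than \<open>n\<close>, so that
  the power is positive from \<open>n = 0\<close> on and one constant serves all
  \<open>n\<close>.\<close>

lemma pochhammer_fact_comparable:
  fixes x :: real
  assumes "x > 0"
  shows "\<exists>C. \<forall>n. comparable C (pochhammer x n / fact n) ((real n + 1) powr (x - 1))"
proof -
  let ?f = "\<lambda>n. pochhammer x n / fact n * (real n + 1) powr (1 - x)"
  \<comment> \<open>\<open>Gamma_series' x (Suc n)\<close> contains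
    \<open>pochhammer x (Suc n)\<close>; the extra quotient takes its last factor off and supplies
    the missing power of \<open>n + 1\<close>.\<close>
  have "(\<lambda>n. inverse (Gamma_series' x (Suc n)) * (real (Suc n) / (x + real n))) \<longlonglongrightarrow> inverse (Gamma x) * 1"
  proof (intro tendsto_mult tendsto_inverse)
    show "(\<lambda>n. Gamma_series' x (Suc n)) \<longlonglongrightarrow> Gamma x"
      by (rule LIMSEQ_Suc[OF Gamma_series'_LIMSEQ])
    show "Gamma x \<noteq> 0" using Gamma_real_pos[OF assms] by simp
    show "(\<lambda>n. real (Suc n) / (x + real n)) \<longlonglongrightarrow> 1"
    proof -
      have "(\<lambda>n. 1 + (1 - x) * inverse (x + real n)) \<longlonglongrightarrow> 1 + (1 - x) * 0"
        by (intro tendsto_intros tendsto_inverse_0_at_top filterlim_tendsto_add_at_top[OF tendsto_const] filterlim_real_sequentially)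
      moreover have "1 + (1 - x) * inverse (x + real n) = real (Suc n) / (x + real n)" for n
        using assms by (simp add: field_simps)
      ultimately show ?thesis by simp
    qed
  qed
  moreover have "inverse (Gamma_series' x (Suc n)) * (real (Suc n) / (x + real n)) = ?f n" for n
  proof -
    have 1: "exp (x * ln (1 + real n)) = (real n + 1) powr x"
      by (simp add: powr_def add.commute)
    have 2: "(real n + 1) powr (1 - x) = (real n + 1) / (real n + 1) powr x"
      by (simp add: powr_diff)
    have "(real n + 1) powr x > 0" "pochhammer x n > 0" "x + real n > 0"
      using assms by (auto simp: pochhammer_pos)
    then show ?thesis
      unfolding 2 by (simp add: Gamma_series'_def pochhammer_Suc 1 divide_simps add.commute)
  qed
  ultimately have "?f \<longlonglongrightarrow> inverse (Gamma x)" by simp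
  then obtain C where C: "\<And>n. comparable C (?f n) 1"
    using comparable_of_convergent[of ?f "inverse (Gamma x)"] assms by (force simp: Gamma_real_pos pochhammer_pos)
  have "comparable (C * 1) (?f n * (real n + 1) powr (x - 1)) (1 * (real n + 1) powr (x - 1))" for n
    by (rule comparable_mult[OF C comparable_refl]) auto
  moreover have "?f n * (real n + 1) powr (x - 1) = pochhammer x n / fact n" for n
    by (simp add: mult.assoc powr_add[symmetric])
  ultimately show ?thesis by (simp only: mult_1 mult_1_right) blast
qed

lemma neg_binomial_sums:
  fixes x y :: real
  assumes "\<bar>y\<bar> < 1"
  shows "(\<lambda>n. pochhammer x n / fact n * y ^ n) sums (1 - y) powr (-x)"
proof -
  have "(\<lambda>n. ((-x) gchoose n) * (-y) ^ n) sums (1 + - y) powr (-x)"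
    using assms by (intro gen_binomial_real) auto
  moreover have "((-x) gchoose n) * (-y) ^ n = pochhammer x n / fact n * y ^ n" for n
  proof -
    have "(-y) ^ n = (-1) ^ n * y ^ n" by (rule power_minus)
    moreover have "(-1 :: real) ^ n * (-1) ^ n = 1" by (simp flip: power_mult_distrib)
    ultimately show ?thesis by (simp add: gbinomial_pochhammer)
  qed
  ultimately show ?thesis by simp
qed

text \<open>Replacing \<open>(n + 1) powr c\<close> by \<open>pochhammer (c + 1) n / fact n\<close>
  turns the series into a negative binomial series, whose sum is explicit.\<close>

lemma power_series_powr_comparable:
  fixes c :: real
  assumes "c > -1"
  shows "\<exists>C. \<forall>x. 0 \<le> x \<longrightarrow> x < 1 \<longrightarrow> summable (\<lambda>n. x ^ n * (real n + 1) powr c) \<and>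
           comparable C (\<Sum>n. x ^ n * (real n + 1) powr c) ((1 - x) powr (- c - 1))"
proof -
  obtain C where C: "\<And>n. comparable C (pochhammer (c + 1) n / fact n) ((real n + 1) powr c)"
    using pochhammer_fact_comparable[of "c + 1"] assms by auto
  have "summable (\<lambda>n. x ^ n * (real n + 1) powr c) \<and>
           comparable C (\<Sum>n. x ^ n * (real n + 1) powr c) ((1 - x) powr (- c - 1))" if x: "0 \<le> x" "x < 1" for x
  proof -
    have s: "(\<lambda>n. pochhammer (c + 1) n / fact n * x ^ n) sums (1 - x) powr (-(c+1))"
      by (rule neg_binomial_sums) (use x in auto)
    have "comparable (1 * C) (x ^ n * (real n + 1) powr c) (x ^ n * (pochhammer (c + 1) n / fact n))" for n
      by (intro comparable_mult comparable_refl comparable_sym[OF C]) (use x in auto)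
    then have "comparable C (x ^ n * (real n + 1) powr c) (pochhammer (c + 1) n / fact n * x ^ n)" for n
      by (simp add: mult.commute)
    from comparable_suminf[OF this sums_summable[OF s]] show ?thesis
      using sums_unique[OF s] by (simp add: add.commute[of c] minus_diff_commute)
  qed
  then show ?thesis by blast
qed

subsection \<open>The Jacobi operator on polynomials\<close>

text \<open>Jacobi's differential operator in the variable
  \<open>x = (1 - cos \<theta>) / 2\<close>, where it is the hypergeometric operator on the unit
  interval.\<close>

definition jacobi_op :: "real \<Rightarrow> real \<Rightarrow> real poly \<Rightarrow> real poly" where
  "jacobi_op a b p = [:0, 1, -1:] * pderiv (pderiv p) + [:a + 1, - (a + b + 2):] * pderiv p"

lemma coeff_jacobi_op:
  "coeff (jacobi_op a b p) j =
     (real j + 1) * (real j + 1 + a) * coeff p (Suc j) - real j * (real j + a + b + 1) * coeff p j"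
proof (cases j)
  case 0
  then show ?thesis by (simp add: jacobi_op_def coeff_pderiv)
next
  case (Suc i)
  then show ?thesis
    by (cases i) (simp_all add: jacobi_op_def coeff_pderiv algebra_simps)
qed

lemma jacobi_op_add: "jacobi_op a b (p + q) = jacobi_op a b p + jacobi_op a b q"
  and jacobi_op_diff: "jacobi_op a b (p - q) = jacobi_op a b p - jacobi_op a b q"
  and jacobi_op_smult: "jacobi_op a b (smult c p) = smult c (jacobi_op a b p)"
  and jacobi_op_0: "jacobi_op a b 0 = 0"
  by (auto intro!: poly_eqI simp: coeff_jacobi_op algebra_simps)

lemma jacobi_op_sum: "jacobi_op a b (\<Sum>i\<in>I. f i) = (\<Sum>i\<in>I. jacobi_op a b (f i))"
  by (induction I rule: infinite_finite_induct) (simp_all add: jacobi_op_0 jacobi_op_add)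

text \<open>In the coefficient recursion at the singular point 0 the factor
  \<open>(j + 1) * (j + 1 + a)\<close> never vanishes for \<open>a > -1\<close>, so the constant
  term determines an eigenpolynomial.\<close>

lemma jacobi_op_unique_0:
  assumes "jacobi_op a b p = smult l p" "poly p 0 = 0" "a > -1"
  shows "p = 0"
proof -
  have "coeff p j = 0" for j
  proof (induction j)
    case 0
    then show ?case using assms by (simp add: poly_0_coeff_0)
  next
    case (Suc j)
    have "coeff (jacobi_op a b p) j = l * coeff p j" using assms by simp
    then have "(real j + 1) * (real j + 1 + a) * coeff p (Suc j) = 0"
      unfolding coeff_jacobi_op Suc by simp
    then show ?case using assms by simp
  qed
  then show ?thesis by (simp add: poly_eq_iff)
qed

text \<open>Carries the uniqueness at 0 over to the endpoint 1, with \<open>a\<close> and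
  \<open>b\<close> exchanged.\<close>

lemma jacobi_op_reflect:
  "jacobi_op b a (pcompose p [:1, -1:]) = pcompose (jacobi_op a b p) [:1, -1:]"
  by (intro poly_ext)
    (simp add: jacobi_op_def pderiv_pcompose pderiv_pCons pcompose_add pcompose_mult pcompose_pCons
      poly_pcompose pderiv_mult pderiv_minus algebra_simps)

lemma jacobi_op_unique_1:
  assumes "jacobi_op a b p = smult l p" "poly p 1 = 0" "b > -1"
  shows "p = 0"
proof -
  have *: "pcompose p [:1, -1:] = 0"
    by (rule jacobi_op_unique_0[where a = b and b = a and l = l])
      (use assms in \<open>simp_all add: jacobi_op_reflect pcompose_smult poly_pcompose\<close>)
  have "poly p x = 0" for x
    using arg_cong[OF *, of "\<lambda>q. poly q (1 - x)"] by (simp add: poly_pcompose)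
  then show ?thesis by (intro poly_ext) simp
qed

text \<open>Bernstein polynomials without their binomial factor. In this basis
  \<open>jacobi_op\<close> has three terms, and at either endpoint all but one member of a given
  degree vanish.\<close>

definition bern :: "nat \<Rightarrow> nat \<Rightarrow> real poly" where
  "bern m k = [:0, 1:] ^ m * [:1, -1:] ^ k"

lemma poly_bern [simp]: "poly (bern m k) x = x ^ m * (1 - x) ^ k"
  by (simp add: bern_def)

lemma pderiv_bern: "pderiv (bern m k) = smult (real m) (bern (m - 1) k) - smult (real k) (bern m (k - 1))"
  by (intro poly_ext) (simp add: bern_def pderiv_mult pderiv_power pderiv_pCons algebra_simps)

lemma jacobi_op_bern:
  "jacobi_op a b (bern m k) = smult (real m * (real m + a)) (bern (m - 1) k)
      + smult (real k * (real k + b)) (bern m (k - 1))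
      - smult ((real m + real k) * (real m + real k + a + b + 1)) (bern m k)"
proof (intro poly_ext)
  fix x
  show "poly (jacobi_op a b (bern m k)) x = poly (smult (real m * (real m + a)) (bern (m - 1) k)
      + smult (real k * (real k + b)) (bern m (k - 1))
      - smult ((real m + real k) * (real m + real k + a + b + 1)) (bern m k)) x"
    apply (cases m; cases "m - 1"; cases k; cases "k - 1")
    apply (simp_all add: jacobi_op_def pderiv_bern pderiv_diff pderiv_minus pderiv_smult del: power_Suc)
    apply (simp_all add: algebra_simps)?
    done
qed

text \<open>The lower-degree terms of \<open>jacobi_op_bern\<close> are raised by
  \<open>1 = x + (1 - x)\<close>, so that the total degree \<open>m + k\<close> is kept. This form
  suits \<open>jacobi_sin\<close>, which is homogeneous; the degree-lowering form suits
  \<open>bailey_poly\<close>, where it leads from level \<open>Suc N\<close> to level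
  \<open>N\<close>.\<close>

lemma jacobi_op_bern_homogeneous:
  "jacobi_op a b (bern m k) = smult (real m * (real m + a)) (bern (m - 1) (k + 1))
      + smult (real k * (real k + b)) (bern (m + 1) (k - 1))
      - smult (2 * real m * real k + (a + 1) * real k + (b + 1) * real m) (bern m k)"
proof -
  have 1: "smult (real m * c) (bern (m - 1) k) = smult (real m * c) (bern (m - 1) (k + 1)) + smult (real m * c) (bern m k)" for c
    by (cases m; intro poly_ext) (simp_all add: algebra_simps)
  have 2: "smult (real k * c) (bern m (k - 1)) = smult (real k * c) (bern (m + 1) (k - 1)) + smult (real k * c) (bern m k)" for c
    by (cases k; intro poly_ext) (simp_all add: algebra_simps)
  show ?thesis
    unfolding jacobi_op_bern 1 2 by (intro poly_ext) (simp add: algebra_simps)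
qed

lemma sum_atMost_drop_0: "f 0 = 0 \<Longrightarrow> (\<Sum>k\<le>n. f k) = (\<Sum>k<n. f (Suc k))"
  for f :: "nat \<Rightarrow> 'a::comm_monoid_add"
  by (metis add.left_neutral lessThan_Suc_atMost sum.lessThan_Suc_shift)

lemma sum_atMost_drop_last: "f n = 0 \<Longrightarrow> (\<Sum>k\<le>n. f k) = (\<Sum>k<n. f k)"
  for f :: "nat \<Rightarrow> 'a::comm_monoid_add"
  by (simp flip: lessThan_Suc_atMost)

section \<open>Jacobi polynomials in the Bernstein basis\<close>

definition jacobi_coeff :: "real \<Rightarrow> real \<Rightarrow> nat \<Rightarrow> nat \<Rightarrow> real" where
  "jacobi_coeff a b n k = (-1) ^ k * ((real n + a) gchoose (n - k)) * ((real n + b) gchoose k)"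

text \<open>At \<open>cos \<theta> = 1 - 2 * x\<close> the two linear factors of the classical sum
  become \<open>- x\<close> and \<open>1 - x\<close>, so the Jacobi polynomial is a combination of
  Bernstein polynomials of the single degree \<open>n\<close>.\<close>

definition jacobi_sin :: "real \<Rightarrow> real \<Rightarrow> nat \<Rightarrow> real poly" where
  "jacobi_sin a b n = (\<Sum>k\<le>n. smult (jacobi_coeff a b n k) (bern k (n - k)))"

lemma poly_jacobi_poly: "poly (jacobi_poly a b n) (1 - 2 * x) = poly (jacobi_sin a b n) x"
proof -
  have "poly [:-1/2, 1/2:] (1 - 2 * x) ^ k = (-1) ^ k * x ^ k" "poly [:1/2, 1/2:] (1 - 2 * x) ^ k = (1 - x) ^ k" for k
    by (simp_all add: field_simps flip: power_mult_distrib)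
  then show ?thesis
    unfolding jacobi_poly_def jacobi_sin_def jacobi_coeff_def poly_sum poly_smult poly_mult poly_power
    by (simp add: ac_simps)
qed

lemma gbinomial_Suc_mult: "(a gchoose Suc j) * real (Suc j) = (a - real j) * (a gchoose j)" for a :: real
  using gbinomial_mult_1[of a j] by (simp add: algebra_simps)

text \<open>Makes the two off-diagonal parts of \<open>jacobi_op_bern_homogeneous\<close> fall back
  onto the diagonal after summation.\<close>

lemma jacobi_coeff_Suc:
  assumes "k < n"
  shows "jacobi_coeff a b n (Suc k) * (real (Suc k) * (real (Suc k) + a)) =
         - (jacobi_coeff a b n k * (real (n - k) * (real (n - k) + b)))"
proof -
  obtain j where j: "n - k = Suc j" "n - Suc k = j" "n = k + Suc j"
    using assms by (metis Suc_diff_Suc le_add_diff_inverse less_imp_le)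
  have "((real n + a) gchoose Suc j) * real (Suc j) = (a + real (Suc k)) * ((real n + a) gchoose j)"
    unfolding gbinomial_Suc_mult using j by simp
  moreover have "((real n + b) gchoose Suc k) * real (Suc k) = (real (n - k) + b) * ((real n + b) gchoose k)"
    unfolding gbinomial_Suc_mult using j by simp
  ultimately have "(a + real (Suc k)) * ((real n + a) gchoose j) * (((real n + b) gchoose Suc k) * real (Suc k)) =
      ((real n + a) gchoose Suc j) * real (Suc j) * ((real (n - k) + b) * ((real n + b) gchoose k))"
    by simp
  then show ?thesis
    unfolding jacobi_coeff_def j(1) j(2) power_Suc by (simp add: ac_simps del: of_nat_Suc)
qed

text \<open>Once the off-diagonal sums are shifted back, \<open>bern k j\<close> with
  \<open>n = k + j\<close> carries the factor \<open>- k * (k + a) - j * (j + b) - 2 * k * j - (a +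
  1) * j - (b + 1) * k\<close>, which depends on \<open>n\<close> only.\<close>

lemma jacobi_op_jacobi_sin:
  "jacobi_op a b (jacobi_sin a b n) = smult (- (real n * (real n + a + b + 1))) (jacobi_sin a b n)"
proof -
  let ?d = "jacobi_coeff a b n"
  have 1: "(\<Sum>k\<le>n. smult (?d k * (real k * (real k + a))) (bern (k - 1) (n - k + 1))) =
        (\<Sum>k\<le>n. smult (- (?d k * (real (n - k) * (real (n - k) + b)))) (bern k (n - k)))"
    by (subst sum_atMost_drop_0, simp, subst sum_atMost_drop_last, simp, intro sum.cong refl)
      (simp only: jacobi_coeff_Suc lessThan_iff, simp add: Suc_diff_Suc)
  have 2: "(\<Sum>k\<le>n. smult (?d k * (real (n - k) * (real (n - k) + b))) (bern (k + 1) (n - k - 1))) =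
        (\<Sum>k\<le>n. smult (- (?d k * (real k * (real k + a)))) (bern k (n - k)))"
    by (subst sum_atMost_drop_last, simp, subst sum_atMost_drop_0, simp, intro sum.cong refl)
      (simp only: jacobi_coeff_Suc lessThan_iff, simp)
  have "jacobi_op a b (jacobi_sin a b n) = 
     (\<Sum>k\<le>n. smult (?d k * (real k * (real k + a))) (bern (k - 1) (n - k + 1)))
   + (\<Sum>k\<le>n. smult (?d k * (real (n - k) * (real (n - k) + b))) (bern (k + 1) (n - k - 1)))
   - (\<Sum>k\<le>n. smult (?d k * (2 * real k * real (n - k) + (a + 1) * real (n - k) + (b + 1) * real k)) (bern k (n - k)))"
    unfolding jacobi_sin_def jacobi_op_sum jacobi_op_smult jacobi_op_bern_homogeneous
    by (simp add: smult_diff_right smult_add_right sum.distrib sum_subtractf)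
  also have "\<dots> = (\<Sum>k\<le>n. smult (- (real n * (real n + a + b + 1))) (smult (?d k) (bern k (n - k))))"
    unfolding 1 2 sum.distrib[symmetric] sum_subtractf[symmetric]
  proof (intro sum.cong refl, goal_cases)
    case (1 k)
    then obtain j where "n = k + j" by (metis atMost_iff le_Suc_ex)
    then show ?case by (intro poly_ext) (simp add: algebra_simps)
  qed
  also have "\<dots> = smult (- (real n * (real n + a + b + 1))) (jacobi_sin a b n)"
    unfolding jacobi_sin_def by (intro poly_ext) (simp add: poly_sum sum_distrib_left sum_negf ac_simps)
  finally show ?thesis .
qed

subsection \<open>Bailey's expansion\<close>

definition bailey_coeff :: "real \<Rightarrow> real \<Rightarrow> nat \<Rightarrow> nat \<Rightarrow> real" where
  "bailey_coeff a b m k = pochhammer (a + b + 2) (2 * (m + k)) /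
     (pochhammer (a + 1) m * fact m * (pochhammer (b + 1) k * fact k))"

text \<open>The \<open>e N\<close> of the overview, kept as a polynomial in \<open>x\<close> with
  \<open>y\<close> as a parameter so that \<open>jacobi_op\<close> can act on it.\<close>

definition bailey_poly :: "real \<Rightarrow> real \<Rightarrow> nat \<Rightarrow> real \<Rightarrow> real poly" where
  "bailey_poly a b N y =
     (\<Sum>m\<le>N. smult (bailey_coeff a b m (N - m) * (y ^ m * (1 - y) ^ (N - m))) (bern m (N - m)))"

lemma poly_bailey_poly:
  "poly (bailey_poly a b N y) x =
     (\<Sum>m\<le>N. bailey_coeff a b m (N - m) * (x * y) ^ m * ((1 - x) * (1 - y)) ^ (N - m))"
  by (simp add: bailey_poly_def poly_sum power_mult_distrib ac_simps)

text \<open>The factor on the right depends on \<open>m + k\<close> alone, so raising either index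
  yields the same one; this lets the two lowered sums of the next recursion merge.\<close>

lemma bailey_coeff_Suc_left:
  assumes "a > -1" "b > -1"
  shows "bailey_coeff a b (Suc m) k * (real (Suc m) * (real (Suc m) + a)) =
     (2 * real (m + k) + a + b + 2) * (2 * real (m + k) + a + b + 3) * bailey_coeff a b m k"
proof -
  have "a + 1 + real m \<noteq> 0" "pochhammer (a + 1) m \<noteq> 0" "pochhammer (b + 1) k \<noteq> 0"
    using assms by (auto simp: pochhammer_eq_0_iff)
  then show ?thesis
    by (simp add: bailey_coeff_def pochhammer_Suc divide_simps del: of_nat_Suc)
      (simp add: algebra_simps)
qed

lemma bailey_coeff_swap: "bailey_coeff a b m k = bailey_coeff b a k m"
  by (simp add: bailey_coeff_def ac_simps)

lemma bailey_coeff_Suc_right: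
  assumes "a > -1" "b > -1"
  shows "bailey_coeff a b m (Suc k) * (real (Suc k) * (real (Suc k) + b)) =
     (2 * real (m + k) + a + b + 2) * (2 * real (m + k) + a + b + 3) * bailey_coeff a b m k"
  using bailey_coeff_Suc_left[OF assms(2,1), of k m] unfolding bailey_coeff_swap[of a]
  by (simp add: ac_simps)

text \<open>Lowering \<open>m\<close> contributes \<open>y\<close> times a multiple of level
  \<open>N\<close>, lowering \<open>k\<close> contributes \<open>1 - y\<close> times the same
  multiple, and the two add up to that multiple.\<close>

lemma jacobi_op_bailey_poly_Suc:
  assumes "a > -1" "b > -1"
  shows "jacobi_op a b (bailey_poly a b (Suc N) y) =
     smult ((2 * real N + a + b + 2) * (2 * real N + a + b + 3)) (bailey_poly a b N y)
     - smult (real (Suc N) * (real (Suc N) + a + b + 1)) (bailey_poly a b (Suc N) y)"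
proof -
  let ?c = "\<lambda>m k. bailey_coeff a b m k * (y ^ m * (1 - y) ^ k)"
  let ?n = "Suc N"
  let ?q = "(2 * real N + a + b + 2) * (2 * real N + a + b + 3)"
  have 1: "(\<Sum>m\<le>?n. smult (?c m (?n - m) * (real m * (real m + a))) (bern (m - 1) (?n - m))) =
      (\<Sum>m\<le>N. smult (?q * y * ?c m (N - m)) (bern m (N - m)))"
  proof (subst sum_atMost_drop_0, simp, unfold lessThan_Suc_atMost, intro sum.cong refl, goal_cases)
    case (1 m)
    have "?c (Suc m) (N - m) * (real (Suc m) * (real (Suc m) + a)) = ?q * y * ?c m (N - m)"
      using bailey_coeff_Suc_left[OF assms, of m "N - m"] 1 by (simp add: ac_simps)
    then show ?case by (simp only: diff_Suc_Suc diff_Suc_1)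
  qed
  have 2: "(\<Sum>m\<le>?n. smult (?c m (?n - m) * (real (?n - m) * (real (?n - m) + b))) (bern m (?n - m - 1))) =
      (\<Sum>m\<le>N. smult (?q * (1 - y) * ?c m (N - m)) (bern m (N - m)))"
  proof (subst sum_atMost_drop_last, simp, unfold lessThan_Suc_atMost, intro sum.cong refl, goal_cases)
    case (1 m)
    then have m: "?n - m = Suc (N - m)" by simp
    have "?c m (Suc (N - m)) * (real (Suc (N - m)) * (real (Suc (N - m)) + b)) = ?q * (1 - y) * ?c m (N - m)"
      using bailey_coeff_Suc_right[OF assms, of m "N - m"] 1 by (simp add: ac_simps)
    then show ?case unfolding m by (simp only: diff_Suc_1)
  qed
  have "jacobi_op a b (bailey_poly a b ?n y) =
      (\<Sum>m\<le>?n. smult (?c m (?n - m) * (real m * (real m + a))) (bern (m - 1) (?n - m)))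
    + (\<Sum>m\<le>?n. smult (?c m (?n - m) * (real (?n - m) * (real (?n - m) + b))) (bern m (?n - m - 1)))
    - (\<Sum>m\<le>?n. smult (?c m (?n - m) * ((real m + real (?n - m)) * (real m + real (?n - m) + a + b + 1))) (bern m (?n - m)))"
    unfolding bailey_poly_def jacobi_op_sum jacobi_op_smult jacobi_op_bern
    by (simp add: smult_diff_right smult_add_right sum.distrib sum_subtractf del: sum.atMost_Suc)
  also have "(\<Sum>m\<le>?n. smult (?c m (?n - m) * ((real m + real (?n - m)) * (real m + real (?n - m) + a + b + 1))) (bern m (?n - m)))
     = smult (real ?n * (real ?n + a + b + 1)) (bailey_poly a b ?n y)"
    unfolding bailey_poly_def by (intro poly_ext)
      (auto simp: poly_sum sum_distrib_left of_nat_diff ac_simps simp del: sum.atMost_Suc intro!: sum.cong)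
  also have "(\<Sum>m\<le>?n. smult (?c m (?n - m) * (real m * (real m + a))) (bern (m - 1) (?n - m)))
    + (\<Sum>m\<le>?n. smult (?c m (?n - m) * (real (?n - m) * (real (?n - m) + b))) (bern m (?n - m - 1)))
     = smult ?q (bailey_poly a b N y)"
  proof -
    have "smult (q * y * c) p + smult (q * (1 - y) * c) p = smult (q * c) p" for q c and p :: "real poly"
      by (intro poly_ext) (simp add: algebra_simps)
    then show ?thesis
      unfolding 1 2 bailey_poly_def sum.distrib[symmetric]
      by (simp only:) (intro poly_ext, simp only: poly_sum poly_smult sum_distrib_left mult.assoc)
  qed
  finally show ?thesis .
qed

section \<open>Symmetry and values at opposite endpoints\<close>

lemma poly_bailey_poly_sym: "poly (bailey_poly a b N y) x = poly (bailey_poly a b N x) y"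
  unfolding poly_bailey_poly by (simp add: ac_simps)

text \<open>At opposite endpoints both \<open>x * y\<close> and \<open>(1 - x) * (1 - y)\<close>
  vanish, which removes every level except 0. The same point later fixes the constant in Bailey's
  formula.\<close>

lemma poly_bailey_poly_1_0: "poly (bailey_poly a b N 1) 0 = (if N = 0 then 1 else 0)"
  unfolding poly_bailey_poly by (auto simp: bailey_coeff_def power_0_left intro!: sum.neutral)

text \<open>Up to the factor \<open>Beta (a + 1) (b + 1)\<close> this is the reciprocal of the
  squared norm of the \<open>n\<close>-th Jacobi polynomial, see
  \<open>integral_jacobi_sin_square\<close>. In Pochhammer form the last factor is an empty product
  at \<open>n = 0\<close>, so \<open>a + b + 1 \<le> 0\<close> causes no trouble there.\<close>

definition bailey_weight :: "real \<Rightarrow> real \<Rightarrow> nat \<Rightarrow> real" where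
  "bailey_weight a b n = pochhammer (a + b + 2) (2 * n) * fact n /
     (pochhammer (a + 1) n * pochhammer (b + 1) n * pochhammer (real n + a + b + 1) n)"

definition jacobi_prod :: "real \<Rightarrow> real \<Rightarrow> nat \<Rightarrow> real \<Rightarrow> real \<Rightarrow> real" where
  "jacobi_prod a b n x y = bailey_weight a b n * poly (jacobi_sin a b n) x * poly (jacobi_sin a b n) y"

lemma poly_jacobi_sin_0: "poly (jacobi_sin a b n) 0 = pochhammer (a + 1) n / fact n"
proof -
  have "poly (jacobi_sin a b n) 0 = (\<Sum>k\<le>n. if k = 0 then jacobi_coeff a b n k else 0)"
    unfolding jacobi_sin_def poly_sum by (intro sum.cong) (auto simp: power_0_left)
  then show ?thesis by (simp add: jacobi_coeff_def gbinomial_pochhammer' ac_simps)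
qed

lemma poly_jacobi_sin_1: "poly (jacobi_sin a b n) 1 = (-1) ^ n * pochhammer (b + 1) n / fact n"
proof -
  have "poly (jacobi_sin a b n) 1 = (\<Sum>k\<le>n. if k = n then jacobi_coeff a b n k else 0)"
    unfolding jacobi_sin_def poly_sum by (intro sum.cong) (auto simp: power_0_left)
  then show ?thesis by (simp add: jacobi_coeff_def gbinomial_pochhammer' ac_simps)
qed

text \<open>These are the Taylor coefficients of
  \<open>(1 - r) * (1 + r) powr (- (a + b + 2))\<close>. The endpoint values cancel most of the
  weight, and the surviving linear factor splits as \<open>(a + b + 2 + n) + (n + 1)\<close> into
  the two binomial coefficients.\<close>

lemma jacobi_prod_0_1:
  assumes "a > -1" "b > -1"
  shows "jacobi_prod a b 0 0 1 = 1"
    and "jacobi_prod a b (Suc n) 0 1 =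
      ((- (a + b + 2)) gchoose (Suc n)) - ((- (a + b + 2)) gchoose n)"
proof -
  show "jacobi_prod a b 0 0 1 = 1"
    by (simp add: jacobi_prod_def bailey_weight_def poly_jacobi_sin_0 poly_jacobi_sin_1)
  let ?s = "a + b + 2"
  let ?P = "pochhammer (?s + real n) (Suc n)"
  have pos: "pochhammer (a + 1) (Suc n) > 0" "pochhammer (b + 1) (Suc n) > 0" "?P > 0"
    using assms by (auto intro!: pochhammer_pos)
  have P: "pochhammer (real (Suc n) + a + b + 1) (Suc n) = ?P" by (simp add: add_ac)
  have "pochhammer ?s (2 * Suc n) = pochhammer ?s (n + Suc (Suc n))" by (rule arg_cong) simp
  also have "\<dots> = pochhammer ?s n * (?P * (?s + real n + real (Suc n)))"
    by (simp only: pochhammer_product' pochhammer_Suc) 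
  finally have 2: "pochhammer ?s (2 * Suc n) = pochhammer ?s n * (?P * (?s + real n + real (Suc n)))" .
  have "jacobi_prod a b (Suc n) 0 1 = (-1) ^ Suc n * pochhammer ?s n * (?s + real n + real (Suc n)) / fact (Suc n)"
    unfolding jacobi_prod_def bailey_weight_def poly_jacobi_sin_0 poly_jacobi_sin_1 2 P
    using pos by (simp add: divide_simps del: fact_Suc power_Suc)
  also have "\<dots> = (-1) ^ Suc n * pochhammer ?s (Suc n) / fact (Suc n) - (-1) ^ n * pochhammer ?s n / fact n"
    by (simp add: pochhammer_Suc divide_simps) (simp add: algebra_simps)
  finally show "jacobi_prod a b (Suc n) 0 1 =
      ((- (a + b + 2)) gchoose (Suc n)) - ((- (a + b + 2)) gchoose n)"
    unfolding gbinomial_pochhammer minus_minus by simp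
qed

text \<open>Only \<open>m = N\<close> is wanted, where the factor \<open>real (N - m)\<close> makes
  the sum vanish; the closed form for all partial sums is what an induction can prove.\<close>

lemma bailey_expansion_0_1:
  assumes "a > -1" "b > -1" "N > 0" "m \<le> N"
  shows "real N * (\<Sum>n\<le>m. ((2 * real N + a + b + 1) gchoose (N - n)) * jacobi_prod a b n 0 1) =
     ((- (a + b + 2)) gchoose m) * real (N - m) * ((2 * real N + a + b + 1) gchoose (N - m))"
  using assms(4)
proof (induction m)
  case 0
  then show ?case using jacobi_prod_0_1[OF assms(1,2)] by simp
next
  case (Suc m)
  let ?a = "2 * real N + a + b + 1"
  let ?c = "\<lambda>m. (- (a + b + 2)) gchoose m"
  have j: "N - m = Suc (N - Suc m)" using Suc by simp
  have 1: "(?a gchoose (N - m)) * real (N - m) = (real N + real m + a + b + 2) * (?a gchoose (N - Suc m))"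
    unfolding j gbinomial_Suc_mult using Suc by (simp add: of_nat_diff)
  have 2: "?c (Suc m) * real (Suc m) = (- (a + b + 2) - real m) * ?c m"
    by (rule gbinomial_Suc_mult)
  have "real N * (\<Sum>n\<le>Suc m. (?a gchoose (N - n)) * jacobi_prod a b n 0 1)
      = ?c m * ((?a gchoose (N - m)) * real (N - m)) + real N * ((?a gchoose (N - Suc m)) * (?c (Suc m) - ?c m))"
    using Suc unfolding sum.atMost_Suc distrib_left jacobi_prod_0_1(2)[OF assms(1,2)] by (simp only: Suc_leD ac_simps)
  also have "\<dots> = (?a gchoose (N - Suc m)) * (?c m * (real m + a + b + 2) + real N * ?c (Suc m))"
    unfolding 1 by (simp add: algebra_simps)
  also have "?c m * (real m + a + b + 2) = - (?c (Suc m) * real (Suc m))"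
    unfolding 2 by (simp add: algebra_simps)
  also have "(?a gchoose (N - Suc m)) * (- (?c (Suc m) * real (Suc m)) + real N * ?c (Suc m)) =
     ?c (Suc m) * real (N - Suc m) * (?a gchoose (N - Suc m))"
    using Suc by (simp add: of_nat_diff algebra_simps)
  finally show ?case .
qed

text \<open>Going down one level lowers the upper index by two. The factor on the left will be the
  difference of two Jacobi eigenvalues.\<close>

lemma gbinomial_shift2:
  "(a gchoose Suc j) * (real (Suc j) * (a - real (Suc j))) = a * (a - 1) * ((a - 2) gchoose j)" for a :: real
proof -
  have "real (Suc j) * (a gchoose Suc j) = a * ((a - 1) gchoose j)" by (rule gbinomial_absorption)
  moreover have "(a - 1 - real j) * ((a - 1) gchoose j) = (a - 1) * ((a - 1 - 1) gchoose j)"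
    by (rule gbinomial_absorb_comp)
  moreover have "a - 1 - real j = a - real (Suc j)" "a - 1 - 1 = a - 2" by simp_all
  ultimately have "real (Suc j) * (a gchoose Suc j) * (a - real (Suc j)) = a * ((a - 1) * ((a - 2) gchoose j))"
    by (metis mult.assoc mult.commute)
  then show ?thesis by (simp add: ac_simps)
qed

text \<open>Both sides satisfy the same recursion in \<open>N\<close> under the Jacobi operator, in either variable, and a
  polynomial solution is determined by its value at an endpoint; so it suffices to compare the
  values at \<open>x = 0\<close>, \<open>y = 1\<close>.\<close>

theorem bailey_expansion:
  assumes "a > -1" "b > -1"
  shows "poly (bailey_poly a b N y) x =
     (\<Sum>n\<le>N. ((2 * real N + a + b + 1) gchoose (N - n)) * jacobi_prod a b n x y)"
proof -
  let ?b = "\<lambda>N n. (2 * real N + a + b + 1) gchoose (N - n)"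
  let ?J = "jacobi_sin a b"
  let ?l = "\<lambda>n. real n * (real n + a + b + 1)"
  define T where "T N y = (\<Sum>n\<le>N. smult (?b N n * bailey_weight a b n * poly (?J n) y) (?J n))" for N y
  define D where "D N y = bailey_poly a b N y - T N y" for N y
  have poly_T: "poly (T N y) x = (\<Sum>n\<le>N. ?b N n * jacobi_prod a b n x y)" for N x y
    by (simp add: T_def poly_sum jacobi_prod_def ac_simps)
  have D_sym: "poly (D N y) x = poly (D N x) y" for N x y
    unfolding D_def poly_diff poly_T poly_bailey_poly_sym[of _ _ _ x] by (simp add: jacobi_prod_def ac_simps)
  have D01: "poly (D N 1) 0 = 0" for N
  proof (cases "N = 0")
    case True
    then show ?thesis using jacobi_prod_0_1[OF assms] by (simp add: D_def poly_T poly_bailey_poly_1_0)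
  next
    case False
    then have "real N * poly (T N 1) 0 = 0"
      using bailey_expansion_0_1[OF assms, of N N] unfolding poly_T by simp
    then show ?thesis using False by (simp add: D_def poly_bailey_poly_1_0)
  qed
  \<comment> \<open>Uniqueness is used twice. At \<open>y = 1\<close> the value at
    \<open>x = 0\<close> is known, so \<open>D N 1\<close> vanishes identically; by symmetry every
    \<open>D N y\<close> then vanishes at \<open>x = 1\<close>, which is the condition at the other
    endpoint.\<close>
  have eigen_0: "D N y = 0" if eq: "\<And>y. jacobi_op a b (D N y) = smult (- ?l N) (D N y)" for N y
  proof -
    have "D N 1 = 0" by (rule jacobi_op_unique_0[OF eq D01 assms(1)])
    then have "poly (D N y) 1 = 0" using D_sym[of N y 1] by simp
    then show ?thesis by (rule jacobi_op_unique_1[OF eq _ assms(2)])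
  qed
  have T_Suc: "jacobi_op a b (T (Suc N) y) = 
     smult ((2 * real N + a + b + 2) * (2 * real N + a + b + 3)) (T N y) - smult (?l (Suc N)) (T (Suc N) y)" for N y
  proof -
    let ?w = "\<lambda>n. bailey_weight a b n * poly (?J n) y"
    \<comment> \<open>The eigenvalues differ by
      \<open>(Suc N - n) * (Suc N + n + a + b + 1)\<close>, the two factors that
      \<open>gbinomial_shift2\<close> absorbs.\<close>
    have c: "?b (Suc N) n * (?l (Suc N) - ?l n) =
        (2 * real N + a + b + 2) * (2 * real N + a + b + 3) * ?b N n" if "n \<le> N" for n
    proof -
      have "Suc N - n = Suc (N - n)" using that by simp
      moreover have "?l (Suc N) - ?l n = real (Suc (N - n)) * (2 * real (Suc N) + a + b + 1 - real (Suc (N - n)))"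
        using that by (simp add: of_nat_diff algebra_simps)
      moreover have "2 * real (Suc N) + a + b + 1 - 2 = 2 * real N + a + b + 1" by simp
      moreover have "(2 * real (Suc N) + a + b + 1) * (2 * real (Suc N) + a + b + 1 - 1) = 
          (2 * real N + a + b + 2) * (2 * real N + a + b + 3)" by (simp add: algebra_simps)
      ultimately show ?thesis using gbinomial_shift2[of "2 * real (Suc N) + a + b + 1" "N - n"] by metis
    qed
    have "jacobi_op a b (T (Suc N) y) + smult (?l (Suc N)) (T (Suc N) y) =
       (\<Sum>n\<le>Suc N. smult (?b (Suc N) n * (?l (Suc N) - ?l n) * ?w n) (?J n))"
      unfolding T_def jacobi_op_sum jacobi_op_smult jacobi_op_jacobi_sin
      by (intro poly_ext)
        (simp add: poly_sum sum_distrib_left sum.distrib[symmetric] sum_negf[symmetric] algebra_simps del: sum.atMost_Suc of_nat_Suc)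
    \<comment> \<open>The top term \<open>n = Suc N\<close> drops out because its eigenvalue
      difference is zero.\<close>
    also have "\<dots> = (\<Sum>n\<le>N. smult (?b (Suc N) n * (?l (Suc N) - ?l n) * ?w n) (?J n))"
      by simp
    also have "\<dots> = (\<Sum>n\<le>N. smult ((2 * real N + a + b + 2) * (2 * real N + a + b + 3) * ?b N n * ?w n) (?J n))"
      by (intro sum.cong refl) (simp only: c atMost_iff)
    also have "\<dots> = smult ((2 * real N + a + b + 2) * (2 * real N + a + b + 3)) (T N y)"
      unfolding T_def by (intro poly_ext) (simp add: poly_sum sum_distrib_left ac_simps)
    finally show ?thesis by (simp add: eq_diff_eq)
  qed
  have "D N y = 0" for y
  proof (induction N arbitrary: y)
    case 0
    have "jacobi_op a b (D 0 y) = smult (- ?l 0) (D 0 y)" for y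
      by (simp add: D_def T_def bailey_poly_def jacobi_sin_def bern_def jacobi_op_def pderiv_smult flip: one_pCons)
    then show ?case by (rule eigen_0)
  next
    case (Suc N)
    have "jacobi_op a b (D (Suc N) y) = smult (- ?l (Suc N)) (D (Suc N) y)" for y
    proof -
      have "bailey_poly a b N y = T N y" using Suc[of y] by (simp add: D_def)
      then show ?thesis
        unfolding D_def jacobi_op_diff jacobi_op_bailey_poly_Suc[OF assms] T_Suc 
        by (simp add: smult_diff_right)
    qed
    then show ?case by (rule eigen_0)
  qed
  then have "bailey_poly a b N y = T N y" by (simp add: D_def)
  then show ?thesis by (simp add: poly_T)
qed

subsection \<open>Summation of the expansion\<close>

text \<open>The explicit test is needed because \<open>N - n\<close> truncates to 0 for
  \<open>n > N\<close>, where the binomial would be 1. Extension by zero makes Pascal's rule hold at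
  every \<open>N\<close> and allows sums over squares of indices.\<close>

definition shifted_binom :: "real \<Rightarrow> nat \<Rightarrow> nat \<Rightarrow> real" where
  "shifted_binom s N n = (if n \<le> N then (2 * real N + s) gchoose (N - n) else 0)"

lemma shifted_binom_nonneg: "s > -1 \<Longrightarrow> 0 \<le> shifted_binom s N n"
  unfolding shifted_binom_def gbinomial_pochhammer'
  by (auto intro!: divide_nonneg_nonneg less_imp_le[OF pochhammer_pos] simp: of_nat_diff)

text \<open>The ratio of consecutive entries is \<open>(N - n) / (N + n + s + 1)\<close>.
  Monotonicity gives the boundedness in \<open>n\<close> that excludes the growing solution of the
  recurrence for the generating functions.\<close>

lemma shifted_binom_Suc_le:
  assumes "s > -1"
  shows "shifted_binom s N (Suc n) \<le> shifted_binom s N n"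
proof (cases "Suc n \<le> N")
  case True
  then have j: "N - n = Suc (N - Suc n)" by simp
  let ?b = "shifted_binom s N (Suc n)" and ?b' = "shifted_binom s N n"
  have "?b' * real (N - n) = (real N + real n + s + 1) * ?b"
    using True gbinomial_Suc_mult[of "2 * real N + s" "N - Suc n"]
    unfolding shifted_binom_def j by (simp add: of_nat_diff algebra_simps)
  moreover have "real (N - n) * ?b \<le> (real N + real n + s + 1) * ?b"
    using True assms shifted_binom_nonneg[OF assms] by (intro mult_right_mono) (simp_all add: of_nat_diff)
  ultimately have "?b * real (N - n) \<le> ?b' * real (N - n)" by (simp add: mult.commute)
  then show ?thesis using True by (simp add: mult_le_cancel_right)
next
  case False
  then show ?thesis using shifted_binom_nonneg[OF assms, of N n] by (simp add: shifted_binom_def)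
qed

lemma shifted_binom_le_0: "s > -1 \<Longrightarrow> shifted_binom s N n \<le> shifted_binom s N 0"
  by (induction n) (auto intro: order_trans[OF shifted_binom_Suc_le])

lemma shifted_binom_Suc_Suc:
  "shifted_binom s (Suc N) (Suc n) =
     shifted_binom s N n + 2 * shifted_binom s N (Suc n) + shifted_binom s N (Suc (Suc n))"
proof -
  have a: "2 * real (Suc N) + s = (2 * real N + s) + 1 + 1" by simp
  \<comment> \<open>The cases record which of the three entries on the right lie beyond the
    truncation.\<close>
  consider "N < n" | "N = n" | "N = Suc n" | j where "N = n + Suc (Suc j)"
    by (metis One_nat_def add.right_neutral add_Suc_right less_imp_Suc_add linorder_neqE_nat not0_implies_Suc)
  then show ?thesis
  proof cases
    case 3
    then show ?thesis by (simp add: shifted_binom_def)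
  next
    case 4
    then have "N - n = Suc (Suc j)" "N - Suc n = Suc j" "N - Suc (Suc n) = j"
      "n \<le> N" "Suc n \<le> N" "Suc (Suc n) \<le> N" "Suc n \<le> Suc N" by auto
    moreover have "(2 * real N + s + 1 + 1) gchoose Suc (Suc j) = ((2 * real N + s) gchoose Suc (Suc j))
        + 2 * ((2 * real N + s) gchoose Suc j) + ((2 * real N + s) gchoose j)"
      unfolding gbinomial_Suc_Suc by simp
    ultimately show ?thesis unfolding shifted_binom_def a diff_Suc_Suc by (simp only: if_True)
  qed (auto simp: shifted_binom_def)
qed

definition shifted_binom_gf :: "real \<Rightarrow> real \<Rightarrow> nat \<Rightarrow> real" where
  "shifted_binom_gf s z n = (\<Sum>N. shifted_binom s N n * z ^ N)"

lemma summable_shifted_binom: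
  assumes "s > -1" "0 \<le> z" "summable (\<lambda>N. shifted_binom s N 0 * z ^ N)"
  shows "summable (\<lambda>N. shifted_binom s N n * z ^ N)"
proof (rule summable_comparison_test'[OF assms(3), of 0])
  show "norm (shifted_binom s N n * z ^ N) \<le> shifted_binom s N 0 * z ^ N" for N
    using shifted_binom_le_0[OF assms(1)] shifted_binom_nonneg[OF assms(1)] assms(2)
    by (auto simp: abs_mult intro!: mult_right_mono)
qed

text \<open>Pascal's rule, applied twice, is a linear recurrence in \<open>n\<close> with characteristic roots \<open>r\<close> and
  \<open>1 / r\<close>, and the generating functions are bounded in \<open>n\<close>.\<close>

lemma shifted_binom_gf_eq:
  assumes s: "s > -1" and r: "0 < r" "r < 1" and z: "z = r / (1 + r)\<^sup>2"
    and sum0: "summable (\<lambda>N. shifted_binom s N 0 * z ^ N)"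
  shows "shifted_binom_gf s z n = r ^ n * shifted_binom_gf s z 0"
proof -
  let ?w = "shifted_binom_gf s z"
  have z0: "0 \<le> z" using r z by simp
  note sm = summable_shifted_binom[OF s z0 sum0]
  have rec: "(1 + r\<^sup>2) * ?w (Suc n) = r * ?w n + r * ?w (Suc (Suc n))" for n
  proof -
    have "?w (Suc n) = (\<Sum>N. shifted_binom s (Suc N) (Suc n) * z ^ Suc N)"
      using suminf_split_head[OF sm[of "Suc n"]] by (simp add: shifted_binom_gf_def shifted_binom_def)
    also have "\<dots> = (\<Sum>N. z * (shifted_binom s N n * z ^ N + 2 * (shifted_binom s N (Suc n) * z ^ N)
           + shifted_binom s N (Suc (Suc n)) * z ^ N))"
      unfolding shifted_binom_Suc_Suc by (simp add: algebra_simps)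
    also have "\<dots> = z * (?w n + 2 * ?w (Suc n) + ?w (Suc (Suc n)))"
      unfolding shifted_binom_gf_def
      by (simp add: suminf_mult suminf_add[symmetric] sm summable_mult summable_add)
    finally have "(1 + r)\<^sup>2 * ?w (Suc n) = (1 + r)\<^sup>2 * z * (?w n + 2 * ?w (Suc n) + ?w (Suc (Suc n)))"
      by simp
    moreover have "(1 + r)\<^sup>2 * z = r" using r z by simp
    ultimately have "(1 + r)\<^sup>2 * ?w (Suc n) = r * (?w n + 2 * ?w (Suc n) + ?w (Suc (Suc n)))"
      by simp
    then show ?thesis by (simp add: power2_eq_square algebra_simps)
  qed
  \<comment> \<open>This difference isolates the component along the root \<open>1 / r\<close>.
    Moving it \<open>k\<close> steps forward costs a factor \<open>r ^ k\<close> against a bounded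
    quantity, so it must vanish.\<close>
  have step: "?w (Suc n) - r * ?w n = r * (?w (Suc (Suc n)) - r * ?w (Suc n))" for n
    using rec[of n] by (simp add: power2_eq_square algebra_simps)
  have w_nonneg: "0 \<le> ?w n" for n
    unfolding shifted_binom_gf_def by (intro suminf_nonneg sm mult_nonneg_nonneg shifted_binom_nonneg s) (use z0 in auto)
  have w_le: "?w n \<le> ?w 0" for n
    unfolding shifted_binom_gf_def
    by (intro suminf_le sm mult_right_mono shifted_binom_le_0 s) (use z0 in auto)
  have iter: "?w (Suc n) - r * ?w n = r ^ k * (?w (Suc (n + k)) - r * ?w (n + k))" for n k
  proof (induction k)
    case (Suc k)
    have "?w (Suc n) - r * ?w n = r ^ k * (?w (Suc (n + k)) - r * ?w (n + k))" by (fact Suc)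
    also have "\<dots> = r ^ Suc k * (?w (Suc (n + Suc k)) - r * ?w (n + Suc k))"
      by (simp only: step[of "n + k"] power_Suc2 mult.assoc add_Suc_right)
    finally show ?case .
  qed simp
  have zero: "?w (Suc n) - r * ?w n = 0" for n
  proof -
    have "norm (?w (Suc n) - r * ?w n) \<le> r ^ k * (2 * ?w 0)" for k
    proof -
      have "0 \<le> r * ?w (n + k)" "r * ?w (n + k) \<le> ?w (n + k)"
        using r w_nonneg[of "n + k"] by (auto intro: mult_left_le_one_le)
      then have "norm (?w (Suc (n + k)) - r * ?w (n + k)) \<le> 2 * ?w 0"
        using w_nonneg[of "Suc (n + k)"] w_le[of "Suc (n + k)"] w_le[of "n + k"] by simp
      then show ?thesis
        unfolding iter[of n k] norm_mult using r by (simp add: mult_left_mono)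
    qed
    moreover have "(\<lambda>k. r ^ k * (2 * ?w 0)) \<longlonglongrightarrow> 0"
      using r by (intro tendsto_mult_left_zero LIMSEQ_power_zero) auto
    ultimately have "norm (?w (Suc n) - r * ?w n) \<le> 0"
      by (intro LIMSEQ_le_const) auto
    then show ?thesis by simp
  qed
  show ?thesis
  proof (induction n)
    case (Suc n)
    then show ?case using zero[of n] by simp
  qed simp
qed

section \<open>Interchange of the two summations\<close>

lemma bailey_weight_pos:
  assumes "a > -1" "b > -1"
  shows "0 < bailey_weight a b n"
proof -
  have "0 < pochhammer (real n + a + b + 1) n"
  \<comment> \<open>For \<open>n = 0\<close> the base may be negative but the product is empty; from
    \<open>n = 1\<close> on the base exceeds 0.\<close>
  proof (cases n)
    case (Suc m)
    then have "0 < real n + a + b + 1" using assms by simp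
    then show ?thesis by (rule pochhammer_pos)
  qed simp
  moreover have "0 < pochhammer (a + 1) n" "0 < pochhammer (b + 1) n" "0 < pochhammer (a + b + 2) (2 * n)"
    using assms by (auto intro!: pochhammer_pos)
  ultimately show ?thesis unfolding bailey_weight_def by simp
qed

lemma bailey_weight_nonneg: "\<alpha> > -1 \<Longrightarrow> \<beta> > -1 \<Longrightarrow> 0 \<le> bailey_weight \<alpha> \<beta> n"
  by (rule less_imp_le[OF bailey_weight_pos])

lemma jacobi_prod_diag_nonneg: "a > -1 \<Longrightarrow> b > -1 \<Longrightarrow> 0 \<le> jacobi_prod a b n x x"
  using bailey_weight_nonneg[of a b n] by (simp add: jacobi_prod_def mult.assoc)

lemma jacobi_prod_0: "jacobi_prod a b 0 x y = 1"
  by (simp add: jacobi_prod_def bailey_weight_def jacobi_sin_def jacobi_coeff_def bern_def)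

text \<open>Reduces absolute convergence off the diagonal to the diagonal, where all terms are
  nonnegative.\<close>

lemma abs_jacobi_prod_le:
  assumes "a > -1" "b > -1"
  shows "\<bar>jacobi_prod a b n x y\<bar> \<le> jacobi_prod a b n x x + jacobi_prod a b n y y"
proof -
  have "\<bar>a * b\<bar> \<le> a * a + b * b" for a b :: real
  proof -
    have "2 * (\<bar>a\<bar> * \<bar>b\<bar>) \<le> a * a + b * b" "0 \<le> \<bar>a\<bar> * \<bar>b\<bar>"
      using sum_squares_bound[of "\<bar>a\<bar>" "\<bar>b\<bar>"] by (simp_all add: power2_eq_square)
    then show ?thesis unfolding abs_mult by linarith
  qed
  then have "bailey_weight a b n * \<bar>poly (jacobi_sin a b n) x * poly (jacobi_sin a b n) y\<bar> \<le>
      bailey_weight a b n * (poly (jacobi_sin a b n) x * poly (jacobi_sin a b n) x + poly (jacobi_sin a b n) y * poly (jacobi_sin a b n) y)"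
    by (intro mult_left_mono bailey_weight_nonneg[OF assms])
  then show ?thesis
    using bailey_weight_nonneg[OF assms, of n] by (simp add: jacobi_prod_def abs_mult algebra_simps)
qed

lemma bailey_expansion':
  assumes "a > -1" "b > -1" "N \<le> K"
  shows "poly (bailey_poly a b N y) x = (\<Sum>n\<le>K. shifted_binom (a + b + 1) N n * jacobi_prod a b n x y)"
proof -
  have "(\<Sum>n\<le>K. shifted_binom (a + b + 1) N n * jacobi_prod a b n x y) =
        (\<Sum>n\<le>N. shifted_binom (a + b + 1) N n * jacobi_prod a b n x y)"
    using assms(3) by (intro sum.mono_neutral_right) (auto simp: shifted_binom_def)
  also have "\<dots> = poly (bailey_poly a b N y) x"
    unfolding bailey_expansion[OF assms(1,2)] by (intro sum.cong) (auto simp: shifted_binom_def add.assoc)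
  finally show ?thesis by simp
qed

lemma sum_bailey_poly:
  assumes "a > -1" "b > -1"
  shows "(\<Sum>N\<le>K. z ^ N * poly (bailey_poly a b N y) x) =
     (\<Sum>n\<le>K. jacobi_prod a b n x y * (\<Sum>N\<le>K. shifted_binom (a + b + 1) N n * z ^ N))"
proof -
  have "(\<Sum>N\<le>K. z ^ N * poly (bailey_poly a b N y) x) =
     (\<Sum>N\<le>K. \<Sum>n\<le>K. z ^ N * (shifted_binom (a + b + 1) N n * jacobi_prod a b n x y))"
    using bailey_expansion'[OF assms] by (intro sum.cong refl) (simp add: sum_distrib_left)
  also have "\<dots> = (\<Sum>n\<le>K. \<Sum>N\<le>K. z ^ N * (shifted_binom (a + b + 1) N n * jacobi_prod a b n x y))"
    by (rule sum.swap)
  finally show ?thesis by (simp add: sum_distrib_left ac_simps)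
qed

text \<open>On the diagonal the expansion has nonnegative terms, and its term \<open>n = 0\<close>
  is the binomial itself because \<open>jacobi_prod\<close> is 1 there; so Bailey's series
  dominates.\<close>

lemma summable_shifted_binom_0:
  assumes "a > -1" "b > -1" "0 \<le> z" "summable (\<lambda>N. z ^ N * poly (bailey_poly a b N x) x)"
  shows "summable (\<lambda>N. shifted_binom (a + b + 1) N 0 * z ^ N)"
proof (rule summable_comparison_test'[OF assms(4), of 0])
  fix N
  have s: "a + b + 1 > -1" using assms by simp
  have "shifted_binom (a + b + 1) N 0 * jacobi_prod a b 0 x x \<le>
     (\<Sum>n\<le>N. shifted_binom (a + b + 1) N n * jacobi_prod a b n x x)"
    using assms by (intro member_le_sum) (auto intro!: mult_nonneg_nonneg shifted_binom_nonneg[OF s] jacobi_prod_diag_nonneg)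
  then have "z ^ N * shifted_binom (a + b + 1) N 0 \<le> z ^ N * poly (bailey_poly a b N x) x"
    unfolding bailey_expansion'[OF assms(1,2) order_refl] jacobi_prod_0 using assms(3) by (intro mult_left_mono) auto
  then show "norm (shifted_binom (a + b + 1) N 0 * z ^ N) \<le> z ^ N * poly (bailey_poly a b N x) x"
    using assms(3) shifted_binom_nonneg[OF s] by (simp add: abs_mult mult.commute)
qed

text \<open>Tonelli's argument: each finite block in \<open>n\<close>, summed over all
  \<open>N\<close>, stays below Bailey's series. Since \<open>?w n\<close> is
  \<open>r ^ n * ?w 0\<close> with \<open>?w 0 \<ge> 1\<close>, the bounded partial sums give the
  claim.\<close>

lemma summable_jacobi_prod_diag:
  assumes ab: "a > -1" "b > -1" and r: "0 < r" "r < 1" and z: "z = r / (1 + r)\<^sup>2"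
    and sm: "summable (\<lambda>N. z ^ N * poly (bailey_poly a b N x) x)"
  shows "summable (\<lambda>n. r ^ n * jacobi_prod a b n x x)"
proof -
  let ?s = "a + b + 1"
  have s: "?s > -1" using ab by simp
  have z0: "0 \<le> z" using r z by simp
  note sb = summable_shifted_binom_0[OF ab z0 sm]
  note sw = summable_shifted_binom[OF s z0 sb]
  let ?w = "shifted_binom_gf ?s z"
  let ?P = "\<lambda>n. jacobi_prod a b n x x"
  have w0: "?w 0 \<ge> 1"
  proof -
    have "(\<Sum>N<1. shifted_binom ?s N 0 * z ^ N) \<le> ?w 0"
      unfolding shifted_binom_gf_def using z0 by (intro sum_le_suminf sb) (auto intro!: mult_nonneg_nonneg shifted_binom_nonneg[OF s])
    then show ?thesis by (simp add: shifted_binom_def)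
  qed
  have nonneg: "0 \<le> z ^ N * poly (bailey_poly a b N x) x" for N
    unfolding bailey_expansion'[OF ab order_refl] using z0
    by (auto intro!: mult_nonneg_nonneg sum_nonneg shifted_binom_nonneg[OF s] jacobi_prod_diag_nonneg[OF ab])
  have part: "(\<Sum>n<K. ?P n * ?w n) \<le> (\<Sum>N. z ^ N * poly (bailey_poly a b N x) x)" for K
  proof -
    have "(\<Sum>n<K. ?P n * ?w n) = (\<Sum>n<K. \<Sum>N. ?P n * (shifted_binom ?s N n * z ^ N))"
      unfolding shifted_binom_gf_def by (simp add: suminf_mult sw)
    also have "\<dots> = (\<Sum>N. \<Sum>n<K. ?P n * (shifted_binom ?s N n * z ^ N))"
      by (intro suminf_sum[symmetric] summable_mult sw)
    also have "\<dots> \<le> (\<Sum>N. z ^ N * poly (bailey_poly a b N x) x)"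
    proof (rule suminf_le[OF _ _ sm])
      fix N
      have "(\<Sum>n<K. ?P n * (shifted_binom ?s N n * z ^ N)) \<le> (\<Sum>n\<le>max N K. ?P n * (shifted_binom ?s N n * z ^ N))"
        using z0 by (intro sum_mono2) (auto intro!: mult_nonneg_nonneg shifted_binom_nonneg[OF s] jacobi_prod_diag_nonneg[OF ab])
      also have "\<dots> = z ^ N * poly (bailey_poly a b N x) x"
        unfolding bailey_expansion'[OF ab max.cobounded1[of N K]] sum_distrib_left by (simp add: ac_simps)
      finally show "(\<Sum>n<K. ?P n * (shifted_binom ?s N n * z ^ N)) \<le> z ^ N * poly (bailey_poly a b N x) x" .
    qed (intro summable_sum summable_mult sw)
    finally show ?thesis .
  qed
  have "summable (\<lambda>n. ?P n * ?w n)"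
  proof (rule bounded_imp_summable)
    show "0 \<le> ?P n * ?w n" for n
      using r w0 by (subst shifted_binom_gf_eq[OF s r z sb]) (auto intro!: mult_nonneg_nonneg jacobi_prod_diag_nonneg[OF ab])
    show "(\<Sum>n\<le>K. ?P n * ?w n) \<le> (\<Sum>N. z ^ N * poly (bailey_poly a b N x) x)" for K
      using part[of "Suc K"] by (simp add: lessThan_Suc_atMost)
  qed
  moreover have "?P n * ?w n = ?w 0 * (r ^ n * ?P n)" for n
    by (subst shifted_binom_gf_eq[OF s r z sb, of n]) simp
  ultimately have "summable (\<lambda>n. ?w 0 * (r ^ n * ?P n))" by simp
  then show ?thesis using w0 by (simp add: summable_cmult_iff)
qed

text \<open>Off the diagonal the terms have both signs, so dominated convergence replaces Tonelli;
  the dominating series comes from the two diagonal ones.\<close>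

lemma bailey_sums:
  assumes ab: "a > -1" "b > -1" and r: "0 < r" "r < 1" and z: "z = r / (1 + r)\<^sup>2"
    and smx: "summable (\<lambda>N. z ^ N * poly (bailey_poly a b N x) x)"
    and smy: "summable (\<lambda>N. z ^ N * poly (bailey_poly a b N y) y)"
  shows "summable (\<lambda>n. r ^ n * jacobi_prod a b n x y)"
    and "(\<lambda>N. z ^ N * poly (bailey_poly a b N y) x) sums
       (shifted_binom_gf (a + b + 1) z 0 * (\<Sum>n. r ^ n * jacobi_prod a b n x y))"
proof -
  let ?s = "a + b + 1"
  have s: "?s > -1" using ab by simp
  have z0: "0 \<le> z" using r z by simp
  note sb = summable_shifted_binom_0[OF ab z0 smx]
  note sw = summable_shifted_binom[OF s z0 sb]
  let ?w = "shifted_binom_gf ?s z"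
  let ?P = "\<lambda>n. jacobi_prod a b n x y"
  have abs: "summable (\<lambda>n. r ^ n * \<bar>?P n\<bar>)"
  proof (rule summable_comparison_test'[of "\<lambda>n. r ^ n * jacobi_prod a b n x x + r ^ n * jacobi_prod a b n y y" 0])
    show "summable (\<lambda>n. r ^ n * jacobi_prod a b n x x + r ^ n * jacobi_prod a b n y y)"
      by (intro summable_add summable_jacobi_prod_diag[OF ab r z] smx smy)
    show "norm (r ^ n * \<bar>?P n\<bar>) \<le> r ^ n * jacobi_prod a b n x x + r ^ n * jacobi_prod a b n y y" for n
      using abs_jacobi_prod_le[OF ab, of n x y] r by (simp add: abs_mult distrib_left[symmetric])
  qed
  then show sP: "summable (\<lambda>n. r ^ n * ?P n)"
    using r summable_rabs_cancel[of "\<lambda>n. r ^ n * ?P n"] by (simp add: abs_mult)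
  \<comment> \<open>The contribution of \<open>n\<close> to the sum over the square of side
    \<open>K\<close>, extended by zero; Tannery's theorem is applied as \<open>K\<close>
    grows.\<close>
  define f where "f n K = (if n \<le> K then ?P n * (\<Sum>N\<le>K. shifted_binom ?s N n * z ^ N) else 0)" for n K
  have lim: "(\<lambda>K. f n K) \<longlonglongrightarrow> ?P n * ?w n" for n
  proof -
    have "(\<lambda>K. ?P n * (\<Sum>N\<le>K. shifted_binom ?s N n * z ^ N)) \<longlonglongrightarrow> ?P n * ?w n"
      unfolding shifted_binom_gf_def by (intro tendsto_mult tendsto_const summable_LIMSEQ' sw)
    then show ?thesis
      by (rule Lim_transform_eventually) (auto simp: f_def eventually_sequentially)
  qed
  have bound: "norm (f n K) \<le> \<bar>?P n\<bar> * ?w n" for n K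
  proof -
    have "0 \<le> (\<Sum>N\<le>K. shifted_binom ?s N n * z ^ N)"
      using z0 by (auto intro!: sum_nonneg mult_nonneg_nonneg shifted_binom_nonneg[OF s])
    moreover have "(\<Sum>N\<le>K. shifted_binom ?s N n * z ^ N) \<le> ?w n"
      unfolding shifted_binom_gf_def using z0
      by (intro sum_le_suminf sw) (auto intro!: mult_nonneg_nonneg shifted_binom_nonneg[OF s])
    ultimately show ?thesis by (auto simp: f_def abs_mult mult_left_mono)
  qed
  have wn: "?w n = r ^ n * ?w 0" for n by (rule shifted_binom_gf_eq[OF s r z sb])
  have "summable (\<lambda>n. (r ^ n * \<bar>?P n\<bar>) * ?w 0)" by (rule summable_mult2[OF abs])
  moreover have "(r ^ n * \<bar>?P n\<bar>) * ?w 0 = \<bar>?P n\<bar> * ?w n" for n by (subst wn[of n]) simp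
  ultimately have sM: "summable (\<lambda>n. \<bar>?P n\<bar> * ?w n)" by simp
  have "(\<lambda>K. \<Sum>n. f n K) \<longlonglongrightarrow> (\<Sum>n. ?P n * ?w n)"
    using tannerys_theorem[of f "\<lambda>n. ?P n * ?w n" sequentially "\<lambda>n. \<bar>?P n\<bar> * ?w n"] lim sM
      always_eventually[of "\<lambda>(n, K). norm (f n K) \<le> \<bar>?P n\<bar> * ?w n"] bound
    by (simp add: case_prod_unfold)
  moreover have "(\<Sum>n. f n K) = (\<Sum>N\<le>K. z ^ N * poly (bailey_poly a b N y) x)" for K
  proof -
    have "(\<Sum>n. f n K) = (\<Sum>n\<le>K. f n K)" by (intro suminf_finite) (auto simp: f_def)
    then show ?thesis unfolding sum_bailey_poly[OF ab] by (simp add: f_def)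
  qed
  moreover have "(\<Sum>n. ?P n * ?w n) = ?w 0 * (\<Sum>n. r ^ n * ?P n)"
  proof -
    have "?P n * ?w n = ?w 0 * (r ^ n * ?P n)" for n by (subst wn[of n]) simp
    then have "(\<Sum>n. ?P n * ?w n) = (\<Sum>n. ?w 0 * (r ^ n * ?P n))" by (rule suminf_cong)
    also have "\<dots> = ?w 0 * (\<Sum>n. r ^ n * ?P n)" by (rule suminf_mult[OF sP])
    finally show ?thesis .
  qed
  ultimately show "(\<lambda>N. z ^ N * poly (bailey_poly a b N y) x) sums (?w 0 * (\<Sum>n. r ^ n * ?P n))"
    by (simp add: sums_def_le)
qed

lemma jacobi_prod_0_1_sums:
  assumes "a > -1" "b > -1" "0 < r" "r < 1"
  shows "(\<lambda>n. r ^ n * jacobi_prod a b n 0 1) sums ((1 - r) * (1 + r) powr (- (a + b + 2)))"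
proof -
  let ?c = "\<lambda>n. (- (a + b + 2)) gchoose n" and ?S = "(1 + r) powr (- (a + b + 2))"
  have c: "(\<lambda>n. ?c n * r ^ n) sums ?S" using assms by (intro gen_binomial_real) auto
  have "(\<lambda>n. ?c (Suc n) * r ^ Suc n - r * (?c n * r ^ n)) sums ((?S - 1) - r * ?S)"
    using sums_Suc_iff[of "\<lambda>n. ?c n * r ^ n" "?S - 1"] c by (intro sums_diff sums_mult) simp_all
  moreover have "?c (Suc n) * r ^ Suc n - r * (?c n * r ^ n) = r ^ Suc n * jacobi_prod a b (Suc n) 0 1" for n
    unfolding jacobi_prod_0_1(2)[OF assms(1,2)] by (simp add: algebra_simps)
  ultimately have "(\<lambda>n. r ^ Suc n * jacobi_prod a b (Suc n) 0 1) sums ((?S - 1) - r * ?S)" by simp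
  then show ?thesis
    using sums_Suc_iff[of "\<lambda>n. r ^ n * jacobi_prod a b n 0 1" "(?S - 1) - r * ?S"] 
    by (simp add: jacobi_prod_0 algebra_simps)
qed

text \<open>The factor \<open>?w\<close>, which does not depend on \<open>x\<close> and
  \<open>y\<close>, is not computed from its series: at \<open>x = 0\<close>, \<open>y = 1\<close>
  Bailey's series is 1 and the Jacobi series is explicit, so \<open>?w\<close> is the reciprocal of
  \<open>?S\<close>.\<close>

theorem bailey_formula:
  assumes ab: "a > -1" "b > -1" and r: "0 < r" "r < 1" and z: "z = r / (1 + r)\<^sup>2"
    and sm: "\<And>x. 0 \<le> x \<Longrightarrow> x \<le> 1 \<Longrightarrow> summable (\<lambda>N. z ^ N * poly (bailey_poly a b N x) x)"
    and xy: "0 \<le> x" "x \<le> 1" "0 \<le> y" "y \<le> 1"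
  shows "(\<lambda>n. r ^ n * jacobi_prod a b n x y) sums
     ((1 - r) * (1 + r) powr (- (a + b + 2)) * (\<Sum>N. z ^ N * poly (bailey_poly a b N y) x))"
proof -
  let ?w = "shifted_binom_gf (a + b + 1) z 0" and ?S = "(1 - r) * (1 + r) powr (- (a + b + 2))"
  have "(\<lambda>N. z ^ N * poly (bailey_poly a b N 1) 0) sums (?w * ?S)"
    using bailey_sums(2)[OF ab r z sm sm, of 0 1] sums_unique[OF jacobi_prod_0_1_sums[OF ab r]] by simp
  moreover have "(\<lambda>N. z ^ N * poly (bailey_poly a b N 1) 0) = (\<lambda>N. if N = 0 then 1 else 0)"
    by (auto simp: poly_bailey_poly_1_0)
  ultimately have w: "?w * ?S = 1"
    using sums_unique2 sums_single[of 0 "\<lambda>_. 1 :: real"] by fastforce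
  have "?S * (\<Sum>N. z ^ N * poly (bailey_poly a b N y) x) = ?S * ?w * (\<Sum>n. r ^ n * jacobi_prod a b n x y)"
    using sums_unique[OF bailey_sums(2)[OF ab r z sm sm]] xy by simp
  also have "\<dots> = (\<Sum>n. r ^ n * jacobi_prod a b n x y)" using w by (simp add: mult.commute)
  finally show ?thesis
    using bailey_sums(1)[OF ab r z sm sm] xy by (simp add: sums_iff)
qed

subsection \<open>Moments of the binomial distribution\<close>

lemma add_power_le: "(x + y) ^ K \<le> 2 ^ K * (x ^ K + y ^ K)" if "0 \<le> x" "0 \<le> y" for x y :: real
proof -
  have "(x + y) ^ K \<le> (2 * max x y) ^ K" using that by (intro power_mono) auto
  also have "\<dots> = 2 ^ K * (max x y) ^ K" by (rule power_mult_distrib)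
  also have "\<dots> \<le> 2 ^ K * (x ^ K + y ^ K)"
    using that by (intro mult_left_mono) (auto simp: max_def)
  finally show ?thesis .
qed

text \<open>A probability distribution when \<open>p + q = 1\<close>. The second parameter is kept
  separate so that \<open>- p\<close> can be substituted to select the even indices.\<close>

definition binom_weight :: "real \<Rightarrow> real \<Rightarrow> nat \<Rightarrow> nat \<Rightarrow> real" where
  "binom_weight p q M x = real (M choose x) * p ^ x * q ^ (M - x)"

lemma binom_weight_nonneg: "0 \<le> p \<Longrightarrow> 0 \<le> q \<Longrightarrow> 0 \<le> binom_weight p q M x"
  by (simp add: binom_weight_def)

lemma sum_binom_weight: "(\<Sum>x\<le>M. binom_weight p q M x) = (p + q) ^ M"
  unfolding binom_weight_def by (subst binomial_ring) simp

text \<open>Multiplied by \<open>(M + K choose K) * p ^ K\<close>, the weight at \<open>x\<close>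
  divided by \<open>(x + 1) ^ K\<close> is at most the weight of \<open>M + K\<close> trials at
  \<open>x + K\<close>, and those have total mass at most 1.\<close>

lemma binomial_inverse_moment:
  assumes "0 \<le> p" "0 \<le> q" "p + q = 1"
  shows "(\<Sum>x\<le>M. binom_weight p q M x * (1 / (real x + 1) ^ K)) * (real M * p + 1) ^ K \<le> 2 ^ K * (real K ^ K + 1)"
proof -
  let ?E = "\<Sum>x\<le>M. binom_weight p q M x * (1 / (real x + 1) ^ K)"
  have E0: "0 \<le> ?E" using assms by (intro sum_nonneg mult_nonneg_nonneg binom_weight_nonneg) auto
  have "?E \<le> (\<Sum>x\<le>M. binom_weight p q M x * 1)"
    using assms by (intro sum_mono mult_left_mono binom_weight_nonneg) (auto simp: divide_simps)
  then have E1: "?E \<le> 1" using assms sum_binom_weight[of p q M] by simp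
  have "?E * (real (M + K choose K) * p ^ K) = (\<Sum>x\<le>M. binom_weight p q M x * (1 / (real x + 1) ^ K) * (real (M + K choose K) * p ^ K))"
    by (simp add: sum_distrib_right)
  also have "\<dots> \<le> (\<Sum>x\<le>M. binom_weight p q (M + K) (x + K))"
  proof (intro sum_mono)
    fix x assume "x \<in> {..M}"
    then have x: "x \<le> M" by simp
    have "real (M + K choose K) * real (M choose x) = real (M + K choose (x + K)) * real (x + K choose K)"
      using choose_mult[of K "x + K" "M + K"] x by (simp flip: of_nat_mult)
    also have "\<dots> \<le> real (M + K choose (x + K)) * (real x + 1) ^ K"
    proof (intro mult_left_mono)
      \<comment> \<open>The binomial is the product of the factors \<open>(x + i) / i\<close> for
        \<open>i\<close> from 1 to \<open>K\<close>, each at most \<open>x + 1\<close>.\<close>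
      have "x + K choose K \<le> (x + 1) ^ K"
      proof (induction K)
        case (Suc K)
        have "Suc K * (x + Suc K choose Suc K) = (x + Suc K) * (x + K choose K)"
          using Suc_times_binomial_eq[of "x + K" K] by (simp add: mult.commute)
        also have "\<dots> \<le> (Suc K * (x + 1)) * (x + 1) ^ K"
          by (intro mult_mono Suc) (auto simp: algebra_simps)
        finally have "Suc K * (x + Suc K choose Suc K) \<le> Suc K * (x + 1) ^ Suc K"
          by (simp only: power_Suc mult.assoc)
        then show ?case by (simp only: Suc_mult_le_cancel1)
      qed simp
      then show "real (x + K choose K) \<le> (real x + 1) ^ K"
        by (metis of_nat_1 of_nat_add of_nat_le_iff of_nat_power)
    qed simp
    finally have "real (M + K choose K) * real (M choose x) / (real x + 1) ^ K \<le> real (M + K choose (x + K))"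
      by (simp add: divide_le_eq)
    then have "(real (M + K choose K) * real (M choose x) / (real x + 1) ^ K) * (p ^ (x + K) * q ^ (M - x))
       \<le> real (M + K choose (x + K)) * (p ^ (x + K) * q ^ (M - x))"
      using assms by (intro mult_right_mono) auto
    then show "binom_weight p q M x * (1 / (real x + 1) ^ K) * (real (M + K choose K) * p ^ K) \<le> binom_weight p q (M + K) (x + K)"
      by (simp add: binom_weight_def power_add ac_simps)
  qed
  also have "\<dots> = (\<Sum>x\<in>(\<lambda>x. x + K) ` {..M}. binom_weight p q (M + K) x)"
    by (subst sum.reindex) auto
  also have "\<dots> \<le> (\<Sum>x\<le>M + K. binom_weight p q (M + K) x)"
    using assms by (intro sum_mono2 binom_weight_nonneg) auto
  also have "\<dots> = 1" using assms by (simp add: sum_binom_weight)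
  finally have *: "?E * (real (M + K choose K) * p ^ K) \<le> 1" .
  \<comment> \<open>Turns the bound into one for \<open>(M * p) ^ K\<close>. The summand 1 in the
    claim is covered by the trivial estimate \<open>?E \<le> 1\<close>, which takes over when
    \<open>M * p\<close> is small.\<close>
  have "(real (M + K) / real K) ^ K \<le> real (M + K choose K)"
    by (rule binomial_ge_n_over_k_pow_k) simp
  then have "real (M + K) ^ K \<le> real K ^ K * real (M + K choose K)"
    by (cases "K = 0") (simp_all add: power_divide divide_le_eq mult.commute)
  moreover have "real M ^ K \<le> real (M + K) ^ K" by (intro power_mono) auto
  ultimately have "real M ^ K * p ^ K \<le> real K ^ K * real (M + K choose K) * p ^ K"
    using assms by (intro mult_right_mono) auto
  then have "?E * (real M ^ K * p ^ K) \<le> ?E * (real K ^ K * real (M + K choose K) * p ^ K)"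
    using E0 by (intro mult_left_mono)
  also have "\<dots> = real K ^ K * (?E * (real (M + K choose K) * p ^ K))" by simp
  also have "\<dots> \<le> real K ^ K * 1" by (intro mult_left_mono *) simp
  finally have **: "?E * (real M * p) ^ K \<le> real K ^ K" by (simp add: power_mult_distrib)
  have "?E * (real M * p + 1) ^ K \<le> ?E * (2 ^ K * ((real M * p) ^ K + 1 ^ K))"
    using E0 assms by (intro mult_left_mono add_power_le) auto
  also have "\<dots> = 2 ^ K * (?E * (real M * p) ^ K + ?E)" by (simp add: algebra_simps)
  also have "\<dots> \<le> 2 ^ K * (real K ^ K + 1)" by (intro mult_left_mono add_mono ** E1) simp
  finally show ?thesis .
qed

text \<open>The moment of \<open>x choose K\<close> is \<open>(M choose K) * p ^ K\<close>. For
  \<open>x \<ge> K\<close> this binomial controls \<open>(x + 1) ^ K\<close>; the remaining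
  \<open>x\<close> contribute at most \<open>K ^ K\<close>.\<close>

lemma binomial_moment:
  assumes "0 \<le> p" "0 \<le> q" "p + q = 1"
  shows "(\<Sum>x\<le>M. binom_weight p q M x * (real x + 1) ^ K) \<le> ((2 * real K) ^ K + real K ^ K) * (real M * p + 1) ^ K"
proof -
  have fm: "(\<Sum>x\<le>M. binom_weight p q M x * real (x choose K)) \<le> (real M * p) ^ K"
  proof (cases "K \<le> M")
    case True
    have "(\<Sum>x\<le>M. binom_weight p q M x * real (x choose K)) = (\<Sum>x\<in>{K..M}. binom_weight p q M x * real (x choose K))"
      by (intro sum.mono_neutral_right) auto
    also have "\<dots> = (\<Sum>x\<in>{K..M}. real (M choose K) * p ^ K * binom_weight p q (M - K) (x - K))"
    proof (intro sum.cong refl)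
      fix x assume x: "x \<in> {K..M}"
      have "real (M choose x) * real (x choose K) = real (M choose K) * real (M - K choose (x - K))"
        using choose_mult[of K x M] x by (simp flip: of_nat_mult)
      moreover have "p ^ x = p ^ K * p ^ (x - K)" "M - K - (x - K) = M - x" using x by (auto simp flip: power_add)
      ultimately show "binom_weight p q M x * real (x choose K) = real (M choose K) * p ^ K * binom_weight p q (M - K) (x - K)"
        by (simp add: binom_weight_def ac_simps)
    qed
    also have "\<dots> = (\<Sum>y\<le>M - K. real (M choose K) * p ^ K * binom_weight p q (M - K) y)"
      using True by (intro sum.reindex_bij_witness[of _ "\<lambda>y. y + K" "\<lambda>x. x - K"]) auto
    also have "\<dots> = real (M choose K) * p ^ K"
      using assms by (simp add: sum_distrib_left[symmetric] sum_binom_weight)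
    also have "\<dots> \<le> real (M ^ K) * p ^ K"
      using assms binomial_le_pow[OF True] by (intro mult_right_mono) (simp_all flip: of_nat_power)
    finally show ?thesis by (simp add: power_mult_distrib)
  next
    case False
    then have "(\<Sum>x\<le>M. binom_weight p q M x * real (x choose K)) = 0" by (intro sum.neutral) auto
    then show ?thesis using assms by simp
  qed
  have "(\<Sum>x\<le>M. binom_weight p q M x * (real x + 1) ^ K) \<le>
      (\<Sum>x\<le>M. binom_weight p q M x * ((2 * real K) ^ K * real (x choose K) + real K ^ K))"
  proof (intro sum_mono mult_left_mono binom_weight_nonneg assms)
    fix x
    show "(real x + 1) ^ K \<le> (2 * real K) ^ K * real (x choose K) + real K ^ K"
    proof (cases "K \<le> x")
      case True
      have "(real x + 1) ^ K \<le> (2 * real x) ^ K"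
      proof (cases "K = 0")
        case False
        then have "1 \<le> x" using True by simp
        then show ?thesis by (intro power_mono) auto
      qed simp
      also have "\<dots> = (2 * real K) ^ K * (real x / real K) ^ K"
        by (cases "K = 0") (simp_all add: power_mult_distrib power_divide)
      also have "\<dots> \<le> (2 * real K) ^ K * real (x choose K)"
        by (intro mult_left_mono binomial_ge_n_over_k_pow_k True) simp
      finally show ?thesis by (rule order_trans) simp
    next
      case False
      then have "(real x + 1) ^ K \<le> real K ^ K" by (intro power_mono) auto
      then show ?thesis by (simp add: add_increasing)
    qed
  qed
  also have "\<dots> = (2 * real K) ^ K * (\<Sum>x\<le>M. binom_weight p q M x * real (x choose K)) + real K ^ K"
  proof -
    have "(\<Sum>x\<le>M. binom_weight p q M x * real K ^ K) = real K ^ K"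
      using assms by (simp add: sum_distrib_right[symmetric] sum_binom_weight)
    then show ?thesis by (simp add: distrib_left sum.distrib sum_distrib_left ac_simps)
  qed
  also have "\<dots> \<le> (2 * real K) ^ K * (real M * p + 1) ^ K + real K ^ K * (real M * p + 1) ^ K"
  proof (intro add_mono mult_left_mono)
    show "(\<Sum>x\<le>M. binom_weight p q M x * real (x choose K)) \<le> (real M * p + 1) ^ K"
      using fm by (rule order_trans) (use assms in \<open>auto intro!: power_mono\<close>)
    show "real K ^ K \<le> real K ^ K * (real M * p + 1) ^ K"
      using assms by (simp add: mult_le_cancel_left1)
  qed simp
  finally show ?thesis by (simp add: distrib_right)
qed

lemma sum_even_indices: "(\<Sum>m\<le>N. f (2 * m)) = (\<Sum>x\<le>2 * N. if even x then f x else 0)"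
  for f :: "nat \<Rightarrow> 'a::comm_monoid_add"
  by (induction N) (simp_all add: add.assoc)

lemma even_binomial_le:
  assumes "0 \<le> p" "0 \<le> q" "\<And>x. 0 \<le> F x"
  shows "(\<Sum>m\<le>N. binom_weight p q (2 * N) (2 * m) * F (2 * m)) \<le> (\<Sum>x\<le>2 * N. binom_weight p q (2 * N) x * F x)"
  unfolding sum_even_indices[of "\<lambda>x. binom_weight p q (2 * N) x * F x"]
  by (intro sum_mono) (use assms in \<open>auto intro!: mult_nonneg_nonneg binom_weight_nonneg\<close>)

text \<open>Averaging over the signs of \<open>p\<close> selects the even indices and gives mass
  \<open>(1 + (q - p) ^ (2 * N)) / 2\<close>, whose power is nonnegative because the exponent is
  even.\<close>

lemma even_binomial_ge_half:
  assumes "p + q = 1"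
  shows "1 / 2 \<le> (\<Sum>m\<le>N. binom_weight p q (2 * N) (2 * m))"
proof -
  have "2 * (\<Sum>m\<le>N. binom_weight p q (2 * N) (2 * m)) = (\<Sum>x\<le>2 * N. binom_weight p q (2 * N) x + binom_weight (- p) q (2 * N) x)"
    unfolding sum_even_indices[of "\<lambda>x. binom_weight p q (2 * N) x"] sum_distrib_left
    by (intro sum.cong refl) (auto simp: binom_weight_def)
  also have "\<dots> = 1 + (- p + q) ^ (2 * N)"
    using assms by (simp add: sum.distrib sum_binom_weight)
  also have "\<dots> \<ge> 1" by (simp add: power_mult)
  finally show ?thesis by simp
qed

text \<open>Only even indices occur because \<open>2 * N choose (2 * m)\<close> is what the
  duplication formula produces. The odd ones are added back for the upper bounds; passing between
  \<open>m + 1\<close> and \<open>2 * m + 1\<close>, and between \<open>N\<close> and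
  \<open>2 * N\<close>, costs the factors \<open>2 ^ K\<close>.\<close>

lemma even_binomial_moments:
  shows "\<exists>C. \<forall>p q N. 0 \<le> p \<longrightarrow> 0 \<le> q \<longrightarrow> p + q = 1 \<longrightarrow>
    (\<Sum>m\<le>N. binom_weight p q (2 * N) (2 * m) *
       (((real m + 1) / (real N * p + 1)) ^ K + ((real N * p + 1) / (real m + 1)) ^ K)) \<le> C"
proof -
  let ?C = "((2 * real K) ^ K + real K ^ K) * 2 ^ K + 2 ^ K * (2 ^ K * (real K ^ K + 1))"
  have "(\<Sum>m\<le>N. binom_weight p q (2 * N) (2 * m) *
       (((real m + 1) / (real N * p + 1)) ^ K + ((real N * p + 1) / (real m + 1)) ^ K)) \<le> ?C"
    if pq: "0 \<le> p" "0 \<le> q" "p + q = 1" for p q N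
  proof -
    let ?w = "binom_weight p q (2 * N)" and ?d = "real N * p + 1"
    have "0 \<le> real N * p" using pq by simp
    then have dne: "?d \<noteq> 0" by linarith
    have dK: "0 \<le> ?d ^ K" using pq by (intro zero_le_power) simp
    have d: "1 \<le> ?d" "real (2 * N) * p + 1 \<le> 2 * ?d" "?d \<le> real (2 * N) * p + 1" using pq by auto
    have "(\<Sum>m\<le>N. ?w (2 * m) * ((real m + 1) / ?d) ^ K) \<le> (\<Sum>m\<le>N. ?w (2 * m) * (((real (2 * m) + 1) / ?d) ^ K))"
      using pq d by (intro sum_mono mult_left_mono power_mono binom_weight_nonneg divide_right_mono) auto
    also have "\<dots> \<le> (\<Sum>x\<le>2 * N. ?w x * ((real x + 1) / ?d) ^ K)"
      using pq d by (intro even_binomial_le) auto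
    also have "\<dots> = (\<Sum>x\<le>2 * N. ?w x * (real x + 1) ^ K) / ?d ^ K"
      by (simp add: sum_divide_distrib power_divide)
    also have "\<dots> \<le> ((2 * real K) ^ K + real K ^ K) * (real (2 * N) * p + 1) ^ K / ?d ^ K"
      using d by (intro divide_right_mono binomial_moment pq dK)
    also have "\<dots> \<le> ((2 * real K) ^ K + real K ^ K) * (2 * ?d) ^ K / ?d ^ K"
      using d pq by (intro divide_right_mono mult_left_mono power_mono) auto
    also have "\<dots> = ((2 * real K) ^ K + real K ^ K) * 2 ^ K"
      using dne by (simp only: power_mult_distrib) simp
    finally have 1: "(\<Sum>m\<le>N. ?w (2 * m) * ((real m + 1) / ?d) ^ K) \<le> ((2 * real K) ^ K + real K ^ K) * 2 ^ K" .
    have "(\<Sum>m\<le>N. ?w (2 * m) * (?d / (real m + 1)) ^ K) \<le> (\<Sum>m\<le>N. ?w (2 * m) * ((2 * ?d / (real (2 * m) + 1)) ^ K))"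
      using pq d by (intro sum_mono mult_left_mono power_mono binom_weight_nonneg) (auto simp: divide_simps algebra_simps)
    also have "\<dots> \<le> (\<Sum>x\<le>2 * N. ?w x * (2 * ?d / (real x + 1)) ^ K)"
      using pq d by (intro even_binomial_le) auto
    also have "\<dots> = (\<Sum>x\<le>2 * N. 2 ^ K * (?w x * (1 / (real x + 1) ^ K) * ?d ^ K))"
      unfolding power_divide power_mult_distrib by (intro sum.cong refl) simp
    also have "\<dots> = 2 ^ K * ((\<Sum>x\<le>2 * N. ?w x * (1 / (real x + 1) ^ K)) * ?d ^ K)"
      by (simp only: sum_distrib_left sum_distrib_right)
    also have "\<dots> \<le> 2 ^ K * ((\<Sum>x\<le>2 * N. ?w x * (1 / (real x + 1) ^ K)) * (real (2 * N) * p + 1) ^ K)"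
      using d pq dK by (intro mult_left_mono power_mono sum_nonneg mult_nonneg_nonneg binom_weight_nonneg) auto
    also have "\<dots> \<le> 2 ^ K * (2 ^ K * (real K ^ K + 1))"
      by (intro mult_left_mono binomial_inverse_moment pq) auto
    finally have 2: "(\<Sum>m\<le>N. ?w (2 * m) * (?d / (real m + 1)) ^ K) \<le> 2 ^ K * (2 ^ K * (real K ^ K + 1))" .
    have "(\<Sum>m\<le>N. ?w (2 * m) * (((real m + 1) / ?d) ^ K + (?d / (real m + 1)) ^ K)) =
       (\<Sum>m\<le>N. ?w (2 * m) * ((real m + 1) / ?d) ^ K) + (\<Sum>m\<le>N. ?w (2 * m) * (?d / (real m + 1)) ^ K)"
      by (simp only: distrib_left[of "?w _"] sum.distrib)
    also note add_mono[OF 1 2]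
    finally show ?thesis .
  qed
  then show ?thesis by blast
qed

lemma powr_le_power_add:
  fixes x c :: real
  assumes "0 < x" "\<bar>c\<bar> \<le> real K"
  shows "x powr c \<le> x ^ K + (1 / x) ^ K"
proof (cases "x \<ge> 1")
  case True
  then have "x powr c \<le> x powr real K" using assms by (intro powr_mono) auto
  then show ?thesis using assms by (simp add: powr_realpow add_increasing2)
next
  case False
  then have "x powr c \<le> x powr (- real K)" using assms by (intro powr_mono') auto
  then show ?thesis using assms by (simp add: powr_minus powr_realpow add_increasing power_divide inverse_eq_divide)
qed

text \<open>The inequality \<open>2 * u * v \<le> u^2 + v^2\<close> separates the two weights, which
  is why \<open>K\<close> must exceed twice each exponent; the second part becomes the first after
  reversing \<open>m\<close> and exchanging \<open>p\<close> with \<open>q\<close>.\<close>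

lemma even_binomial_weighted_le:
  shows "\<exists>C. \<forall>p q N. 0 \<le> p \<longrightarrow> 0 \<le> q \<longrightarrow> p + q = 1 \<longrightarrow>
    (\<Sum>m\<le>N. binom_weight p q (2 * N) (2 * m) *
       (((real m + 1) / (real N * p + 1)) powr a * ((real (N - m) + 1) / (real N * q + 1)) powr b)) \<le> C"
proof -
  obtain K :: nat where K: "2 * \<bar>a\<bar> \<le> real K" "2 * \<bar>b\<bar> \<le> real K"
    using real_arch_simple[of "max (2 * \<bar>a\<bar>) (2 * \<bar>b\<bar>)"] by auto
  obtain C where C: "\<And>p q N. 0 \<le> p \<Longrightarrow> 0 \<le> q \<Longrightarrow> p + q = 1 \<Longrightarrow>
    (\<Sum>m\<le>N. binom_weight p q (2 * N) (2 * m) *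
       (((real m + 1) / (real N * p + 1)) ^ K + ((real N * p + 1) / (real m + 1)) ^ K)) \<le> C"
    using even_binomial_moments[of K] by blast
  have "(\<Sum>m\<le>N. binom_weight p q (2 * N) (2 * m) *
       (((real m + 1) / (real N * p + 1)) powr a * ((real (N - m) + 1) / (real N * q + 1)) powr b)) \<le> C + C"
    if pq: "0 \<le> p" "0 \<le> q" "p + q = 1" for p q N
  proof -
    let ?w = "binom_weight p q (2 * N)"
    let ?R = "\<lambda>p m. (real m + 1) / (real N * p + 1)"
    let ?S = "\<lambda>p m. ?R p m ^ K + ((real N * p + 1) / (real m + 1)) ^ K"
    have pos: "0 < ?R p m" "0 < ?R q m" for m using pq by (auto intro!: divide_pos_pos add_nonneg_pos)
    have "?R p m powr a * ?R q (N - m) powr b \<le> ?S p m + ?S q (N - m)" for m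
    proof -
      have "2 * (?R p m powr a * ?R q (N - m) powr b) \<le> (?R p m powr a)\<^sup>2 + (?R q (N - m) powr b)\<^sup>2"
        using sum_squares_bound[of "?R p m powr a" "?R q (N - m) powr b"] by simp
      moreover have "(?R p m powr a)\<^sup>2 = ?R p m powr (2 * a)" "(?R q (N - m) powr b)\<^sup>2 = ?R q (N - m) powr (2 * b)"
        by (simp_all add: power2_eq_square flip: powr_add)
      moreover have "?R p m powr (2 * a) \<le> ?S p m" "?R q (N - m) powr (2 * b) \<le> ?S q (N - m)"
        using powr_le_power_add[OF pos(1), of "2 * a" K m] powr_le_power_add[OF pos(2), of "2 * b" K "N - m"] K by auto
      moreover have "0 \<le> ?R p m powr a * ?R q (N - m) powr b" by simp
      ultimately show ?thesis by linarith
    qed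
    then have "(\<Sum>m\<le>N. ?w (2 * m) * (?R p m powr a * ?R q (N - m) powr b)) \<le> (\<Sum>m\<le>N. ?w (2 * m) * (?S p m + ?S q (N - m)))"
      using pq by (intro sum_mono mult_left_mono binom_weight_nonneg)
    also have "\<dots> = (\<Sum>m\<le>N. ?w (2 * m) * ?S p m) + (\<Sum>m\<le>N. ?w (2 * m) * ?S q (N - m))"
      by (simp add: distrib_left sum.distrib)
    also have "(\<Sum>m\<le>N. ?w (2 * m) * ?S q (N - m)) = (\<Sum>m\<le>N. binom_weight q p (2 * N) (2 * m) * ?S q m)"
    proof (rule sum.reindex_bij_witness[of _ "\<lambda>m. N - m" "\<lambda>m. N - m"])
      fix m assume "m \<in> {..N}"
      then have m: "m \<le> N" by simp
      then have e1: "2 * N - 2 * (N - m) = 2 * m" and e2: "2 * (N - m) = 2 * N - 2 * m" by auto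
      have e3: "2 * N choose (2 * N - 2 * m) = (2 * N choose (2 * m))"
        by (rule binomial_symmetric[symmetric]) (use m in simp)
      have "binom_weight q p (2 * N) (2 * (N - m)) = ?w (2 * m)"
        unfolding binom_weight_def e1 unfolding e2 e3 by (simp only: mult.assoc mult.commute[of "q ^ _"])
      then show "binom_weight q p (2 * N) (2 * (N - m)) * ?S q (N - m) = ?w (2 * m) * ?S q (N - m)" by simp
    qed auto
    finally show ?thesis using C[of p q N] C[of q p N] pq by linarith
  qed
  then show ?thesis by blast
qed

text \<open>The lower bound comes from the upper bound for the opposite exponents, through the
  tangent inequality \<open>2 * l - l^2 / x \<le> x\<close> applied to each weight.\<close>

lemma even_binomial_weighted_comparable:
  shows "\<exists>C. \<forall>p q N. 0 \<le> p \<longrightarrow> 0 \<le> q \<longrightarrow> p + q = 1 \<longrightarrow>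
    comparable C (\<Sum>m\<le>N. binom_weight p q (2 * N) (2 * m) * ((real m + 1) powr a * (real (N - m) + 1) powr b))
       ((real N * p + 1) powr a * (real N * q + 1) powr b)"
proof -
  let ?f = "\<lambda>a b p q N m. ((real m + 1) / (real N * p + 1)) powr a * ((real (N - m) + 1) / (real N * q + 1)) powr b"
  obtain A where A: "\<And>p q N. 0 \<le> p \<Longrightarrow> 0 \<le> q \<Longrightarrow> p + q = 1 \<Longrightarrow>
    (\<Sum>m\<le>N. binom_weight p q (2 * N) (2 * m) * ?f a b p q N m) \<le> A"
    using even_binomial_weighted_le[of a b] by blast
  obtain B0 where B0: "\<And>p q N. 0 \<le> p \<Longrightarrow> 0 \<le> q \<Longrightarrow> p + q = 1 \<Longrightarrow>
    (\<Sum>m\<le>N. binom_weight p q (2 * N) (2 * m) * ?f (-a) (-b) p q N m) \<le> B0"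
    using even_binomial_weighted_le[of "-a" "-b"] by blast
  define B where "B = max 1 B0"
  have B: "B \<ge> 1" "\<And>p q N. 0 \<le> p \<Longrightarrow> 0 \<le> q \<Longrightarrow> p + q = 1 \<Longrightarrow>
    (\<Sum>m\<le>N. binom_weight p q (2 * N) (2 * m) * ?f (-a) (-b) p q N m) \<le> B"
    unfolding B_def using max.cobounded1 order_trans[OF B0 max.cobounded2] by blast+
  have "comparable (max 1 (max A (4 * B))) (\<Sum>m\<le>N. binom_weight p q (2 * N) (2 * m) * ((real m + 1) powr a * (real (N - m) + 1) powr b))
       ((real N * p + 1) powr a * (real N * q + 1) powr b)"
    if pq: "0 \<le> p" "0 \<le> q" "p + q = 1" for p q N
  proof -
    let ?w = "binom_weight p q (2 * N)"
    let ?D = "(real N * p + 1) powr a * (real N * q + 1) powr b"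
    let ?S = "\<Sum>m\<le>N. ?w (2 * m) * ?f a b p q N m"
    have pos: "0 < real N * p + 1" "0 < real N * q + 1" using pq by (auto intro!: add_nonneg_pos)
    then have D: "0 < ?D" by simp
    have eq: "(real m + 1) powr a * (real (N - m) + 1) powr b = ?D * ?f a b p q N m" for m
      using pos by (simp add: powr_divide)
    have S: "(\<Sum>m\<le>N. ?w (2 * m) * ((real m + 1) powr a * (real (N - m) + 1) powr b)) = ?D * ?S"
      unfolding eq by (simp add: sum_distrib_left ac_simps)
    \<comment> \<open>This choice balances the two terms: the even mass contributes at least
      \<open>l\<close>, while the inverse weights take away at most
      \<open>l^2 * B = l / 2\<close>.\<close>
    define l where "l = 1 / (2 * B)"
    have l: "0 < l" "l * B = 1 / 2" using B(1) by (auto simp: l_def)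
    have "2 * l - l\<^sup>2 * ?f (-a) (-b) p q N m \<le> ?f a b p q N m" for m
    proof -
      let ?g = "?f a b p q N m"
      have g: "0 < ?g" using pos by (auto intro!: mult_pos_pos)
      have inv: "?f (-a) (-b) p q N m = inverse ?g" using pos by (simp add: powr_minus)
      have "2 * l - l\<^sup>2 * inverse x \<le> x" if "0 < x" for x :: real
      proof -
        have "0 \<le> (x - l)\<^sup>2 / x" using that by (intro divide_nonneg_pos) auto
        also have "\<dots> = x - 2 * l + l\<^sup>2 * inverse x"
          using that by (simp add: power2_eq_square divide_simps) (simp add: algebra_simps)
        finally show ?thesis by linarith
      qed
      from this[OF g] show ?thesis unfolding inv .
    qed
    then have "(\<Sum>m\<le>N. ?w (2 * m) * (2 * l - l\<^sup>2 * ?f (-a) (-b) p q N m)) \<le> ?S"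
      using pq by (intro sum_mono mult_left_mono binom_weight_nonneg)
    moreover have "(\<Sum>m\<le>N. ?w (2 * m) * (2 * l - l\<^sup>2 * ?f (-a) (-b) p q N m)) =
        2 * l * (\<Sum>m\<le>N. ?w (2 * m)) - l\<^sup>2 * (\<Sum>m\<le>N. ?w (2 * m) * ?f (-a) (-b) p q N m)"
      by (simp add: right_diff_distrib sum_subtractf sum_distrib_left ac_simps)
    moreover have "2 * l * (\<Sum>m\<le>N. ?w (2 * m)) \<ge> 2 * l * (1 / 2)"
      using l even_binomial_ge_half[OF pq(3), of N] by (intro mult_left_mono) auto
    moreover have "l\<^sup>2 * (\<Sum>m\<le>N. ?w (2 * m) * ?f (-a) (-b) p q N m) \<le> l\<^sup>2 * B"
      by (intro mult_left_mono B pq) auto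
    moreover have "l\<^sup>2 * B = l * (1 / 2)" unfolding l(2)[symmetric] by (simp add: power2_eq_square)
    ultimately have lower: "l / 2 \<le> ?S" by linarith
    have "comparable (max 1 (max A (4 * B))) (D * S) D"
      if "0 < D" "l / 2 \<le> S" "S \<le> A" for D S
    proof (rule comparableI)
      show "D * S \<le> A * D" using that by simp
      have "1 \<le> 4 * B * S" using that(2) B(1) by (simp add: l_def field_simps)
      then have "1 * D \<le> 4 * B * S * D" using that(1) by (intro mult_right_mono) auto
      then show "D \<le> 4 * B * (D * S)" by (simp add: ac_simps)
    qed (use that l(1) in auto)
    from this[OF D lower A[OF pq]] show ?thesis unfolding S .
  qed
  then show ?thesis by blast
qed

subsection \<open>Size of Bailey's series\<close>

lemma powr_le_endpoints:
  fixes x l u c :: real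
  assumes "0 < l" "l \<le> x" "x \<le> u"
  shows "x powr c \<le> l powr c + u powr c"
proof (cases "c \<ge> 0")
  case True
  then have "x powr c \<le> u powr c" using assms by (intro powr_mono2) auto
  then show ?thesis by (simp add: add_increasing)
next
  case False
  then have "x powr c \<le> l powr c" using assms by (intro powr_mono2') auto
  then show ?thesis by (simp add: add_increasing2)
qed

text \<open>The ratio always lies between 1 and \<open>1 / (d * n)\<close>, in an order that depends
  on whether \<open>d * n \<ge> 1\<close>; the resulting bound is uniform in
  \<open>p\<close>.\<close>

lemma ratio_powr_le:
  fixes d p n c :: real
  assumes "0 < d" "0 \<le> p" "0 < n"
  shows "((p + 1 / n) / (d + p)) powr c \<le> 1 + (d * n) powr (- c)"
proof -
  let ?y = "d * n" and ?r = "(p + 1 / n) / (d + p)"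
  have pos: "0 < ?y" "0 < d + p" using assms by auto
  have inv: "(1 / ?y) powr c = ?y powr (- c)" using pos by (simp add: powr_divide powr_minus inverse_eq_divide)
  show ?thesis
  proof (cases "?y \<ge> 1")
    case True
    have "p \<le> p * ?y" using assms True by (simp add: mult_le_cancel_left1)
    then have "1 / ?y \<le> ?r" using assms pos by (simp add: divide_simps) (simp add: algebra_simps)
    moreover have "?r \<le> 1" using assms pos True by (simp add: divide_simps) (simp add: algebra_simps)
    ultimately show ?thesis using powr_le_endpoints[of "1 / ?y" ?r 1 c] pos inv by simp
  next
    case False
    have "p * ?y \<le> p" using assms False by (simp add: mult_left_le)
    then have "?r \<le> 1 / ?y" using assms pos by (simp add: divide_simps) (simp add: algebra_simps)
    moreover have "1 \<le> ?r" using assms pos False by (simp add: divide_simps) (simp add: algebra_simps)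
    ultimately show ?thesis using powr_le_endpoints[of 1 ?r "1 / ?y" c] pos inv by simp
  qed
qed

text \<open>Scale-free form: under the geometric law with weights \<open>(1 - x) * x ^ n\<close>,
  powers of the rescaled index \<open>(1 - x) * (n + 1)\<close> have bounded mean.\<close>

lemma power_series_scaled_le:
  fixes c :: real
  assumes "c > -1"
  shows "\<exists>C. \<forall>x. 0 \<le> x \<longrightarrow> x < 1 \<longrightarrow> summable (\<lambda>n. x ^ n * ((1 - x) * (real n + 1)) powr c) \<and>
           (\<Sum>n. x ^ n * ((1 - x) * (real n + 1)) powr c) \<le> C / (1 - x)"
proof -
  obtain C where C: "\<And>x. 0 \<le> x \<Longrightarrow> x < 1 \<Longrightarrow> summable (\<lambda>n. x ^ n * (real n + 1) powr c) \<and>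
           comparable C (\<Sum>n. x ^ n * (real n + 1) powr c) ((1 - x) powr (- c - 1))"
    using power_series_powr_comparable[OF assms] by blast
  have "summable (\<lambda>n. x ^ n * ((1 - x) * (real n + 1)) powr c) \<and>
           (\<Sum>n. x ^ n * ((1 - x) * (real n + 1)) powr c) \<le> C / (1 - x)" if x: "0 \<le> x" "x < 1" for x
  proof -
    have eq: "x ^ n * ((1 - x) * (real n + 1)) powr c = (1 - x) powr c * (x ^ n * (real n + 1) powr c)" for n
      using x by (simp add: powr_mult)
    have sm: "summable (\<lambda>n. x ^ n * (real n + 1) powr c)" and
      le: "(\<Sum>n. x ^ n * (real n + 1) powr c) \<le> C * (1 - x) powr (- c - 1)"
      using C[OF x] by (auto simp: comparable_def)
    have "(1 - x) powr c * (\<Sum>n. x ^ n * (real n + 1) powr c) \<le> (1 - x) powr c * (C * (1 - x) powr (- c - 1))"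
      by (intro mult_left_mono le) simp
    also have "\<dots> = C * ((1 - x) powr c * (1 - x) powr (- c - 1))" by simp
    also have "(1 - x) powr c * (1 - x) powr (- c - 1) = 1 / (1 - x)"
      using x by (simp add: powr_minus_divide flip: powr_add)
    finally show ?thesis unfolding eq using sm by (simp add: suminf_mult summable_mult)
  qed
  then show ?thesis by blast
qed

text \<open>A single quantity that controls all powers of \<open>y\<close>. Both exponents in it
  exceed -1, so its geometric mean value is still bounded; the power
  \<open>y powr (- (1 / 2))\<close> is the reason for the factor 2 in the exponent.\<close>

lemma powr_le_max_powr:
  fixes y c Y :: real
  assumes "0 < y" "Y = y powr (- (1 / 2)) + y powr 1"
  shows "1 \<le> Y" "y powr c \<le> Y powr (2 * \<bar>c\<bar>)"
proof -
  have Y: "y \<le> Y" "y powr (- (1 / 2)) \<le> Y" using assms by auto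
  show Y1: "1 \<le> Y"
  proof (cases "y \<ge> 1")
    case False
    then have "y powr 0 \<le> y powr (- (1 / 2))" using assms by (intro powr_mono') auto
    then show ?thesis using Y assms by simp
  qed (use Y in simp)
  show "y powr c \<le> Y powr (2 * \<bar>c\<bar>)"
  proof (cases "c \<ge> 0")
    case True
    then have "y powr c \<le> Y powr c" using assms Y by (intro powr_mono2) auto
    also have "\<dots> \<le> Y powr (2 * \<bar>c\<bar>)" using True Y1 by (intro powr_mono) auto
    finally show ?thesis .
  next
    case False
    have "y powr c = (y powr (- (1 / 2))) powr (2 * \<bar>c\<bar>)" using False by (simp add: powr_powr)
    also have "\<dots> \<le> Y powr (2 * \<bar>c\<bar>)" using Y by (intro powr_mono2) auto
    finally show ?thesis .
  qed
qed

text \<open>The geometric law concentrates at \<open>n\<close> of order \<open>1 / (1 - x)\<close>,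
  so \<open>1 / (n + 1)\<close> may be replaced by \<open>1 - x\<close>. The upper bound involves
  the exponent \<open>a + b\<close>, and the hypotheses are what keeps it above -1. The lower bound
  is Markov's inequality for \<open>Y\<close>.\<close>

lemma two_weight_series:
  fixes a b :: real
  assumes "a > -1/2" "b > -1/2"
  shows "\<exists>C. \<forall>x p q. 0 \<le> x \<longrightarrow> x < 1 \<longrightarrow> 0 \<le> p \<longrightarrow> 0 \<le> q \<longrightarrow>
    summable (\<lambda>n. x ^ n * ((p + 1 / (real n + 1)) powr (- a) * (q + 1 / (real n + 1)) powr (- b))) \<and>
    comparable C (\<Sum>n. x ^ n * ((p + 1 / (real n + 1)) powr (- a) * (q + 1 / (real n + 1)) powr (- b)))
      ((1 - x + p) powr (- a) * (1 - x + q) powr (- b) / (1 - x))"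
proof -
  let ?bd = "\<lambda>c C. \<forall>x. 0 \<le> x \<longrightarrow> x < 1 \<longrightarrow> summable (\<lambda>n. x ^ n * ((1 - x) * (real n + 1)) powr c) \<and>
           (\<Sum>n. x ^ n * ((1 - x) * (real n + 1)) powr c) \<le> C / (1 - x)"
  have ex: "\<exists>C. ?bd c C" if "c > -1" for c :: real
    using power_series_scaled_le[OF that] .
  have c: "a > -1" "b > -1" "a + b > -1" "- (1 / 2) > (-1 :: real)" "1 > (-1 :: real)" using assms by auto
  obtain C1 where b1: "?bd a C1" using ex[OF c(1)] ..
  obtain C2 where b2: "?bd b C2" using ex[OF c(2)] ..
  obtain C3 where b3: "?bd (a + b) C3" using ex[OF c(3)] ..
  obtain C4 where b4: "?bd (- (1 / 2)) C4" using ex[OF c(4)] ..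
  obtain C5 where b5: "?bd 1 C5" using ex[OF c(5)] ..
  define A where "A = 1 + C1 + C2 + C3"
  define B where "B = max 1 (C4 + C5)"
  define e where "e = 2 * \<bar>a\<bar> + 2 * \<bar>b\<bar>"
  \<comment> \<open>Where \<open>Y n \<le> 2 * B\<close>, the inverse of the normalized term is at
    most \<open>4 * (2 * B) powr e\<close>, that is \<open>inverse k\<close>.\<close>
  define k where "k = (2 * B) powr (- e) / 4"
  have B: "1 \<le> B" "C4 + C5 \<le> B" and k: "0 < k" by (auto simp: B_def k_def)
  have "summable (\<lambda>n. x ^ n * ((p + 1 / (real n + 1)) powr (- a) * (q + 1 / (real n + 1)) powr (- b))) \<and>
    comparable (max 1 (max A (2 / k))) (\<Sum>n. x ^ n * ((p + 1 / (real n + 1)) powr (- a) * (q + 1 / (real n + 1)) powr (- b)))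
      ((1 - x + p) powr (- a) * (1 - x + q) powr (- b) / (1 - x))"
    if x: "0 \<le> x" "x < 1" and pq: "0 \<le> p" "0 \<le> q" for x p q
  proof -
    note C1 = b1[rule_format, OF x] and C2 = b2[rule_format, OF x] and C3 = b3[rule_format, OF x]
      and C4 = b4[rule_format, OF x] and C5 = b5[rule_format, OF x]
    let ?d = "1 - x"
    let ?y = "\<lambda>n. ?d * (real n + 1)"
    define r where "r p n = (p + 1 / (real n + 1)) / (?d + p)" for p n
    define g where "g n = r p n powr (- a) * r q n powr (- b)" for n
    define D where "D = (?d + p) powr (- a) * (?d + q) powr (- b)"
    have d: "0 < ?d" "0 < ?d + p" "0 < ?d + q" and D: "0 < D" using x pq by (auto simp: D_def)
    have y: "0 < ?y n" for n using x by auto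
    have rpos: "0 < r p n" "0 < r q n" for n
      unfolding r_def
      by (rule divide_pos_pos[OF add_nonneg_pos[OF pq(1)] d(2)], simp,
          rule divide_pos_pos[OF add_nonneg_pos[OF pq(2)] d(3)], simp)
    have eq: "x ^ n * ((p + 1 / (real n + 1)) powr (- a) * (q + 1 / (real n + 1)) powr (- b)) = D * (x ^ n * g n)" for n
      using d pq unfolding D_def g_def r_def by (simp add: powr_divide)
    have r_le: "r p n powr c \<le> 1 + ?y n powr (- c)" "r q n powr c \<le> 1 + ?y n powr (- c)" for n c
      unfolding r_def using ratio_powr_le[OF d(1) pq(1), of "real n + 1" c] ratio_powr_le[OF d(1) pq(2), of "real n + 1" c] by auto
    have geo: "summable (\<lambda>n. x ^ n)" "(\<Sum>n. x ^ n) = 1 / ?d"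
      using x by (auto simp: summable_geometric suminf_geometric)
    let ?U = "\<lambda>n. x ^ n + x ^ n * ?y n powr a + x ^ n * ?y n powr b + x ^ n * ?y n powr (a + b)"
    have g0: "0 < g n" for n using rpos[of n] by (simp add: g_def)
    have upper: "x ^ n * g n \<le> ?U n" for n
    proof -
      have "g n \<le> (1 + ?y n powr a) * (1 + ?y n powr b)"
        unfolding g_def using r_le(1)[of n "- a"] r_le(2)[of n "- b"] by (intro mult_mono) auto
      also have "\<dots> = 1 + ?y n powr a + ?y n powr b + ?y n powr (a + b)"
        by (simp add: powr_add algebra_simps)
      finally have "x ^ n * g n \<le> x ^ n * (1 + ?y n powr a + ?y n powr b + ?y n powr (a + b))"
        using x by (intro mult_left_mono) auto
      then show ?thesis by (simp only: distrib_left mult_1_right)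
    qed
    have U: "summable ?U" using C1 C2 C3 geo by (intro summable_add) auto
    have sg: "summable (\<lambda>n. x ^ n * g n)"
    proof (rule summable_comparison_test'[OF U, of 0])
      show "norm (x ^ n * g n) \<le> ?U n" for n
        using upper[of n] x(1) g0[of n] by (simp add: abs_mult)
    qed
    have "(\<Sum>n. x ^ n * g n) \<le> suminf ?U" by (rule suminf_le[OF upper sg U])
    also have "suminf ?U = 1 / ?d + (\<Sum>n. x ^ n * ?y n powr a) + (\<Sum>n. x ^ n * ?y n powr b) + (\<Sum>n. x ^ n * ?y n powr (a + b))"
      unfolding geo(2)[symmetric]
      by (intro sums_unique[symmetric] sums_add summable_sums geo(1) conjunct1[OF C1]
          conjunct1[OF C2] conjunct1[OF C3])
    also have "\<dots> \<le> 1 / ?d + C1 / ?d + C2 / ?d + C3 / ?d"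
      using C1 C2 C3 by (intro add_mono) auto
    also have "\<dots> = A / ?d" by (simp add: A_def add_divide_distrib)
    finally have up: "(\<Sum>n. x ^ n * g n) \<le> A / ?d" .
    define Y where "Y n = ?y n powr (- (1 / 2)) + ?y n powr 1" for n
    have Yb: "1 \<le> Y n" "?y n powr c \<le> Y n powr (2 * \<bar>c\<bar>)" for n c
      using powr_le_max_powr[OF y Y_def] by auto
    \<comment> \<open>A minorant affine in \<open>Y\<close>, negative where \<open>Y\<close> is
      large. Since \<open>Y\<close> has mean at most \<open>B\<close>, summation keeps at least half
      of \<open>k\<close>.\<close>
    have low: "k * (1 - Y n / (2 * B)) \<le> g n" for n
    proof (cases "Y n \<le> 2 * B")
      case True
      have one: "1 + ?y n powr c \<le> 2 * Y n powr (2 * \<bar>c\<bar>)" for c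
        using Yb(2)[of n c] ge_one_powr_ge_zero[OF Yb(1)[of n], of "2 * \<bar>c\<bar>"] by linarith
      have "inverse (g n) = r p n powr a * r q n powr b" 
        unfolding g_def by (simp only: powr_minus inverse_mult_distrib inverse_inverse_eq)
      also have "\<dots> \<le> (1 + ?y n powr (- a)) * (1 + ?y n powr (- b))"
        by (intro mult_mono r_le(1)[of n a] r_le(2)[of n b] add_nonneg_nonneg zero_le_one powr_ge_zero)
      also have "\<dots> \<le> (2 * Y n powr (2 * \<bar>- a\<bar>)) * (2 * Y n powr (2 * \<bar>- b\<bar>))"
        by (intro mult_mono one add_nonneg_nonneg mult_nonneg_nonneg zero_le_one powr_ge_zero zero_le_numeral)
      also have "\<dots> = 4 * Y n powr e"
        unfolding e_def powr_add abs_minus_cancel by (simp only: mult.assoc mult.left_commute)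
      also have "\<dots> \<le> 4 * (2 * B) powr e"
      proof (intro mult_left_mono powr_mono2)
        show "0 \<le> e" "Y n \<le> 2 * B" "0 \<le> Y n" using True Yb(1)[of n] by (simp_all add: e_def)
      qed simp
      also have "\<dots> = inverse k"
      proof -
        have "4 * w = inverse (inverse w / 4)" for w :: real by (cases "w = 0") (simp_all add: field_simps)
        then show ?thesis unfolding k_def powr_minus .
      qed
      finally have "inverse (g n) \<le> inverse k" .
      then have "k \<le> g n" using k g0[of n] by (simp add: inverse_le_iff_le)
      moreover have "0 \<le> Y n / (2 * B)" using B Yb(1)[of n] by simp
      then have "k * (1 - Y n / (2 * B)) \<le> k * 1" using k by (intro mult_left_mono) simp_all
      ultimately show ?thesis by linarith
    next
      case False
      then have "1 - Y n / (2 * B) \<le> 0" using B by (simp add: divide_simps)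
      then have "k * (1 - Y n / (2 * B)) \<le> 0" using k by (simp add: mult_nonneg_nonpos)
      then show ?thesis using g0[of n] by simp
    qed
    have Ys: "summable (\<lambda>n. x ^ n * Y n)" "(\<Sum>n. x ^ n * Y n) \<le> B / ?d"
    proof -
      have eqY: "x ^ n * Y n = x ^ n * ?y n powr (- (1 / 2)) + x ^ n * ?y n powr 1" for n
        unfolding Y_def by (rule distrib_left)
      show "summable (\<lambda>n. x ^ n * Y n)" unfolding eqY using C4 C5 by (intro summable_add) auto
      have "(\<Sum>n. x ^ n * Y n) = (\<Sum>n. x ^ n * ?y n powr (- (1 / 2))) + (\<Sum>n. x ^ n * ?y n powr 1)"
        unfolding eqY using C4 C5 by (intro suminf_add[symmetric]) auto
      also have "\<dots> \<le> C4 / ?d + C5 / ?d" using C4 C5 by (intro add_mono) auto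
      also have "\<dots> \<le> B / ?d" using B d by (simp add: divide_right_mono flip: add_divide_distrib)
      finally show "(\<Sum>n. x ^ n * Y n) \<le> B / ?d" .
    qed
    have "k / (2 * ?d) \<le> (\<Sum>n. x ^ n * g n)"
    proof -
      let ?V = "\<lambda>n. k * x ^ n - k / (2 * B) * (x ^ n * Y n)"
      have V: "summable ?V" by (intro summable_diff summable_mult geo Ys)
      have "k / (2 * ?d) = k * (1 / ?d) - k / (2 * B) * (B / ?d)" using B d by (simp add: divide_simps)
      also have "\<dots> \<le> k * (1 / ?d) - k / (2 * B) * (\<Sum>n. x ^ n * Y n)"
        using Ys(2) k B by (intro diff_left_mono mult_left_mono) auto
      also have "\<dots> = suminf ?V"
        unfolding geo(2)[symmetric] by (intro sums_unique sums_diff sums_mult summable_sums geo(1) Ys(1))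
      also have "\<dots> \<le> (\<Sum>n. x ^ n * g n)"
      proof (rule suminf_le[OF _ V sg])
        fix n
        have "x ^ n * (k * (1 - Y n / (2 * B))) \<le> x ^ n * g n" using low x by (intro mult_left_mono) auto
        then show "?V n \<le> x ^ n * g n" by (simp add: algebra_simps)
      qed
      finally show ?thesis .
    qed
    have "comparable (max 1 (max A (2 / k))) (D * S) (D / ?d)" if "S \<le> A / ?d" "k / (2 * ?d) \<le> S" for S
    proof (rule comparableI)
      have "0 < k / (2 * ?d)" using k d by simp
      then have S: "0 < S" using that by linarith
      then show "0 \<le> D * S" "0 \<le> D / ?d" using D d by auto
      have "D * S \<le> D * (A / ?d)" using that D by (intro mult_left_mono) auto
      then show "D * S \<le> A * (D / ?d)" by (simp add: mult.commute)
      have "(2 * D / k) * (k / (2 * c)) = D / c" for c using k by simp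
      then have "D / ?d = (2 * D / k) * (k / (2 * ?d))" by (rule sym)
      also have "\<dots> \<le> (2 * D / k) * S" using that D k by (intro mult_left_mono) auto
      also have "\<dots> = 2 / k * (D * S)" by simp
      finally show "D / ?d \<le> 2 / k * (D * S)" .
    qed
    note cmp = this[OF up \<open>k / (2 * ?d) \<le> _\<close>]
    have cmp': "comparable (max 1 (max A (2 / k))) (D * (\<Sum>n. x ^ n * g n))
        ((?d + p) powr (- a) * (?d + q) powr (- b) / ?d)"
      using cmp by (simp only: D_def)
    show ?thesis
      unfolding eq suminf_mult[OF sg] by (rule conjI[OF summable_mult[OF sg] cmp'])
  qed
  then show ?thesis by blast
qed

text \<open>The duplication formula writes \<open>1 / (m!)^2\<close> as
  \<open>4 ^ m * pochhammer (1/2) m / (m! * (2 * m)!)\<close>. The double factorials assemble to the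
  binomial, and each remaining Pochhammer quotient is comparable to a power.\<close>

lemma bailey_coeff_comparable:
  assumes ab: "\<alpha> > -1" "\<beta> > -1"
  shows "\<exists>C. \<forall>m k. comparable C (bailey_coeff \<alpha> \<beta> m k)
    (4 ^ (m + k) * real (2 * (m + k) choose (2 * m)) * ((real (m + k) + 1) powr (\<alpha> + \<beta> + 1) *
      ((real m + 1) powr (- (\<alpha> + 1/2)) * (real k + 1) powr (- (\<beta> + 1/2)))))"
proof -
  let ?P = "\<lambda>x n. pochhammer x n / fact n :: real"
  obtain C1 where C1: "\<And>n. comparable C1 (?P (\<alpha> + \<beta> + 2) n) ((real n + 1) powr (\<alpha> + \<beta> + 1))"
    using pochhammer_fact_comparable[of "\<alpha> + \<beta> + 2"] ab by (auto simp: algebra_simps)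
  obtain C2 where C2: "\<And>n. comparable C2 (?P (\<alpha> + 1) n) ((real n + 1) powr \<alpha>)"
    using pochhammer_fact_comparable[of "\<alpha> + 1"] ab by auto
  obtain C3 where C3: "\<And>n. comparable C3 (?P (\<beta> + 1) n) ((real n + 1) powr \<beta>)"
    using pochhammer_fact_comparable[of "\<beta> + 1"] ab by auto
  obtain C4 where C4: "\<And>n. comparable C4 (?P (1/2) n) ((real n + 1) powr (1/2 - 1))"
    using pochhammer_fact_comparable[of "1/2"] by auto
  define E where "E = 1 * (C1 * 2 powr \<bar>\<alpha> + \<beta> + 1\<bar> * (C4 * C2 * (C4 * C3)))"
  have "comparable E (bailey_coeff \<alpha> \<beta> m k)
    (4 ^ (m + k) * real (2 * (m + k) choose (2 * m)) * ((real (m + k) + 1) powr (\<alpha> + \<beta> + 1) *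
      ((real m + 1) powr (- (\<alpha> + 1/2)) * (real k + 1) powr (- (\<beta> + 1/2)))))" for m k
  proof -
    have half: "fact (2 * n) = 4 ^ n * ?P (1/2) n * (fact n)\<^sup>2" for n
      by (simp add: fact_double power2_eq_square power_mult)
    have fm: "1 / (fact n)\<^sup>2 = 4 ^ n * ?P (1/2) n / fact (2 * n)" for n
    proof -
      have "pochhammer (1/2 :: real) n \<noteq> 0" using pochhammer_pos[of "1/2 :: real" n] by simp
      then show ?thesis unfolding half by (simp add: power2_eq_square)
    qed
    have ch: "real (2 * (m + k) choose (2 * m)) = fact (2 * (m + k)) / (fact (2 * m) * fact (2 * k))"
      using binomial_fact[of "2 * m" "2 * (m + k)", where 'a = real] by simp
    have "bailey_coeff \<alpha> \<beta> m k = ?P (\<alpha> + \<beta> + 2) (2 * (m + k)) * fact (2 * (m + k)) *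
       (inverse (?P (\<alpha> + 1) m) * (1 / (fact m)\<^sup>2)) * (inverse (?P (\<beta> + 1) k) * (1 / (fact k)\<^sup>2))"
      by (simp add: bailey_coeff_def power2_eq_square inverse_eq_divide)
    also have "\<dots> = 4 ^ (m + k) * real (2 * (m + k) choose (2 * m)) * (?P (\<alpha> + \<beta> + 2) (2 * (m + k)) *
       ((?P (1/2) m * inverse (?P (\<alpha> + 1) m)) * (?P (1/2) k * inverse (?P (\<beta> + 1) k))))"
    proof -
      have "P * F * (inverse A * (u * h / f)) * (inverse B * (v * h' / f')) = 
        (u * v) * (F / (f * f')) * (P * ((h * inverse A) * (h' * inverse B)))" for P F A B u v h h' f f' :: real
        by (simp add: divide_inverse)
      then show ?thesis unfolding fm ch power_add .
    qed
    finally have eq: "bailey_coeff \<alpha> \<beta> m k = \<dots>" .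
    have c1: "comparable (C1 * 2 powr \<bar>\<alpha> + \<beta> + 1\<bar>) (?P (\<alpha> + \<beta> + 2) (2 * (m + k))) ((real (m + k) + 1) powr (\<alpha> + \<beta> + 1))"
    proof (rule comparable_trans[OF C1 comparable_powr])
      show "comparable 2 (real (2 * (m + k)) + 1) (real (m + k) + 1)" by (auto simp: comparable_def)
    qed
    have c2: "comparable (C4 * C2) (?P (1/2) m * inverse (?P (\<alpha> + 1) m)) ((real m + 1) powr (- (\<alpha> + 1/2)))" for m
    proof -
      have "u powr (1/2 - 1) * inverse (u powr \<alpha>) = u powr (- (\<alpha> + 1/2))" for u :: real
      proof -
        have e: "- (\<alpha> + 1/2) = (1/2 - 1) + - \<alpha>" by simp
        show ?thesis by (simp only: e powr_add powr_minus)
      qed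
      then show ?thesis using comparable_mult[OF C4 comparable_inverse[OF C2], of m m] by (simp only:)
    qed
    have c3: "comparable (C4 * C3) (?P (1/2) m * inverse (?P (\<beta> + 1) m)) ((real m + 1) powr (- (\<beta> + 1/2)))" for m
    proof -
      have "u powr (1/2 - 1) * inverse (u powr \<beta>) = u powr (- (\<beta> + 1/2))" for u :: real
      proof -
        have e: "- (\<beta> + 1/2) = (1/2 - 1) + - \<beta>" by simp
        show ?thesis by (simp only: e powr_add powr_minus)
      qed
      then show ?thesis using comparable_mult[OF C4 comparable_inverse[OF C3], of m m] by (simp only:)
    qed
    show ?thesis
      unfolding eq E_def by (intro comparable_mult c1 c2 c3 comparable_refl) simp
  qed
  then show ?thesis by blast
qed

text \<open>Writing the two products as \<open>(s * p)^2\<close> and \<open>(s * q)^2\<close> lets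
  \<open>s\<close> come out by homogeneity, leaving even-indexed binomial weights with
  \<open>p + q = 1\<close>.\<close>

lemma bailey_poly_comparable:
  assumes ab: "\<alpha> > -1" "\<beta> > -1"
  shows "\<exists>C. \<forall>x y s p q N. 0 \<le> p \<longrightarrow> 0 \<le> q \<longrightarrow> p + q = 1 \<longrightarrow> x * y = (s * p)\<^sup>2 \<longrightarrow> (1 - x) * (1 - y) = (s * q)\<^sup>2 \<longrightarrow>
    comparable C (poly (bailey_poly \<alpha> \<beta> N y) x)
      ((4 * s\<^sup>2) ^ N * ((p + 1 / (real N + 1)) powr (- (\<alpha> + 1/2)) * (q + 1 / (real N + 1)) powr (- (\<beta> + 1/2))))"
proof -
  let ?a = "\<alpha> + 1/2" and ?b = "\<beta> + 1/2"
  let ?bc = "\<lambda>m k. 4 ^ (m + k) * real (2 * (m + k) choose (2 * m)) * ((real (m + k) + 1) powr (\<alpha> + \<beta> + 1) *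
      ((real m + 1) powr (- ?a) * (real k + 1) powr (- ?b)))"
  obtain C1 where C1: "\<And>m k. comparable C1 (bailey_coeff \<alpha> \<beta> m k) (?bc m k)"
    using bailey_coeff_comparable[OF ab] by blast
  obtain C2 where C2: "\<And>p q N. 0 \<le> p \<Longrightarrow> 0 \<le> q \<Longrightarrow> p + q = 1 \<Longrightarrow>
    comparable C2 (\<Sum>m\<le>N. binom_weight p q (2 * N) (2 * m) * ((real m + 1) powr (- ?a) * (real (N - m) + 1) powr (- ?b)))
       ((real N * p + 1) powr (- ?a) * (real N * q + 1) powr (- ?b))"
    using even_binomial_weighted_comparable[of "- ?a" "- ?b"] by blast
  define E where "E = C1 * 1 * (1 * (C2 * (2 powr \<bar>- ?a\<bar> * 2 powr \<bar>- ?b\<bar>)))"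
  have "comparable E (poly (bailey_poly \<alpha> \<beta> N y) x)
      ((4 * s\<^sup>2) ^ N * ((p + 1 / (real N + 1)) powr (- ?a) * (q + 1 / (real N + 1)) powr (- ?b)))"
    if pq: "0 \<le> p" "0 \<le> q" "p + q = 1" and xy: "x * y = (s * p)\<^sup>2" "(1 - x) * (1 - y) = (s * q)\<^sup>2" for x y s p q N
  proof -
    let ?n = "real N + 1"
    have pw: "(x * y) ^ m * ((1 - x) * (1 - y)) ^ (N - m) = (s\<^sup>2) ^ N * (p ^ (2 * m) * q ^ (2 * N - 2 * m))" if "m \<le> N" for m
    proof -
      have 1: "(s\<^sup>2) ^ N = (s\<^sup>2) ^ m * (s\<^sup>2) ^ (N - m)" using that by (simp flip: power_add)
      have "2 * N - 2 * m = 2 * (N - m)" by simp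
      then have 2: "q ^ (2 * N - 2 * m) = (q\<^sup>2) ^ (N - m)" "p ^ (2 * m) = (p\<^sup>2) ^ m"
        by (simp_all only: power_mult)
      show ?thesis unfolding xy 1 2 power_mult_distrib by simp
    qed
    have bp: "poly (bailey_poly \<alpha> \<beta> N y) x = (\<Sum>m\<le>N. bailey_coeff \<alpha> \<beta> m (N - m) * ((s\<^sup>2) ^ N * (p ^ (2 * m) * q ^ (2 * N - 2 * m))))"
      unfolding poly_bailey_poly by (intro sum.cong refl) (simp only: pw mult.assoc atMost_iff)
    have c0: "comparable (C1 * 1) (poly (bailey_poly \<alpha> \<beta> N y) x) (\<Sum>m\<le>N. ?bc m (N - m) * ((s\<^sup>2) ^ N * (p ^ (2 * m) * q ^ (2 * N - 2 * m))))"
      unfolding bp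
    proof (rule comparable_sum)
      show "1 \<le> C1 * 1" using C1[of 0 0] by (simp add: comparable_def)
    qed (intro comparable_mult C1 comparable_refl mult_nonneg_nonneg zero_le_power pq zero_le_power2)
    have eq: "(\<Sum>m\<le>N. ?bc m (N - m) * ((s\<^sup>2) ^ N * (p ^ (2 * m) * q ^ (2 * N - 2 * m)))) =
       (4 ^ N * (s\<^sup>2) ^ N * ?n powr (\<alpha> + \<beta> + 1)) *
       (\<Sum>m\<le>N. binom_weight p q (2 * N) (2 * m) * ((real m + 1) powr (- ?a) * (real (N - m) + 1) powr (- ?b)))"
      unfolding sum_distrib_left
    proof (intro sum.cong refl)
      fix m assume "m \<in> {..N}"
      then have m: "m + (N - m) = N" by simp
      show "?bc m (N - m) * ((s\<^sup>2) ^ N * (p ^ (2 * m) * q ^ (2 * N - 2 * m))) =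
        4 ^ N * (s\<^sup>2) ^ N * ?n powr (\<alpha> + \<beta> + 1) *
        (binom_weight p q (2 * N) (2 * m) * ((real m + 1) powr (- ?a) * (real (N - m) + 1) powr (- ?b)))"
        unfolding m binom_weight_def by (simp only: ac_simps)
    qed
    note 1 = c0[unfolded eq]
    have c: "comparable 2 (real N * u + 1) (?n * (u + 1 / ?n))" if u: "0 \<le> u" "u \<le> 1" for u
    proof -
      have e: "?n * (u + 1 / ?n) = real N * u + u + 1" by (simp add: field_simps)
      have "comparable 2 (t + 1) (t + u + 1)" if "0 \<le> t" for t :: real
        unfolding comparable_def using that u by auto
      then show ?thesis unfolding e using u by simp
    qed
    have pq1: "p \<le> 1" "q \<le> 1" using pq by auto
    have 2: "comparable (1 * (C2 * (2 powr \<bar>- ?a\<bar> * 2 powr \<bar>- ?b\<bar>)))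
       ((4 ^ N * (s\<^sup>2) ^ N * ?n powr (\<alpha> + \<beta> + 1)) *
       (\<Sum>m\<le>N. binom_weight p q (2 * N) (2 * m) * ((real m + 1) powr (- ?a) * (real (N - m) + 1) powr (- ?b))))
       ((4 ^ N * (s\<^sup>2) ^ N * ?n powr (\<alpha> + \<beta> + 1)) * ((?n * (p + 1 / ?n)) powr (- ?a) * (?n * (q + 1 / ?n)) powr (- ?b)))"
      by (rule comparable_mult[OF comparable_refl comparable_trans[OF C2[OF pq]
            comparable_mult[OF comparable_powr[OF c] comparable_powr[OF c]]]])
        (use pq pq1 in auto)
    have "?n powr (\<alpha> + \<beta> + 1) * ((?n * (p + 1 / ?n)) powr (- ?a) * (?n * (q + 1 / ?n)) powr (- ?b)) =
        (?n powr (\<alpha> + \<beta> + 1) * (?n powr (- ?a) * ?n powr (- ?b))) * ((p + 1 / ?n) powr (- ?a) * (q + 1 / ?n) powr (- ?b))"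
    proof -
      have "(?n * u) powr c = ?n powr c * u powr c" if "0 \<le> u" for u c :: real using that by (simp add: powr_mult)
      then show ?thesis using pq by simp
    qed
    \<comment> \<open>The exponents \<open>\<alpha> + \<beta> + 1\<close>,
      \<open>- (\<alpha> + 1/2)\<close> and \<open>- (\<beta> + 1/2)\<close> add up to zero, so no
      power of \<open>N\<close> remains.\<close>
    also have "?n powr (\<alpha> + \<beta> + 1) * (?n powr (- ?a) * ?n powr (- ?b)) = 1"
      by (simp flip: powr_add)
    finally have 3: "(4 ^ N * (s\<^sup>2) ^ N * ?n powr (\<alpha> + \<beta> + 1)) * ((?n * (p + 1 / ?n)) powr (- ?a) * (?n * (q + 1 / ?n)) powr (- ?b)) =
        (4 * s\<^sup>2) ^ N * ((p + 1 / ?n) powr (- ?a) * (q + 1 / ?n) powr (- ?b))"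
      by (simp only: mult.assoc power_mult_distrib mult_1)
    show ?thesis using comparable_trans[OF 1 2] unfolding 3 E_def .
  qed
  then show ?thesis by blast
qed

text \<open>Here \<open>d\<close> measures the distance to the boundary
  \<open>4 * z * s^2 = 1\<close> of convergence.\<close>

definition appell_size :: "real \<Rightarrow> real \<Rightarrow> real \<Rightarrow> real \<Rightarrow> real \<Rightarrow> real" where
  "appell_size \<alpha> \<beta> d p q = (d + p) powr (- (\<alpha> + 1/2)) * (d + q) powr (- (\<beta> + 1/2)) / d"

theorem bailey_series_comparable:
  assumes ab: "\<alpha> > -1" "\<beta> > -1"
  shows "\<exists>C. \<forall>x y s p q z. 0 \<le> p \<longrightarrow> 0 \<le> q \<longrightarrow> p + q = 1 \<longrightarrow> x * y = (s * p)\<^sup>2 \<longrightarrow> (1 - x) * (1 - y) = (s * q)\<^sup>2 \<longrightarrow>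
    0 \<le> z \<longrightarrow> 4 * z * s\<^sup>2 < 1 \<longrightarrow>
    summable (\<lambda>N. z ^ N * poly (bailey_poly \<alpha> \<beta> N y) x) \<and>
    comparable C (\<Sum>N. z ^ N * poly (bailey_poly \<alpha> \<beta> N y) x)
      (appell_size \<alpha> \<beta> (1 - 4 * z * s\<^sup>2) p q)"
proof -
  obtain C1 where C1: "\<And>x y s p q N. 0 \<le> p \<Longrightarrow> 0 \<le> q \<Longrightarrow> p + q = 1 \<Longrightarrow> x * y = (s * p)\<^sup>2 \<Longrightarrow> (1 - x) * (1 - y) = (s * q)\<^sup>2 \<Longrightarrow>
    comparable C1 (poly (bailey_poly \<alpha> \<beta> N y) x)
      ((4 * s\<^sup>2) ^ N * ((p + 1 / (real N + 1)) powr (- (\<alpha> + 1/2)) * (q + 1 / (real N + 1)) powr (- (\<beta> + 1/2))))"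
    using bailey_poly_comparable[OF ab] by blast
  have a: "\<alpha> + 1/2 > -1/2" and b: "\<beta> + 1/2 > -1/2" using ab by auto
  obtain C2 where C2: "\<And>x p q. 0 \<le> x \<Longrightarrow> x < 1 \<Longrightarrow> 0 \<le> p \<Longrightarrow> 0 \<le> q \<Longrightarrow>
    summable (\<lambda>n. x ^ n * ((p + 1 / (real n + 1)) powr (- (\<alpha> + 1/2)) * (q + 1 / (real n + 1)) powr (- (\<beta> + 1/2)))) \<and>
    comparable C2 (\<Sum>n. x ^ n * ((p + 1 / (real n + 1)) powr (- (\<alpha> + 1/2)) * (q + 1 / (real n + 1)) powr (- (\<beta> + 1/2))))
      ((1 - x + p) powr (- (\<alpha> + 1/2)) * (1 - x + q) powr (- (\<beta> + 1/2)) / (1 - x))"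
    using two_weight_series[OF a b] by blast
  have "summable (\<lambda>N. z ^ N * poly (bailey_poly \<alpha> \<beta> N y) x) \<and>
    comparable (1 * C1 * C2) (\<Sum>N. z ^ N * poly (bailey_poly \<alpha> \<beta> N y) x)
      (appell_size \<alpha> \<beta> (1 - 4 * z * s\<^sup>2) p q)"
    if h: "0 \<le> p" "0 \<le> q" "p + q = 1" "x * y = (s * p)\<^sup>2" "(1 - x) * (1 - y) = (s * q)\<^sup>2" "0 \<le> z" "4 * z * s\<^sup>2 < 1" for x y s p q z
  proof -
    have x0: "0 \<le> 4 * z * s\<^sup>2" using h by simp
    note 2 = C2[OF x0 h(7) h(1,2)]
    have eqz: "z ^ N * ((4 * s\<^sup>2) ^ N * w) = (4 * z * s\<^sup>2) ^ N * w" for N w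
      by (simp add: power_mult_distrib)
    have "comparable (1 * C1) (z ^ N * poly (bailey_poly \<alpha> \<beta> N y) x)
      (z ^ N * ((4 * s\<^sup>2) ^ N * ((p + 1 / (real N + 1)) powr (- (\<alpha> + 1/2)) * (q + 1 / (real N + 1)) powr (- (\<beta> + 1/2)))))" for N
      by (intro comparable_mult comparable_refl C1 h zero_le_power)
    then have "comparable (1 * C1) (z ^ N * poly (bailey_poly \<alpha> \<beta> N y) x)
      ((4 * z * s\<^sup>2) ^ N * ((p + 1 / (real N + 1)) powr (- (\<alpha> + 1/2)) * (q + 1 / (real N + 1)) powr (- (\<beta> + 1/2))))" for N
      unfolding eqz .
    note cs = comparable_suminf[OF this conjunct1[OF 2]]
    show ?thesis unfolding appell_size_def by (rule conjI[OF cs(1) comparable_trans[OF cs(2) conjunct2[OF 2]]])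
  qed
  then show ?thesis by blast
qed

subsection \<open>Normalization of the Jacobi polynomials\<close>

text \<open>The substitution \<open>x = sin (\<theta> / 2)^2\<close> leads to the Beta integral;
  working with nonnegative integrals yields integrability and value together.\<close>

lemma has_bochner_integral_jacobi_measure:
  assumes "a > -1" "b > -1"
  shows "has_bochner_integral (jacobi_measure a b) (\<lambda>\<theta>. (sin (\<theta> / 2)) ^ (2 * m) * (cos (\<theta> / 2)) ^ (2 * k))
     (Beta (a + 1 + real m) (b + 1 + real k))"
proof (rule has_bochner_integral_nn_integral)
  let ?F = "\<lambda>x. x powr (a + real m) * (1 - x) powr (b + real k)"
  let ?g = "\<lambda>\<theta>. (sin (\<theta> / 2))\<^sup>2"
  let ?g' = "\<lambda>\<theta>. sin (\<theta> / 2) * cos (\<theta> / 2)"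
  let ?f = "\<lambda>\<theta>. (sin (\<theta> / 2)) ^ (2 * m) * (cos (\<theta> / 2)) ^ (2 * k)"
  let ?w = "\<lambda>\<theta>. sin (\<theta> / 2) powr (2 * a + 1) * cos (\<theta> / 2) powr (2 * b + 1)"
  have sc: "0 \<le> sin (\<theta> / 2)" "0 \<le> cos (\<theta> / 2)" if "\<theta> \<in> {0..pi}" for \<theta>
    using that by (auto intro!: sin_ge_zero cos_ge_zero)
  show "?f \<in> borel_measurable (jacobi_measure a b)"
    unfolding jacobi_measure_def by (simp add: measurable_density_eq1 measurable_restrict_space1)
  show "AE x in jacobi_measure a b. 0 \<le> ?f x" by (simp add: power_mult)
  show "0 \<le> Beta (a + 1 + real m) (b + 1 + real k)"
    using assms by (simp add: Beta_def Gamma_real_nonneg)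
  have eq: "?f \<theta> * ?w \<theta> = ?F (?g \<theta>) * ?g' \<theta>" if "\<theta> \<in> {0..pi}" for \<theta>
  proof -
    have pw: "x ^ (2 * j) * x powr (2 * a + 1) = (x\<^sup>2) powr (a + real j) * x" if "0 \<le> x" for x a :: real and j
    \<comment> \<open>At 0 both sides vanish, the left one because \<open>0 powr c = 0\<close> for
      every exponent.\<close>
    proof (cases "x = 0")
      case False
      then have "0 < x" using that by simp
      have sq: "(x\<^sup>2) powr c = x powr (2 * c)" for c
        using powr_powr[of x 2 c] \<open>0 < x\<close> by (simp add: powr_numeral)
      have "(x\<^sup>2) powr (a + real j) * x = x powr (2 * (a + real j) + 1)"
        using powr_add[of x "2 * (a + real j)" 1] powr_one[of x] \<open>0 < x\<close> by (simp only: sq)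
      also have "\<dots> = x powr (real (2 * j) + (2 * a + 1))" by (rule arg_cong) simp
      also have "\<dots> = x powr real (2 * j) * x powr (2 * a + 1)" by (rule powr_add)
      also have "x powr real (2 * j) = x ^ (2 * j)" using \<open>0 < x\<close> by (rule powr_realpow)
      finally show ?thesis by simp
    qed simp
    have "1 - ?g \<theta> = (cos (\<theta> / 2))\<^sup>2" by (simp add: cos_squared_eq)
    note c = this
    have "?f \<theta> * ?w \<theta> = ((sin (\<theta> / 2)) ^ (2 * m) * sin (\<theta> / 2) powr (2 * a + 1)) *
        ((cos (\<theta> / 2)) ^ (2 * k) * cos (\<theta> / 2) powr (2 * b + 1))" by (simp only: ac_simps)
    also have "\<dots> = ?F (?g \<theta>) * ?g' \<theta>"
      unfolding c pw[OF sc(1)[OF that]] pw[OF sc(2)[OF that]] by (simp only: ac_simps)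
    finally show ?thesis .
  qed
  have "(\<integral>\<^sup>+\<theta>. ennreal (?f \<theta>) \<partial>jacobi_measure a b) =
      (\<integral>\<^sup>+\<theta>. ennreal (?w \<theta>) * ennreal (?f \<theta>) \<partial>restrict_space lborel {0..pi})"
    unfolding jacobi_measure_def by (subst nn_integral_density) (auto intro!: measurable_restrict_space1)
  also have "\<dots> = (\<integral>\<^sup>+\<theta>. ennreal (?w \<theta>) * ennreal (?f \<theta>) * indicator {0..pi} \<theta> \<partial>lborel)"
    by (subst nn_integral_restrict_space) auto
  also have "\<dots> = (\<integral>\<^sup>+\<theta>. ennreal (?F (?g \<theta>) * ?g' \<theta> * indicator {0..pi} \<theta>) \<partial>lborel)"
  proof (intro nn_integral_cong)
    fix \<theta> :: real
    show "ennreal (?w \<theta>) * ennreal (?f \<theta>) * indicator {0..pi} \<theta> = ennreal (?F (?g \<theta>) * ?g' \<theta> * indicator {0..pi} \<theta>)"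
    proof (cases "\<theta> \<in> {0..pi}")
      case True
      then show ?thesis using eq[OF True] sc[OF True] by (simp add: mult.commute flip: ennreal_mult)
    qed simp
  qed
  also have "\<dots> = (\<integral>\<^sup>+x. ennreal (?F x * indicator {?g 0..?g pi} x) \<partial>lborel)"
  proof (rule nn_integral_substitution[symmetric])
    show "set_borel_measurable borel {?g 0..?g pi} ?F"
      unfolding set_borel_measurable_def by measurable
    show "(?g has_real_derivative ?g' x) (at x)" for x
      by (auto intro!: derivative_eq_intros)
    show "continuous_on {0..pi} ?g'" by (intro continuous_intros) auto
    show "0 \<le> ?g' x" if "x \<in> {0..pi}" for x using sc[OF that] by simp
  qed simp
  also have "\<dots> = (\<integral>\<^sup>+x. ennreal (?F x) * indicator {0..1} x \<partial>lborel)"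
    by (intro nn_integral_cong) (auto simp: indicator_def)
  also have "\<dots> = ennreal (Beta (a + 1 + real m) (b + 1 + real k))"
    using has_integral_Beta_real[of "a + 1 + real m" "b + 1 + real k"] assms
    by (intro nn_integral_has_integral_lebesgue') (auto simp: add_ac)
  finally show "(\<integral>\<^sup>+\<theta>. ennreal (?f \<theta>) \<partial>jacobi_measure a b) = ennreal (Beta (a + 1 + real m) (b + 1 + real k))" .
qed

section \<open>Finite differences and orthogonality\<close>

lemma alternating_binomial_pascal:
  fixes f :: "nat \<Rightarrow> real"
  shows "(\<Sum>k\<le>Suc n. (-1) ^ k * real (Suc n choose k) * f k) =
    (\<Sum>k\<le>n. (-1) ^ k * real (n choose k) * (f k - f (Suc k)))"
proof -
  have 1: "(\<Sum>k\<le>Suc n. (-1) ^ k * real (Suc n choose k) * f k) =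
      f 0 + (\<Sum>k\<le>n. (-1) ^ Suc k * real (Suc n choose Suc k) * f (Suc k))"
    by (subst sum.atMost_Suc_shift) simp
  have "(\<Sum>k\<le>Suc n. (-1) ^ k * real (n choose k) * f k) =
      f 0 + (\<Sum>k\<le>n. (-1) ^ Suc k * real (n choose Suc k) * f (Suc k))"
    by (subst sum.atMost_Suc_shift) simp
  then have 2: "(\<Sum>k\<le>n. (-1) ^ k * real (n choose k) * f k) =
      f 0 + (\<Sum>k\<le>n. (-1) ^ Suc k * real (n choose Suc k) * f (Suc k))" by (simp add: binomial_eq_0)
  show ?thesis
    unfolding 1 right_diff_distrib sum_subtractf 2
    by (simp add: sum_subtractf[symmetric] sum_negf[symmetric] sum.distrib[symmetric] algebra_simps)
qed

text \<open>Up to sign an \<open>n\<close>-th finite difference of a polynomial of degree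
  \<open>j\<close> in \<open>k\<close>: it kills lower degrees and sees only the leading coefficient
  for \<open>j = n\<close>. One difference of a rising factorial is again a rising factorial, of
  degree one less.\<close>

lemma alternating_binomial_pochhammer:
  fixes a :: real
  assumes "j \<le> n"
  shows "(\<Sum>k\<le>n. (-1) ^ k * real (n choose k) * pochhammer (a + real k) j) = (if j = n then (-1) ^ n * fact n else 0)"
  using assms
proof (induction n arbitrary: a j)
  case (Suc n)
  show ?case
  proof (cases j)
    case 0
    then show ?thesis unfolding alternating_binomial_pascal by simp
  next
    case (Suc i)
    have d: "pochhammer (a + real k) (Suc i) - pochhammer (a + real (Suc k)) (Suc i) = - real (Suc i) * pochhammer ((a + 1) + real k) i" for k
    proof -
      have "pochhammer x (Suc i) - pochhammer (x + 1) (Suc i) = - real (Suc i) * pochhammer (x + 1) i" for x :: real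
        by (simp only: pochhammer_rec[of x] pochhammer_Suc[of "x + 1"]) (simp add: algebra_simps)
      from this[of "a + real k"] show ?thesis by (simp add: add_ac)
    qed
    have "(\<Sum>k\<le>Suc n. (-1) ^ k * real (Suc n choose k) * pochhammer (a + real k) j) =
        - real (Suc i) * (\<Sum>k\<le>n. (-1) ^ k * real (n choose k) * pochhammer ((a + 1) + real k) i)"
      unfolding alternating_binomial_pascal Suc d sum_distrib_left by (simp only: ac_simps)
    also have "\<dots> = - real (Suc i) * (if i = n then (-1) ^ n * fact n else 0)"
      using Suc.IH[of i "a + 1"] Suc.prems Suc by simp
    also have "\<dots> = (if j = Suc n then (-1) ^ Suc n * fact (Suc n) else 0)"
      using Suc by (simp add: algebra_simps)
    finally show ?thesis .
  qed
qed simp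

lemma pochhammer_times_Gamma: "x > 0 \<Longrightarrow> pochhammer x n * Gamma x = Gamma (x + real n)" for x :: real
proof -
  assume x: "x > 0"
  then have "x \<notin> \<int>\<^sub>\<le>\<^sub>0" by (auto elim!: nonpos_Ints_cases)
  then show ?thesis using pochhammer_Gamma[of x n] Gamma_real_pos[OF x] by simp
qed

text \<open>In each Beta integral the Gamma factors combine with the binomials to quantities free of
  \<open>k\<close>, except for \<open>pochhammer (a + 1 + k) j\<close>; orthogonality to lower
  powers is then the vanishing of a finite difference.\<close>

lemma has_bochner_integral_jacobi_sin_power:
  assumes ab: "a > -1" "b > -1" and "j \<le> n"
  shows "has_bochner_integral (jacobi_measure a b)
     (\<lambda>\<theta>. poly (jacobi_sin a b n) ((sin (\<theta> / 2))\<^sup>2) * ((sin (\<theta> / 2))\<^sup>2) ^ j)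
     (if j = n then (-1) ^ n * Gamma (a + 1 + real n) * Gamma (b + 1 + real n) / Gamma (a + b + 2 + real (2 * n)) else 0)"
proof -
  let ?G = "Gamma (a + 1 + real n) * Gamma (b + 1 + real n) / (fact n * Gamma (a + b + 2 + real (n + j)))"
  have int: "has_bochner_integral (jacobi_measure a b)
     (\<lambda>\<theta>. \<Sum>k\<le>n. jacobi_coeff a b n k * ((sin (\<theta> / 2)) ^ (2 * (k + j)) * (cos (\<theta> / 2)) ^ (2 * (n - k))))
     (\<Sum>k\<le>n. jacobi_coeff a b n k * Beta (a + 1 + real (k + j)) (b + 1 + real (n - k)))"
    by (intro has_bochner_integral_sum has_bochner_integral_mult_right has_bochner_integral_jacobi_measure ab)
  have eq1: "(\<Sum>k\<le>n. jacobi_coeff a b n k * ((sin (\<theta> / 2)) ^ (2 * (k + j)) * (cos (\<theta> / 2)) ^ (2 * (n - k)))) =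
     poly (jacobi_sin a b n) ((sin (\<theta> / 2))\<^sup>2) * ((sin (\<theta> / 2))\<^sup>2) ^ j" for \<theta> :: real
  proof -
    have c: "1 - (sin (\<theta> / 2))\<^sup>2 = (cos (\<theta> / 2))\<^sup>2" by (simp add: cos_squared_eq)
    have p: "u ^ (2 * (k + j)) = (u\<^sup>2) ^ k * (u\<^sup>2) ^ j" "u ^ (2 * k) = (u\<^sup>2) ^ k" for u :: real and k
      by (simp_all only: power_mult power_add)
    show ?thesis unfolding jacobi_sin_def poly_sum sum_distrib_right poly_smult poly_bern c p
      by (intro sum.cong refl) (simp only: power_add ac_simps)
  qed
  have eq2: "(\<Sum>k\<le>n. jacobi_coeff a b n k * Beta (a + 1 + real (k + j)) (b + 1 + real (n - k))) =
     ?G * (\<Sum>k\<le>n. (-1) ^ k * real (n choose k) * pochhammer ((a + 1) + real k) j)"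
    unfolding sum_distrib_left
  proof (intro sum.cong refl)
    fix k assume "k \<in> {..n}"
    then have k: "k \<le> n" by simp
    have 1: "((real n + a) gchoose (n - k)) = pochhammer (a + 1 + real k) (n - k) / fact (n - k)"
      using k by (simp add: gbinomial_pochhammer' of_nat_diff add_ac)
    have 2: "((real n + b) gchoose k) = pochhammer (b + 1 + real (n - k)) k / fact k"
      using k by (simp add: gbinomial_pochhammer' of_nat_diff algebra_simps)
    have pos: "0 < a + 1 + real k" "0 < b + 1 + real (n - k)" using ab by auto
    have e: "a + 1 + real k + real (n - k) = a + 1 + real n" "b + 1 + real (n - k) + real k = b + 1 + real n"
      "a + 1 + real (k + j) = a + 1 + real k + real j" using k by (simp_all add: of_nat_diff)
    have 3: "pochhammer (a + 1 + real k) (n - k) * Gamma (a + 1 + real k) = Gamma (a + 1 + real n)"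
      using pochhammer_times_Gamma[OF pos(1), of "n - k"] unfolding e .
    have 4: "pochhammer (b + 1 + real (n - k)) k * Gamma (b + 1 + real (n - k)) = Gamma (b + 1 + real n)"
      using pochhammer_times_Gamma[OF pos(2), of k] unfolding e .
    have 5: "Gamma (a + 1 + real (k + j)) = pochhammer (a + 1 + real k) j * Gamma (a + 1 + real k)"
      unfolding e by (rule pochhammer_times_Gamma[OF pos(1), symmetric])
    have 6: "real (n choose k) = fact n / (fact k * fact (n - k))" using k by (rule binomial_fact)
    have 7: "a + 1 + real (k + j) + (b + 1 + real (n - k)) = a + b + 2 + real (n + j)"
      using k by (simp add: of_nat_diff)
    have "e * (P / x) * (Q / y) * (R * A * B / D) = (P * A) * (Q * B) / (N * D) * (e * (N / (y * x)) * R)"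
      if "N \<noteq> 0" for e P x Q y R A B D N :: real
    proof -
      have "(P * A) * (Q * B) / (N * D) * (e * (N / (y * x)) * R) = e * (P / x) * (Q / y) * (R * A * B / D) * (N / N)"
        by (simp only: divide_inverse inverse_mult_distrib ac_simps)
      then show ?thesis using that by simp
    qed
    note alg = this
    show "jacobi_coeff a b n k * Beta (a + 1 + real (k + j)) (b + 1 + real (n - k)) =
       ?G * ((-1) ^ k * real (n choose k) * pochhammer ((a + 1) + real k) j)"
      unfolding jacobi_coeff_def Beta_def 1 2 5 6 7 3[symmetric] 4[symmetric] by (rule alg[OF fact_nonzero])
  qed
  have eq3: "?G * (\<Sum>k\<le>n. (-1) ^ k * real (n choose k) * pochhammer ((a + 1) + real k) j) =
      (if j = n then (-1) ^ n * Gamma (a + 1 + real n) * Gamma (b + 1 + real n) / Gamma (a + b + 2 + real (2 * n)) else 0)"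
  proof (cases "j = n")
    case True
    then have e2: "real (n + j) = real (2 * n)" by simp
    show ?thesis unfolding alternating_binomial_pochhammer[OF assms(3)] e2 using True by simp
  next
    case False
    then show ?thesis unfolding alternating_binomial_pochhammer[OF assms(3)] by simp
  qed
  show ?thesis using int unfolding eq1 eq2 eq3 .
qed

lemma degree_bern: "degree (bern m k) = m + k"
  and coeff_bern_top: "coeff (bern m k) (m + k) = (-1) ^ k"
proof -
  show d: "degree (bern m k) = m + k"
    unfolding bern_def by (subst degree_mult_eq) (auto simp: degree_power_eq)
  have "lead_coeff (bern m k) = (-1) ^ k"
    unfolding bern_def by (simp add: lead_coeff_mult lead_coeff_power)
  then show "coeff (bern m k) (m + k) = (-1) ^ k" by (simp add: d)
qed

lemma degree_jacobi_sin: "degree (jacobi_sin a b n) \<le> n"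
  unfolding jacobi_sin_def
  by (intro degree_sum_le order_trans[OF degree_smult_le]) (auto simp: degree_bern)

lemma coeff_jacobi_sin_top:
  "coeff (jacobi_sin a b n) n = (-1) ^ n * (pochhammer (real n + a + b + 1) n / fact n)"
proof -
  have "coeff (jacobi_sin a b n) n = (\<Sum>k\<le>n. jacobi_coeff a b n k * (-1) ^ (n - k))"
    unfolding jacobi_sin_def coeff_sum coeff_smult
  proof (intro sum.cong refl)
    fix k assume "k \<in> {..n}"
    then show "jacobi_coeff a b n k * coeff (bern k (n - k)) n = jacobi_coeff a b n k * (-1) ^ (n - k)"
      using coeff_bern_top[of k "n - k"] by simp
  qed
  also have "\<dots> = (\<Sum>k\<le>n. (-1) ^ n * (((real n + b) gchoose k) * ((real n + a) gchoose (n - k))))"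
  proof (intro sum.cong refl)
    fix k assume "k \<in> {..n}"
    then have "(-1 :: real) ^ k * (-1) ^ (n - k) = (-1) ^ n" by (simp flip: power_add)
    then show "jacobi_coeff a b n k * (-1) ^ (n - k) = (-1) ^ n * (((real n + b) gchoose k) * ((real n + a) gchoose (n - k)))"
      unfolding jacobi_coeff_def by (metis mult.assoc mult.commute)
  qed
  also have "\<dots> = (-1) ^ n * ((real n + b + (real n + a)) gchoose n)"
    unfolding sum_distrib_left[symmetric] atMost_atLeast0 gbinomial_Vandermonde ..
  also have "((real n + b + (real n + a)) gchoose n) = pochhammer (real n + a + b + 1) n / fact n"
    by (simp add: gbinomial_pochhammer' add_ac)
  finally show ?thesis .
qed

text \<open>Expanding one of the two factors in powers, orthogonality leaves only its top
  coefficient, which the Vandermonde convolution has evaluated.\<close>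

lemma integral_jacobi_sin_square:
  assumes ab: "a > -1" "b > -1"
  shows "(\<integral>\<theta>. (poly (jacobi_sin a b n) ((sin (\<theta> / 2))\<^sup>2))\<^sup>2 \<partial>jacobi_measure a b) =
    Beta (a + 1) (b + 1) / bailey_weight a b n"
proof -
  let ?J = "jacobi_sin a b n" and ?s = "\<lambda>\<theta>. (sin (\<theta> / 2))\<^sup>2 :: real"
  let ?c = "(-1) ^ n * Gamma (a + 1 + real n) * Gamma (b + 1 + real n) / Gamma (a + b + 2 + real (2 * n))"
  have J: "poly ?J x = (\<Sum>j\<le>n. coeff ?J j * x ^ j)" for x
    unfolding poly_altdef using degree_jacobi_sin[of a b n]
    by (intro sum.mono_neutral_left) (auto simp: coeff_eq_0)
  have "has_bochner_integral (jacobi_measure a b) (\<lambda>\<theta>. \<Sum>j\<le>n. coeff ?J j * (poly ?J (?s \<theta>) * (?s \<theta>) ^ j))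
     (\<Sum>j\<le>n. coeff ?J j * (if j = n then ?c else 0))"
    by (intro has_bochner_integral_sum has_bochner_integral_mult_right has_bochner_integral_jacobi_sin_power ab) simp
  moreover have "(\<Sum>j\<le>n. coeff ?J j * (poly ?J x * x ^ j)) = (poly ?J x)\<^sup>2" for x
    unfolding power2_eq_square by (subst (3) J) (simp add: sum_distrib_left ac_simps)
  ultimately have "(\<integral>\<theta>. (poly ?J (?s \<theta>))\<^sup>2 \<partial>jacobi_measure a b) = (\<Sum>j\<le>n. coeff ?J j * (if j = n then ?c else 0))"
    by (simp add: has_bochner_integral_integral_eq)
  also have "\<dots> = coeff ?J n * ?c" by (subst sum.remove[of _ n]) auto
  also have "\<dots> = Beta (a + 1) (b + 1) / bailey_weight a b n"
  proof -
    have g: "Gamma (a + 1 + real n) = pochhammer (a + 1) n * Gamma (a + 1)"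
      "Gamma (b + 1 + real n) = pochhammer (b + 1) n * Gamma (b + 1)"
      "Gamma (a + b + 2 + real (2 * n)) = pochhammer (a + b + 2) (2 * n) * Gamma (a + b + 2)"
      using ab by (intro pochhammer_times_Gamma[symmetric]; simp)+
    have e: "a + 1 + (b + 1) = a + b + 2" by simp
    have "(-1 :: real) ^ n * (-1) ^ n = 1" by (simp flip: power_mult_distrib)
    then have "((-1) ^ n * (p / f)) * ((-1) ^ n * (a * A) * (b * B) / (q * Q)) = (A * B / Q) / (q * f / (a * b * p))" for p f a A b B q Q :: real
      by (simp add: divide_inverse)
    then show ?thesis unfolding coeff_jacobi_sin_top g Beta_def bailey_weight_def e .
  qed
  finally show ?thesis .
qed

lemma poly_jacobi_poly_cos: "poly (jacobi_poly a b n) (cos \<theta>) = poly (jacobi_sin a b n) ((sin (\<theta> / 2))\<^sup>2)"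
proof -
  have "cos \<theta> = 1 - 2 * (sin (\<theta> / 2))\<^sup>2" using cos_double_sin[of "\<theta> / 2"] by simp
  then show ?thesis by (simp only: poly_jacobi_poly)
qed

lemma jacobi_trig_mult:
  assumes "a > -1" "b > -1"
  shows "jacobi_trig a b n \<theta> * jacobi_trig a b n \<phi> =
    jacobi_prod a b n ((sin (\<theta> / 2))\<^sup>2) ((sin (\<phi> / 2))\<^sup>2) / Beta (a + 1) (b + 1)"
proof -
  let ?h = "Beta (a + 1) (b + 1) / bailey_weight a b n"
  have "0 < Beta (a + 1) (b + 1)" using assms by (simp add: Beta_def Gamma_real_pos)
  then have h: "0 < ?h" using bailey_weight_pos[OF assms] by simp
  have n: "jacobi_norm a b n = sqrt ?h"
    unfolding jacobi_norm_def poly_jacobi_poly_cos integral_jacobi_sin_square[OF assms] ..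
  have "sqrt ?h * sqrt ?h = ?h" using h by (simp only: real_sqrt_mult_self abs_of_pos)
  then have "a / sqrt ?h * (b / sqrt ?h) = a * b / ?h" for a b :: real by (metis times_divide_times_eq)
  then show ?thesis
    unfolding jacobi_trig_def n poly_jacobi_poly_cos jacobi_prod_def by simp
qed

subsection \<open>The kernels as products\<close>

lemma sin_ge_half: "x / 2 \<le> sin x" if "0 \<le> x" "x \<le> pi / 2" for x :: real
proof -
  have "(\<Sum>m<3. sin_coeff m * x ^ m) = x"
    by (simp add: sin_coeff_def numeral_eq_Suc)
  then have "\<bar>sin x - x\<bar> \<le> inverse (fact 3) * \<bar>x\<bar> ^ 3"
    using Maclaurin_sin_bound[of x 3] by simp
  then have "\<bar>sin x - x\<bar> * 6 \<le> x ^ 3" using that by (simp add: fact_numeral)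
  moreover have "x - sin x \<le> \<bar>sin x - x\<bar>" by simp
  ultimately have 1: "x - x ^ 3 / 6 \<le> sin x" by argo
  \<comment> \<open>The cubic Taylor bound suffices as long as \<open>x * x \<le> 3\<close>, and
    \<open>1.6 * 1.6 = 2.56\<close>.\<close>
  have "x \<le> 1.6" using that pi_approx by simp
  then have "x * x \<le> 1.6 * 1.6" using that by (intro mult_mono) auto
  then have "x * (x * x) \<le> x * 3" using that by (intro mult_left_mono) auto
  then show ?thesis using 1 by (simp add: power3_eq_cube mult.assoc)
qed

lemma one_minus_exp_bounds:
  fixes t :: real
  assumes "0 < t" "t \<le> 1"
  shows "t / 3 \<le> 1 - exp (- t)" "1 - exp (- t) \<le> t" "1 / 3 \<le> exp (- t)"
proof -
  have "exp 1 \<le> (3 :: real)" using e_less_272 by simp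
  then have "exp t \<le> 3" using assms by (meson exp_le_cancel_iff order_trans)
  then show e: "1 / 3 \<le> exp (- t)" by (simp add: exp_minus field_simps)
  have "t * (1 / 3) \<le> t * exp (- t)" using assms e by (intro mult_left_mono) auto
  also have "\<dots> \<le> (exp t - 1) * exp (- t)"
  proof (rule mult_right_mono)
    show "t \<le> exp t - 1" using exp_ge_add_one_self[of t] by linarith
  qed simp
  also have "\<dots> = 1 - exp (- t)" by (simp add: left_diff_distrib flip: exp_add)
  finally show "t / 3 \<le> 1 - exp (- t)" by simp
  show "1 - exp (- t) \<le> t" using exp_ge_add_one_self[of "- t"] by simp
qed

section \<open>Bailey's series in half angles\<close>

lemma bailey_poly_nonneg:
  assumes "a > -1" "b > -1" "0 \<le> x" "x \<le> 1" "0 \<le> y" "y \<le> 1"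
  shows "0 \<le> poly (bailey_poly a b N y) x"
proof -
  have "0 \<le> bailey_coeff a b m k" for m k
    unfolding bailey_coeff_def using assms
    by (intro divide_nonneg_nonneg mult_nonneg_nonneg less_imp_le[OF pochhammer_pos] fact_ge_zero) auto
  then show ?thesis
    unfolding poly_bailey_poly using assms by (intro sum_nonneg mult_nonneg_nonneg zero_le_power) auto
qed

definition bailey_sum :: "real \<Rightarrow> real \<Rightarrow> real \<Rightarrow> real \<Rightarrow> real \<Rightarrow> real" where
  "bailey_sum a b z \<theta> \<phi> =
     (\<Sum>N. z ^ N * poly (bailey_poly a b N ((sin (\<phi> / 2))\<^sup>2)) ((sin (\<theta> / 2))\<^sup>2))"

text \<open>The general estimate is applied with \<open>s = cos ((\<theta> - \<phi>) / 2)\<close>,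
  and its probabilities \<open>p\<close>, \<open>q\<close> are then traded for the products
  \<open>s * p\<close>, \<open>s * q\<close> of sines and cosines.\<close>

lemma bailey_series_half_angle_comparable:
  assumes ab: "a > -1" "b > -1"
  shows "\<exists>C. \<forall>\<theta> \<phi> z. \<theta> \<in> {0..pi} \<longrightarrow> \<phi> \<in> {0..pi} \<longrightarrow> 0 \<le> z \<longrightarrow> z < 1 / 4 \<longrightarrow>
    summable (\<lambda>N. z ^ N * poly (bailey_poly a b N ((sin (\<phi> / 2))\<^sup>2)) ((sin (\<theta> / 2))\<^sup>2)) \<and>
    comparable C (bailey_sum a b z \<theta> \<phi>)
      (appell_size a b (1 - 4 * z * (cos ((\<theta> - \<phi>) / 2))\<^sup>2) (sin (\<theta> / 2) * sin (\<phi> / 2)) (cos (\<theta> / 2) * cos (\<phi> / 2)))"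
proof -
  let ?a = "a + 1/2" and ?b = "b + 1/2"
  obtain C1 where C1: "\<And>x y s p q z. 0 \<le> p \<Longrightarrow> 0 \<le> q \<Longrightarrow> p + q = 1 \<Longrightarrow> x * y = (s * p)\<^sup>2 \<Longrightarrow> (1 - x) * (1 - y) = (s * q)\<^sup>2 \<Longrightarrow>
    0 \<le> z \<Longrightarrow> 4 * z * s\<^sup>2 < 1 \<Longrightarrow>
    summable (\<lambda>N. z ^ N * poly (bailey_poly a b N y) x) \<and>
    comparable C1 (\<Sum>N. z ^ N * poly (bailey_poly a b N y) x)
      (appell_size a b (1 - 4 * z * s\<^sup>2) p q)"
    using bailey_series_comparable[OF ab] by blast
  define E where "E = C1 * (3 powr \<bar>- ?a\<bar> * 3 powr \<bar>- ?b\<bar> * 1)"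
  have "summable (\<lambda>N. z ^ N * poly (bailey_poly a b N ((sin (\<phi> / 2))\<^sup>2)) ((sin (\<theta> / 2))\<^sup>2)) \<and>
    comparable E (bailey_sum a b z \<theta> \<phi>)
      (appell_size a b (1 - 4 * z * (cos ((\<theta> - \<phi>) / 2))\<^sup>2) (sin (\<theta> / 2) * sin (\<phi> / 2)) (cos (\<theta> / 2) * cos (\<phi> / 2)))"
    if tp: "\<theta> \<in> {0..pi}" "\<phi> \<in> {0..pi}" and z: "0 \<le> z" "z < 1 / 4" for \<theta> \<phi> z
  proof -
    define u where "u = sin (\<theta> / 2) * sin (\<phi> / 2)"
    define v where "v = cos (\<theta> / 2) * cos (\<phi> / 2)"
    define s where "s = cos ((\<theta> - \<phi>) / 2)"
    define d where "d = 1 - 4 * z * s\<^sup>2"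
    have u0: "0 \<le> u" unfolding u_def using tp by (intro mult_nonneg_nonneg sin_ge_zero) auto
    have v0: "0 \<le> v" unfolding v_def using tp by (intro mult_nonneg_nonneg cos_ge_zero) auto
    have s: "u + v = s" unfolding s_def u_def v_def diff_divide_distrib cos_diff by simp
    have s1: "s \<le> 1" "0 \<le> s" using u0 v0 s unfolding s_def by auto
    obtain p q where pq: "0 \<le> p" "0 \<le> q" "p + q = 1" "s * p = u" "s * q = v"
    \<comment> \<open>If \<open>s = 0\<close>, both products vanish and do not determine
      \<open>p\<close> and \<open>q\<close>; the pair 1, 0 is a valid choice.\<close>
    proof (cases "s = 0")
      case True
      then show ?thesis using that[of 1 0] s u0 v0 by simp
    next
      case False
      then show ?thesis using that[of "u / s" "v / s"] s u0 v0 s1 by (simp add: add_divide_distrib[symmetric])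
    qed
    have "s\<^sup>2 \<le> 1" using s1 by (simp add: power_le_one)
    then have "4 * z * s\<^sup>2 \<le> 4 * z * 1" using z by (intro mult_left_mono) auto
    then have zs: "4 * z * s\<^sup>2 < 1" using z by simp
    then have d0: "0 < d" by (simp add: d_def)
    \<comment> \<open>Removing the factor \<open>s\<close> costs a factor 2 when
      \<open>s \<ge> 1/2\<close>. Otherwise \<open>4 * z < 1\<close> gives
      \<open>d \<ge> 3/4\<close>, and \<open>d\<close> alone dominates \<open>p'\<close>, which is
      at most 1.\<close>
    have near: "comparable 3 (d + p') (d + u')" if "0 \<le> p'" "p' \<le> 1" "s * p' = u'" for p' u'
    proof -
      have u'0: "0 \<le> u'" using mult_nonneg_nonneg[OF s1(2) that(1)] that(3) by simp
      have "s * p' \<le> 1 * p'" using that s1 by (intro mult_right_mono) auto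
      then have up: "u' \<le> p'" using that by simp
      have "d + p' \<le> 3 * (d + u')"
      proof (cases "s \<ge> 1 / 2")
        case True
        then have "(1 / 2) * p' \<le> s * p'" using that by (intro mult_right_mono) auto
        then show ?thesis using that d0 by simp
      next
        case False
        then have "s * s \<le> (1 / 2) * (1 / 2)" using s1 by (intro mult_mono) auto
        moreover have "4 * z * s\<^sup>2 \<le> 1 * s\<^sup>2" using z by (intro mult_right_mono) auto
        ultimately have "3 / 4 \<le> d" unfolding d_def power2_eq_square by simp
        then show ?thesis using that u'0 by simp
      qed
      then show ?thesis unfolding comparable_def using up u'0 d0 that by simp
    qed
    have p1: "p \<le> 1" "q \<le> 1" using pq by auto
    have xy: "(sin (\<theta> / 2))\<^sup>2 * (sin (\<phi> / 2))\<^sup>2 = (s * p)\<^sup>2"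
      unfolding pq(4) u_def by (simp add: power_mult_distrib)
    have xy': "(1 - (sin (\<theta> / 2))\<^sup>2) * (1 - (sin (\<phi> / 2))\<^sup>2) = (s * q)\<^sup>2"
      unfolding pq(5) v_def by (simp add: power_mult_distrib cos_squared_eq)
    note c1 = C1[OF pq(1-3) xy xy' z(1) zs, folded d_def]
    have c2: "comparable (3 powr \<bar>- ?a\<bar> * 3 powr \<bar>- ?b\<bar> * 1) (appell_size a b d p q) (appell_size a b d u v)"
      unfolding appell_size_def divide_inverse[of _ d]
      using comparable_mult[OF comparable_mult[OF
          comparable_powr[OF near[OF pq(1) p1(1) pq(4)], of "- ?a"]
          comparable_powr[OF near[OF pq(2) p1(2) pq(5)], of "- ?b"]]
          comparable_refl[of "inverse d"]] d0 by simp
    show ?thesis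
      unfolding bailey_sum_def s_def[symmetric] u_def[symmetric] v_def[symmetric] d_def[symmetric] E_def
      by (rule conjI[OF conjunct1[OF c1] comparable_trans[OF conjunct2[OF c1] c2]])
  qed
  then show ?thesis by blast
qed

lemma summable_bailey_sum:
  assumes "a > -1" "b > -1" "\<theta> \<in> {0..pi}" "\<phi> \<in> {0..pi}" "0 \<le> z" "z < 1 / 4"
  shows "summable (\<lambda>N. z ^ N * poly (bailey_poly a b N ((sin (\<phi> / 2))\<^sup>2)) ((sin (\<theta> / 2))\<^sup>2))"
  using bailey_series_half_angle_comparable[OF assms(1,2)] assms(3-) by blast

lemma sin_sq_le_one: "(sin x)\<^sup>2 \<le> 1" for x :: real
  by (simp add: abs_square_le_1)

lemma bailey_sum_term_nonneg:
  assumes "a > -1" "b > -1" "0 \<le> z"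
  shows "0 \<le> z ^ N * poly (bailey_poly a b N ((sin (\<phi> / 2))\<^sup>2)) ((sin (\<theta> / 2))\<^sup>2)"
  by (intro mult_nonneg_nonneg bailey_poly_nonneg zero_le_power assms sin_sq_le_one zero_le_power2)

lemma poly_bailey_poly_0: "poly (bailey_poly a b 0 y) x = 1"
  by (simp add: poly_bailey_poly bailey_coeff_def)

lemma bailey_sum_ge_1:
  assumes "a > -1" "b > -1" "\<theta> \<in> {0..pi}" "\<phi> \<in> {0..pi}" "0 \<le> z" "z < 1 / 4"
  shows "1 \<le> bailey_sum a b z \<theta> \<phi>"
proof -
  have "(\<Sum>N<1. z ^ N * poly (bailey_poly a b N ((sin (\<phi> / 2))\<^sup>2)) ((sin (\<theta> / 2))\<^sup>2)) \<le> bailey_sum a b z \<theta> \<phi>"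
    unfolding bailey_sum_def
    by (intro sum_le_suminf summable_bailey_sum assms bailey_sum_term_nonneg) auto
  then show ?thesis by (simp add: poly_bailey_poly_0)
qed

lemma exp_ratio_bounds:
  fixes t :: real
  assumes "0 < t"
  defines "r \<equiv> exp (- t)"
  shows "0 < r" "r < 1" "0 \<le> r / (1 + r)\<^sup>2" "r / (1 + r)\<^sup>2 < 1 / 4"
    and "1 - 4 * (r / (1 + r)\<^sup>2) = ((1 - r) / (1 + r))\<^sup>2" "r / (1 + r)\<^sup>2 \<le> r"
proof -
  show r: "0 < r" "r < 1" using assms by (auto simp: r_def)
  then show "0 \<le> r / (1 + r)\<^sup>2" by simp
  show e: "1 - 4 * (r / (1 + r)\<^sup>2) = ((1 - r) / (1 + r))\<^sup>2"
    using r by (simp add: power_divide divide_simps) (simp add: power2_eq_square algebra_simps)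
  have "0 < 1 - 4 * (r / (1 + r)\<^sup>2)" unfolding e using r by simp
  then show "r / (1 + r)\<^sup>2 < 1 / 4" by linarith
  have "1 \<le> (1 + r)\<^sup>2" using r by simp
  then have "r / (1 + r)\<^sup>2 \<le> r / 1" using r by (intro divide_left_mono) auto
  then show "r / (1 + r)\<^sup>2 \<le> r" by simp
qed

definition poisson_factor :: "real \<Rightarrow> real \<Rightarrow> real" where
  "poisson_factor s t = exp (- t * (s / 2)) * ((1 - exp (- t)) * (1 + exp (- t)) powr (- (s + 1)))"

lemma aux_jacobi_poisson_kernel_sums:
  assumes ab: "a > -1" "b > -1" and t: "0 < t" and tp: "\<theta> \<in> {0..pi}" "\<phi> \<in> {0..pi}"
  shows "(\<lambda>n. exp (- t * (real n + (a + b + 1) / 2)) * jacobi_trig a b n \<theta> * jacobi_trig a b n \<phi>) sums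
    (poisson_factor (a + b + 1) t * bailey_sum a b (exp (- t) / (1 + exp (- t))\<^sup>2) \<theta> \<phi> / Beta (a + 1) (b + 1))"
proof -
  let ?r = "exp (- t)" and ?x = "(sin (\<theta> / 2))\<^sup>2" and ?y = "(sin (\<phi> / 2))\<^sup>2" and ?h = "Beta (a + 1) (b + 1)"
  let ?z = "?r / (1 + ?r)\<^sup>2" and ?e = "exp (- t * ((a + b + 1) / 2))"
  note b = exp_ratio_bounds[OF t]
  \<comment> \<open>Every \<open>x\<close> in the unit interval is
    \<open>sin (\<theta> / 2)^2\<close> for some angle, so this is the half-angle estimate at equal
    angles.\<close>
  have sm: "summable (\<lambda>N. ?z ^ N * poly (bailey_poly a b N x) x)" if "0 \<le> x" "x \<le> 1" for x
  proof -
    have sq: "0 \<le> sqrt x" "sqrt x \<le> 1" using that by auto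
    then have neg: "-1 \<le> sqrt x" by (rule_tac order_trans[of _ 0]) auto
    then have "0 \<le> arcsin (sqrt x)" "arcsin (sqrt x) \<le> pi / 2"
      using arcsin_le_mono[of 0 "sqrt x"] arcsin_ubound[of "sqrt x"] sq by auto
    then have th: "2 * arcsin (sqrt x) \<in> {0..pi}" by auto
    have sqe: "(sin (2 * arcsin (sqrt x) / 2))\<^sup>2 = x"
      using sin_arcsin[OF neg sq(2)] that by simp
    show ?thesis using summable_bailey_sum[OF ab th th b(3,4)] unfolding sqe .
  qed
  have "(\<lambda>n. ?r ^ n * jacobi_prod a b n ?x ?y) sums
     ((1 - ?r) * (1 + ?r) powr (- (a + b + 2)) * bailey_sum a b ?z \<theta> \<phi>)"
    unfolding bailey_sum_def
    by (rule bailey_formula[OF ab b(1,2) refl sm]) (auto simp: sin_sq_le_one)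
  then have "(\<lambda>n. ?e / ?h * (?r ^ n * jacobi_prod a b n ?x ?y)) sums
     (?e / ?h * ((1 - ?r) * (1 + ?r) powr (- (a + b + 2)) * bailey_sum a b ?z \<theta> \<phi>))"
    by (rule sums_mult)
  moreover have "?e / ?h * (?r ^ n * jacobi_prod a b n ?x ?y) =
      exp (- t * (real n + (a + b + 1) / 2)) * jacobi_trig a b n \<theta> * jacobi_trig a b n \<phi>" for n
  proof -
    have "?r ^ n = exp (real n * (- t))" by (rule exp_of_nat_mult[symmetric])
    then have "exp (- t * (real n + (a + b + 1) / 2)) = ?e * ?r ^ n"
      by (simp add: algebra_simps flip: exp_add)
    then show ?thesis unfolding mult.assoc[of "exp (- t * (real n + _))"] jacobi_trig_mult[OF ab] by simp
  qed
  moreover have "?e / ?h * ((1 - ?r) * (1 + ?r) powr (- (a + b + 2)) * bailey_sum a b ?z \<theta> \<phi>) =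
     poisson_factor (a + b + 1) t * bailey_sum a b ?z \<theta> \<phi> / ?h"
  proof -
    have "- (a + b + 1 + 1) = - (a + b + 2)" by simp
    then show ?thesis unfolding poisson_factor_def by (simp only:) simp
  qed
  ultimately show ?thesis by (simp only:)
qed

lemma aux_jacobi_poisson_kernel_eq:
  assumes "a > -1" "b > -1" "0 < t" "\<theta> \<in> {0..pi}" "\<phi> \<in> {0..pi}"
  shows "aux_jacobi_poisson_kernel a b t \<theta> \<phi> =
    poisson_factor (a + b + 1) t * bailey_sum a b (exp (- t) / (1 + exp (- t))\<^sup>2) \<theta> \<phi> / Beta (a + 1) (b + 1)"
  unfolding aux_jacobi_poisson_kernel_def by (rule sums_unique[OF aux_jacobi_poisson_kernel_sums[OF assms], symmetric])

lemma Beta_pos: "a > -1 \<Longrightarrow> b > -1 \<Longrightarrow> 0 < Beta (a + 1) (b + 1)" for a :: real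
  by (simp add: Beta_def Gamma_real_pos)

text \<open>For \<open>n \<ge> 1\<close> the number \<open>n + s / 2\<close> is positive because
  \<open>s > -1\<close>, so the absolute value affects the term \<open>n = 0\<close> alone, and that
  term is constant in the angles.\<close>

lemma jacobi_poisson_kernel_eq:
  assumes ab: "a > -1" "b > -1" and t: "0 < t" and tp: "\<theta> \<in> {0..pi}" "\<phi> \<in> {0..pi}"
  defines "s \<equiv> a + b + 1"
  shows "jacobi_poisson_kernel a b t \<theta> \<phi> =
    aux_jacobi_poisson_kernel a b t \<theta> \<phi> + (exp (- t * (\<bar>s\<bar> / 2)) - exp (- t * (s / 2))) / Beta (a + 1) (b + 1)"
proof -
  let ?f = "\<lambda>n. exp (- t * (real n + s / 2)) * jacobi_trig a b n \<theta> * jacobi_trig a b n \<phi>"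
  let ?c = "(exp (- t * (\<bar>s\<bar> / 2)) - exp (- t * (s / 2))) / Beta (a + 1) (b + 1)"
  have f: "?f sums aux_jacobi_poisson_kernel a b t \<theta> \<phi>"
    unfolding aux_jacobi_poisson_kernel_eq[OF ab t tp] s_def by (rule aux_jacobi_poisson_kernel_sums[OF ab t tp])
  have "(\<lambda>n. if n = 0 then ?c else 0) sums ?c" using sums_single[of 0 "\<lambda>_. ?c"] by simp
  then have "(\<lambda>n. ?f n + (if n = 0 then ?c else 0)) sums (aux_jacobi_poisson_kernel a b t \<theta> \<phi> + ?c)"
    by (rule sums_add[OF f])
  moreover have "?f n + (if n = 0 then ?c else 0) =
      exp (- t * \<bar>real n + s / 2\<bar>) * jacobi_trig a b n \<theta> * jacobi_trig a b n \<phi>" for n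
  proof (cases "n = 0")
    case True
    have "jacobi_trig a b 0 \<theta> * jacobi_trig a b 0 \<phi> = 1 / Beta (a + 1) (b + 1)"
      unfolding jacobi_trig_mult[OF ab] jacobi_prod_0 ..
    then show ?thesis using True unfolding mult.assoc by (simp add: diff_divide_distrib)
  next
    case False
    then have "1 \<le> real n" by simp
    then have "0 \<le> real n + s / 2" using ab unfolding s_def by argo
    then show ?thesis using False by simp
  qed
  ultimately have "(\<lambda>n. exp (- t * \<bar>real n + s / 2\<bar>) * jacobi_trig a b n \<theta> * jacobi_trig a b n \<phi>) sums
      (aux_jacobi_poisson_kernel a b t \<theta> \<phi> + ?c)" by simp
  then show ?thesis unfolding jacobi_poisson_kernel_def s_def by (rule sums_unique[symmetric])
qed

lemma comparable_onI:
  assumes "\<And>t \<theta> \<phi>. t \<in> T \<Longrightarrow> \<theta> \<in> {0..pi} \<Longrightarrow> \<phi> \<in> {0..pi} \<Longrightarrow> comparable C (X t \<theta> \<phi>) (Y t \<theta> \<phi>)" "1 \<le> C"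
  shows "comparable_on T X Y"
  unfolding comparable_on_def
proof (intro exI[of _ C] conjI ballI)
  show "0 < C" using assms(2) by simp
  fix t \<theta> \<phi> assume "t \<in> T" "\<theta> \<in> {0..pi}" "\<phi> \<in> {0..pi}"
  note c = assms(1)[OF this]
  show "X t \<theta> \<phi> \<le> C * Y t \<theta> \<phi>" using c by (simp add: comparable_def)
  have "Y t \<theta> \<phi> \<le> C * X t \<theta> \<phi>" using c by (simp add: comparable_def)
  then have "inverse C * Y t \<theta> \<phi> \<le> inverse C * (C * X t \<theta> \<phi>)" using \<open>0 < C\<close> by (intro mult_left_mono) auto
  also have "inverse C * (C * X t \<theta> \<phi>) = X t \<theta> \<phi>" using \<open>0 < C\<close> by simp
  finally show "inverse C * Y t \<theta> \<phi> \<le> X t \<theta> \<phi>" .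
qed

subsection \<open>Estimates of the auxiliary kernel\<close>

lemma half_angle_bounds:
  assumes tp: "\<theta> \<in> {0..pi}" "\<phi> \<in> {0..pi}"
  shows "\<theta> * \<phi> / 16 \<le> sin (\<theta> / 2) * sin (\<phi> / 2)" "sin (\<theta> / 2) * sin (\<phi> / 2) \<le> \<theta> * \<phi>"
    and "(pi - \<theta>) * (pi - \<phi>) / 16 \<le> cos (\<theta> / 2) * cos (\<phi> / 2)" "cos (\<theta> / 2) * cos (\<phi> / 2) \<le> (pi - \<theta>) * (pi - \<phi>)"
    and "(\<theta> - \<phi>)\<^sup>2 / 16 \<le> 1 - (cos ((\<theta> - \<phi>) / 2))\<^sup>2" "1 - (cos ((\<theta> - \<phi>) / 2))\<^sup>2 \<le> (\<theta> - \<phi>)\<^sup>2"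
proof -
  have s: "x / 4 \<le> sin (x / 2)" "sin (x / 2) \<le> x" if "0 \<le> x" "x \<le> pi" for x :: real
    using sin_ge_half[of "x / 2"] sin_x_le_x[of "x / 2"] that by simp_all
  have prod: "x * y / 16 \<le> sin (x / 2) * sin (y / 2)" "sin (x / 2) * sin (y / 2) \<le> x * y"
    if "0 \<le> x" "x \<le> pi" "0 \<le> y" "y \<le> pi" for x y :: real
  proof -
    have nn: "0 \<le> sin (x / 2)" "0 \<le> sin (y / 2)" using s(1)[OF that(1,2)] s(1)[OF that(3,4)] that by argo+
    have "x / 4 * (y / 4) \<le> sin (x / 2) * sin (y / 2)"
      by (rule mult_mono[OF s(1)[OF that(1,2)] s(1)[OF that(3,4)]]) (use that nn in auto)
    then show "x * y / 16 \<le> sin (x / 2) * sin (y / 2)" by simp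
    show "sin (x / 2) * sin (y / 2) \<le> x * y"
      by (rule mult_mono[OF s(2)[OF that(1,2)] s(2)[OF that(3,4)]]) (use that nn in auto)
  qed
  show "\<theta> * \<phi> / 16 \<le> sin (\<theta> / 2) * sin (\<phi> / 2)" "sin (\<theta> / 2) * sin (\<phi> / 2) \<le> \<theta> * \<phi>"
    using prod[of \<theta> \<phi>] tp by auto
  have c: "cos (x / 2) = sin ((pi - x) / 2)" for x :: real
    by (simp add: cos_sin_eq diff_divide_distrib)
  show "(pi - \<theta>) * (pi - \<phi>) / 16 \<le> cos (\<theta> / 2) * cos (\<phi> / 2)" "cos (\<theta> / 2) * cos (\<phi> / 2) \<le> (pi - \<theta>) * (pi - \<phi>)"
    unfolding c using prod[of "pi - \<theta>" "pi - \<phi>"] tp by auto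
  have a: "0 \<le> \<bar>\<theta> - \<phi>\<bar>" "\<bar>\<theta> - \<phi>\<bar> \<le> pi" using tp by auto
  have "1 - (cos ((\<theta> - \<phi>) / 2))\<^sup>2 = (sin ((\<theta> - \<phi>) / 2))\<^sup>2" by (simp add: sin_squared_eq)
  also have "\<dots> = sin (\<bar>\<theta> - \<phi>\<bar> / 2) * sin (\<bar>\<theta> - \<phi>\<bar> / 2)"
  proof (cases "\<theta> \<ge> \<phi>")
    case False
    then have "\<bar>\<theta> - \<phi>\<bar> / 2 = - ((\<theta> - \<phi>) / 2)" by (simp add: field_simps)
    then show ?thesis by (simp only: sin_minus power2_eq_square minus_mult_minus)
  qed (simp add: power2_eq_square)
  finally have e: "1 - (cos ((\<theta> - \<phi>) / 2))\<^sup>2 = sin (\<bar>\<theta> - \<phi>\<bar> / 2) * sin (\<bar>\<theta> - \<phi>\<bar> / 2)" .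
  have "\<bar>\<theta> - \<phi>\<bar> * \<bar>\<theta> - \<phi>\<bar> = (\<theta> - \<phi>)\<^sup>2" by (simp add: power2_eq_square)
  then show "(\<theta> - \<phi>)\<^sup>2 / 16 \<le> 1 - (cos ((\<theta> - \<phi>) / 2))\<^sup>2" "1 - (cos ((\<theta> - \<phi>) / 2))\<^sup>2 \<le> (\<theta> - \<phi>)\<^sup>2"
    unfolding e using prod[OF a a] by auto
qed

lemma sum_squares_expand: "a\<^sup>2 + b\<^sup>2 = (a - b)\<^sup>2 + 2 * (a * b)" for a b :: real
  by (simp add: power2_eq_square algebra_simps)

text \<open>With \<open>z = exp (- t) / (1 + exp (- t))^2\<close>, \<open>d\<close> is
  \<open>1 - 4 * z\<close>, of order \<open>t^2\<close>, plus
  \<open>4 * z * sin ((\<theta> - \<phi>) / 2)^2\<close>. The other two claims follow from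
  \<open>\<theta>^2 + \<phi>^2 = (\<theta> - \<phi>)^2 + 2 * \<theta> * \<phi>\<close> and its
  reflection.\<close>

lemma comparable_delta:
  fixes t :: real
  assumes t: "0 < t" "t \<le> 1" and tp: "\<theta> \<in> {0..pi}" "\<phi> \<in> {0..pi}"
  defines "d \<equiv> 1 - 4 * (exp (- t) / (1 + exp (- t))\<^sup>2) * (cos ((\<theta> - \<phi>) / 2))\<^sup>2"
  shows "comparable 100 d (t\<^sup>2 + (\<theta> - \<phi>)\<^sup>2)"
    and "comparable 100 (d + sin (\<theta> / 2) * sin (\<phi> / 2)) (t\<^sup>2 + \<theta>\<^sup>2 + \<phi>\<^sup>2)"
    and "comparable 100 (d + cos (\<theta> / 2) * cos (\<phi> / 2)) (t\<^sup>2 + (pi - \<theta>)\<^sup>2 + (pi - \<phi>)\<^sup>2)"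
proof -
  let ?r = "exp (- t)"
  define z where "z = ?r / (1 + ?r)\<^sup>2"
  define c where "c = 1 - (cos ((\<theta> - \<phi>) / 2))\<^sup>2"
  define P where "P = (\<theta> - \<phi>)\<^sup>2"
  note e = one_minus_exp_bounds[OF t] and b = exp_ratio_bounds[OF t(1)]
  note h = half_angle_bounds[OF tp, folded c_def P_def]
  have P0: "0 \<le> P" by (simp add: P_def)
  then have c0: "0 \<le> c" using h(5) by argo
  have "t / 3 / 2 \<le> (1 - ?r) / (1 + ?r)" using e b(1,2) t by (intro frac_le) auto
  then have "(t / 6)\<^sup>2 \<le> ((1 - ?r) / (1 + ?r))\<^sup>2" using t by (intro power_mono) auto
  then have l1: "t\<^sup>2 / 36 \<le> 1 - 4 * z" using b(5) by (simp add: z_def power_divide)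
  have "(1 - ?r) / (1 + ?r) \<le> t / 1" using e(2) b(1,2) t by (intro frac_le) auto
  then have "((1 - ?r) / (1 + ?r))\<^sup>2 \<le> t\<^sup>2" using b(1,2) by (intro power_mono) auto
  then have u1: "1 - 4 * z \<le> t\<^sup>2" using b(5) by (simp add: z_def)
  have "(1 + ?r)\<^sup>2 \<le> 2\<^sup>2" using b(1,2) by (intro power_mono) auto
  moreover have "0 < (1 + ?r)\<^sup>2" by (intro zero_less_power add_pos_pos) auto
  ultimately have "?r / 4 \<le> z" unfolding z_def by (intro frac_le; simp)
  then have z: "1 / 3 \<le> 4 * z" "4 * z \<le> 1" using e(3) b(4)[folded z_def] by argo+
  have "1 - w * k = (1 - w) + w * (1 - k)" for w k :: real by (simp add: algebra_simps)
  then have d: "d = (1 - 4 * z) + 4 * z * c" unfolding d_def c_def z_def .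
  have "(1 / 3) * c \<le> 4 * z * c" "4 * z * c \<le> 1 * c" using z c0 by (intro mult_right_mono; simp)+
  \<comment> \<open>The 36 is the square of 6 from \<open>t / 6\<close>, the 48 is
    \<open>3 * 16\<close> from \<open>1 / 3 \<le> 4 * z\<close> and the sine bound; 100 exceeds
    every factor that occurs.\<close>
  then have lo: "t\<^sup>2 / 36 + P / 48 \<le> d" and up: "d \<le> t\<^sup>2 + P"
    unfolding d using l1 u1 h(5,6) by argo+
  have t0: "0 \<le> t\<^sup>2" by simp
  have d0: "0 \<le> d" using lo t0 P0 by argo
  have c1: "d \<le> 100 * (t\<^sup>2 + P)" "t\<^sup>2 + P \<le> 100 * d" "0 \<le> t\<^sup>2 + P" using lo up t0 P0 by argo+
  then show "comparable 100 d (t\<^sup>2 + (\<theta> - \<phi>)\<^sup>2)" unfolding comparable_def P_def[symmetric] using d0 by simp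
  have key: "comparable 100 (d + u) (t\<^sup>2 + (P + 2 * m))" if "0 \<le> m" "m / 16 \<le> u" "u \<le> m" for u m
  proof -
    have "d + u \<le> 100 * (t\<^sup>2 + (P + 2 * m))" "t\<^sup>2 + (P + 2 * m) \<le> 100 * (d + u)" "0 \<le> d + u" "0 \<le> t\<^sup>2 + (P + 2 * m)"
      using lo up t0 P0 that d0 by argo+
    then show ?thesis unfolding comparable_def by simp
  qed
  have "t\<^sup>2 + \<theta>\<^sup>2 + \<phi>\<^sup>2 = t\<^sup>2 + (P + 2 * (\<theta> * \<phi>))"
    unfolding P_def add.assoc sum_squares_expand[of \<theta> \<phi>] ..
  note eq = this
  have "0 \<le> \<theta> * \<phi>" using tp by simp
  from key[OF this h(1,2)] show "comparable 100 (d + sin (\<theta> / 2) * sin (\<phi> / 2)) (t\<^sup>2 + \<theta>\<^sup>2 + \<phi>\<^sup>2)"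
    unfolding eq .
  have "P = (pi - \<theta> - (pi - \<phi>))\<^sup>2" unfolding P_def by (simp add: power2_commute)
  then have "t\<^sup>2 + (pi - \<theta>)\<^sup>2 + (pi - \<phi>)\<^sup>2 = t\<^sup>2 + (P + 2 * ((pi - \<theta>) * (pi - \<phi>)))"
    unfolding add.assoc sum_squares_expand[of "pi - \<theta>" "pi - \<phi>"] by (simp only:)
  note eq' = this
  have "0 \<le> (pi - \<theta>) * (pi - \<phi>)" using tp by simp
  from key[OF this h(3,4)] show "comparable 100 (d + cos (\<theta> / 2) * cos (\<phi> / 2)) (t\<^sup>2 + (pi - \<theta>)\<^sup>2 + (pi - \<phi>)\<^sup>2)"
    unfolding eq' .
qed

lemma bailey_sum_comparable_small:
  assumes ab: "a > -1" "b > -1"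
  shows "\<exists>C. \<forall>t \<theta> \<phi>. 0 < t \<longrightarrow> t \<le> 1 \<longrightarrow> \<theta> \<in> {0..pi} \<longrightarrow> \<phi> \<in> {0..pi} \<longrightarrow>
    comparable C (bailey_sum a b (exp (- t) / (1 + exp (- t))\<^sup>2) \<theta> \<phi>)
      ((t\<^sup>2 + \<theta>\<^sup>2 + \<phi>\<^sup>2) powr (- (a + 1/2)) * (t\<^sup>2 + (pi - \<theta>)\<^sup>2 + (pi - \<phi>)\<^sup>2) powr (- (b + 1/2)) *
        inverse (t\<^sup>2 + (\<theta> - \<phi>)\<^sup>2))"
proof -
  let ?a = "a + 1/2" and ?b = "b + 1/2"
  obtain C1 where C1: "\<And>\<theta> \<phi> z. \<theta> \<in> {0..pi} \<Longrightarrow> \<phi> \<in> {0..pi} \<Longrightarrow> 0 \<le> z \<Longrightarrow> z < 1 / 4 \<Longrightarrow>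
    comparable C1 (bailey_sum a b z \<theta> \<phi>)
      (appell_size a b (1 - 4 * z * (cos ((\<theta> - \<phi>) / 2))\<^sup>2) (sin (\<theta> / 2) * sin (\<phi> / 2)) (cos (\<theta> / 2) * cos (\<phi> / 2)))"
    using bailey_series_half_angle_comparable[OF ab] by blast
  have "comparable (C1 * (100 powr \<bar>- ?a\<bar> * 100 powr \<bar>- ?b\<bar> * 100))
      (bailey_sum a b (exp (- t) / (1 + exp (- t))\<^sup>2) \<theta> \<phi>)
      ((t\<^sup>2 + \<theta>\<^sup>2 + \<phi>\<^sup>2) powr (- ?a) * (t\<^sup>2 + (pi - \<theta>)\<^sup>2 + (pi - \<phi>)\<^sup>2) powr (- ?b) *
        inverse (t\<^sup>2 + (\<theta> - \<phi>)\<^sup>2))"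
    if t: "0 < t" "t \<le> 1" and tp: "\<theta> \<in> {0..pi}" "\<phi> \<in> {0..pi}" for t \<theta> \<phi>
  proof -
    note d = comparable_delta[OF t tp] and c1 = C1[OF tp exp_ratio_bounds(3,4)[OF t(1)], unfolded appell_size_def]
    show ?thesis
      by (rule comparable_trans[OF c1])
        (subst divide_inverse, rule comparable_mult[OF comparable_mult[OF comparable_powr[OF d(2)] comparable_powr[OF d(3)]] comparable_inverse[OF d(1)]])
  qed
  then show ?thesis by blast
qed

lemma comparable_1_bounds: "1 \<le> C \<Longrightarrow> 1 / C \<le> x \<Longrightarrow> x \<le> C \<Longrightarrow> comparable C x 1"
  unfolding comparable_def by (auto simp: field_simps intro: order_trans[of 0 "1 / C"])

text \<open>The bound \<open>2 / 9\<close> keeps \<open>z\<close> away from the singular value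
  \<open>1 / 4\<close>, so \<open>d\<close> and both angular factors stay between fixed positive
  constants.\<close>

lemma bailey_sum_comparable_1:
  assumes ab: "a > -1" "b > -1"
  shows "\<exists>C. \<forall>z \<theta> \<phi>. 0 \<le> z \<longrightarrow> z \<le> 2 / 9 \<longrightarrow> \<theta> \<in> {0..pi} \<longrightarrow> \<phi> \<in> {0..pi} \<longrightarrow>
    comparable C (bailey_sum a b z \<theta> \<phi>) 1"
proof -
  let ?a = "a + 1/2" and ?b = "b + 1/2"
  obtain C1 where C1: "\<And>\<theta> \<phi> z. \<theta> \<in> {0..pi} \<Longrightarrow> \<phi> \<in> {0..pi} \<Longrightarrow> 0 \<le> z \<Longrightarrow> z < 1 / 4 \<Longrightarrow>
    comparable C1 (bailey_sum a b z \<theta> \<phi>)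
      (appell_size a b (1 - 4 * z * (cos ((\<theta> - \<phi>) / 2))\<^sup>2) (sin (\<theta> / 2) * sin (\<phi> / 2)) (cos (\<theta> / 2) * cos (\<phi> / 2)))"
    using bailey_series_half_angle_comparable[OF ab] by blast
  have "comparable (C1 * (9 powr \<bar>- ?a\<bar> * 9 powr \<bar>- ?b\<bar> * 9)) (bailey_sum a b z \<theta> \<phi>) (1 powr (- ?a) * 1 powr (- ?b) * inverse 1)"
    if z: "0 \<le> z" "z \<le> 2 / 9" and tp: "\<theta> \<in> {0..pi}" "\<phi> \<in> {0..pi}" for z \<theta> \<phi>
  proof -
    have z4: "z < 1 / 4" using z by argo
    define d where "d = 1 - 4 * z * (cos ((\<theta> - \<phi>) / 2))\<^sup>2"
    have cc: "0 \<le> (cos ((\<theta> - \<phi>) / 2))\<^sup>2" "(cos ((\<theta> - \<phi>) / 2))\<^sup>2 \<le> 1" by (simp_all add: abs_square_le_1)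
    have "4 * z * (cos ((\<theta> - \<phi>) / 2))\<^sup>2 \<le> (8 / 9) * 1" using cc z by (intro mult_mono) auto
    moreover have "0 \<le> 4 * z * (cos ((\<theta> - \<phi>) / 2))\<^sup>2" using z by simp
    ultimately have d: "1 / 9 \<le> d" "d \<le> 1" unfolding d_def by argo+
    have "0 \<le> sin (\<theta> / 2) * sin (\<phi> / 2)" using tp by (intro mult_nonneg_nonneg sin_ge_zero) auto
    moreover have "sin (\<theta> / 2) * sin (\<phi> / 2) \<le> 1 * 1" using tp by (intro mult_mono sin_ge_zero) auto
    ultimately have c: "comparable 9 (d + sin (\<theta> / 2) * sin (\<phi> / 2)) 1" using d by (intro comparable_1_bounds) argo+
    have "0 \<le> cos (\<theta> / 2) * cos (\<phi> / 2)" using tp by (intro mult_nonneg_nonneg cos_ge_zero) auto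
    moreover have "cos (\<theta> / 2) * cos (\<phi> / 2) \<le> 1 * 1" using tp by (intro mult_mono cos_ge_zero) auto
    ultimately have c': "comparable 9 (d + cos (\<theta> / 2) * cos (\<phi> / 2)) 1" using d by (intro comparable_1_bounds) argo+
    have c'': "comparable 9 d 1" using d by (intro comparable_1_bounds) argo+
    note c1 = C1[OF tp z(1) z4, folded d_def, unfolded appell_size_def]
    show ?thesis
      by (rule comparable_trans[OF c1])
        (subst divide_inverse, rule comparable_mult[OF comparable_mult[OF comparable_powr[OF c] comparable_powr[OF c']] comparable_inverse[OF c'']])
  qed
  then have "comparable (C1 * (9 powr \<bar>- ?a\<bar> * 9 powr \<bar>- ?b\<bar> * 9)) (bailey_sum a b z \<theta> \<phi>) 1"
    if "0 \<le> z" "z \<le> 2 / 9" "\<theta> \<in> {0..pi}" "\<phi> \<in> {0..pi}" for z \<theta> \<phi>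
    using that by simp
  then show ?thesis by blast
qed

text \<open>For \<open>t \<ge> 1\<close> one has \<open>r \<le> 1/2\<close>, and \<open>2/9\<close>
  is the value of \<open>r / (1 + r)^2\<close> at \<open>r = 1/2\<close>.\<close>

lemma exp_large_bounds:
  fixes t :: real
  assumes "1 \<le> t"
  shows "exp (- t) \<le> 1 / 2" "exp (- t) / (1 + exp (- t))\<^sup>2 \<le> 2 / 9"
proof -
  have "2 \<le> exp t" using exp_ge_add_one_self[of t] assms by argo
  then show r: "exp (- t) \<le> 1 / 2" by (simp add: exp_minus field_simps)
  \<comment> \<open>Obtained from
    \<open>2 * (1 + r)^2 - 9 * r = (2 - r) * (1 - 2 * r)\<close>.\<close>
  have "0 \<le> 4 * ((2 - exp (- t)) * (1 - 2 * exp (- t)))" using r by (intro mult_nonneg_nonneg) auto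
  then have "9 * exp (- t) \<le> 2 * (1 + exp (- t))\<^sup>2" by (simp add: power2_eq_square algebra_simps)
  moreover have "0 < (1 + exp (- t))\<^sup>2" by (intro zero_less_power add_pos_pos) auto
  ultimately show "exp (- t) / (1 + exp (- t))\<^sup>2 \<le> 2 / 9" by (simp add: divide_simps)
qed

lemma poisson_factor_comparable_small:
  "\<exists>C. \<forall>t. 0 < t \<longrightarrow> t \<le> 1 \<longrightarrow> comparable C (poisson_factor s t) t"
proof -
  have "comparable (exp (\<bar>s\<bar> / 2) * (3 * 2 powr \<bar>- (s + 1)\<bar>)) (poisson_factor s t) (1 * (t * 1 powr (- (s + 1))))"
    if t: "0 < t" "t \<le> 1" for t
    unfolding poisson_factor_def
  proof (intro comparable_mult comparable_powr)
    note e = one_minus_exp_bounds[OF t] and b = exp_ratio_bounds[OF t(1)]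
    have "\<bar>- t * (s / 2)\<bar> \<le> 1 * (\<bar>s\<bar> / 2)" unfolding abs_mult using t by (intro mult_mono) auto
    then have "- t * (s / 2) \<le> \<bar>s\<bar> / 2" "- (\<bar>s\<bar> / 2) \<le> - t * (s / 2)" by argo+
    then show "comparable (exp (\<bar>s\<bar> / 2)) (exp (- t * (s / 2))) 1"
      by (intro comparable_1_bounds) (simp_all add: inverse_eq_divide[symmetric] exp_minus[symmetric])
    show "comparable 3 (1 - exp (- t)) t" unfolding comparable_def using e b t by auto
    show "comparable 2 (1 + exp (- t)) 1" unfolding comparable_def using b(1,2) by auto
  qed
  then have "comparable (exp (\<bar>s\<bar> / 2) * (3 * 2 powr \<bar>- (s + 1)\<bar>)) (poisson_factor s t) t" if "0 < t" "t \<le> 1" for t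
    using that by simp
  then show ?thesis by blast
qed

lemma poisson_factor_comparable_large:
  "\<exists>C. \<forall>t. 1 \<le> t \<longrightarrow> comparable C (poisson_factor s t) (exp (- t * (s / 2)))"
proof -
  have "comparable (1 * (2 * 2 powr \<bar>- (s + 1)\<bar>)) (poisson_factor s t) (exp (- t * (s / 2)) * (1 * 1 powr (- (s + 1))))"
    if t: "1 \<le> t" for t
    unfolding poisson_factor_def
  proof (intro comparable_mult comparable_powr comparable_refl)
    have "comparable 2 (1 - e) 1" "comparable 2 (1 + e) 1" if "0 < e" "e \<le> 1 / 2" for e :: real
      unfolding comparable_def using that by auto
    from this[OF exp_gt_zero exp_large_bounds(1)[OF t]]
    show "comparable 2 (1 - exp (- t)) 1" "comparable 2 (1 + exp (- t)) 1" .
  qed simp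
  then have "comparable (1 * (2 * 2 powr \<bar>- (s + 1)\<bar>)) (poisson_factor s t) (exp (- t * (s / 2)))" if "1 \<le> t" for t
    using that by simp
  then show ?thesis by blast
qed

lemma aux_jacobi_poisson_kernel_comparable_small:
  assumes ab: "a > -1" "b > -1"
  shows "comparable_on {0<..1} (aux_jacobi_poisson_kernel a b)
       (\<lambda>t \<theta> \<phi>. (t\<^sup>2 + \<theta>\<^sup>2 + \<phi>\<^sup>2) powr (- a - 1/2) *
                (t\<^sup>2 + (pi - \<theta>)\<^sup>2 + (pi - \<phi>)\<^sup>2) powr (- b - 1/2) *
                (t / (t\<^sup>2 + (\<theta> - \<phi>)\<^sup>2)))"
proof -
  let ?h = "Beta (a + 1) (b + 1)"
  obtain C1 where C1: "\<And>t \<theta> \<phi>. 0 < t \<Longrightarrow> t \<le> 1 \<Longrightarrow> \<theta> \<in> {0..pi} \<Longrightarrow> \<phi> \<in> {0..pi} \<Longrightarrow>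
    comparable C1 (bailey_sum a b (exp (- t) / (1 + exp (- t))\<^sup>2) \<theta> \<phi>)
      ((t\<^sup>2 + \<theta>\<^sup>2 + \<phi>\<^sup>2) powr (- (a + 1/2)) * (t\<^sup>2 + (pi - \<theta>)\<^sup>2 + (pi - \<phi>)\<^sup>2) powr (- (b + 1/2)) *
        inverse (t\<^sup>2 + (\<theta> - \<phi>)\<^sup>2))"
    using bailey_sum_comparable_small[OF ab] by blast
  obtain C2 where C2: "\<And>t. 0 < t \<Longrightarrow> t \<le> 1 \<Longrightarrow> comparable C2 (poisson_factor (a + b + 1) t) t"
    using poisson_factor_comparable_small by blast
  have h: "0 < ?h" by (rule Beta_pos[OF ab])
  obtain C3 where C3: "comparable C3 (inverse ?h) 1"
    using comparableI[of "inverse ?h" 1 "inverse ?h" ?h] h by auto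
  show ?thesis
  proof (rule comparable_onI[where C = "C2 * C1 * C3"])
    fix t \<theta> \<phi> :: real
    assume t: "t \<in> {0<..1}" and tp: "\<theta> \<in> {0..pi}" "\<phi> \<in> {0..pi}"
    then have t': "0 < t" "t \<le> 1" by auto
    have e: "- (a + 1/2) = - a - 1/2" for a :: real by simp
    have "X * Y * (t / Q) = t * (X * Y * inverse Q) * 1" for X Y Q :: real by (simp add: divide_inverse)
    then show "comparable (C2 * C1 * C3) (aux_jacobi_poisson_kernel a b t \<theta> \<phi>)
       ((t\<^sup>2 + \<theta>\<^sup>2 + \<phi>\<^sup>2) powr (- a - 1/2) * (t\<^sup>2 + (pi - \<theta>)\<^sup>2 + (pi - \<phi>)\<^sup>2) powr (- b - 1/2) *
                (t / (t\<^sup>2 + (\<theta> - \<phi>)\<^sup>2)))"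
      using comparable_mult[OF comparable_mult[OF C2[OF t'] C1[OF t' tp]] C3]
      unfolding aux_jacobi_poisson_kernel_eq[OF ab t'(1) tp] divide_inverse[of _ ?h] e by (simp only:)
  next
    \<comment> \<open>\<open>comparable\<close> contains this bound on its constant, so one instance
      is enough.\<close>
    show "1 \<le> C2 * C1 * C3"
      using comparable_mult[OF comparable_mult[OF C2[of 1] C1[of 1 0 0]] C3] by (simp add: comparable_def)
  qed
qed

lemma aux_jacobi_poisson_kernel_comparable_large:
  assumes ab: "a > -1" "b > -1"
  shows "\<exists>C. 1 \<le> C \<and> (\<forall>t \<theta> \<phi>. 1 \<le> t \<longrightarrow> \<theta> \<in> {0..pi} \<longrightarrow> \<phi> \<in> {0..pi} \<longrightarrow>
     comparable C (aux_jacobi_poisson_kernel a b t \<theta> \<phi>) (exp (- t * ((a + b + 1) / 2))))"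
proof -
  let ?h = "Beta (a + 1) (b + 1)"
  obtain C1 where C1: "\<And>z \<theta> \<phi>. 0 \<le> z \<Longrightarrow> z \<le> 2 / 9 \<Longrightarrow> \<theta> \<in> {0..pi} \<Longrightarrow> \<phi> \<in> {0..pi} \<Longrightarrow>
    comparable C1 (bailey_sum a b z \<theta> \<phi>) 1"
    using bailey_sum_comparable_1[OF ab] by blast
  obtain C2 where C2: "\<And>t. 1 \<le> t \<Longrightarrow> comparable C2 (poisson_factor (a + b + 1) t) (exp (- t * ((a + b + 1) / 2)))"
    using poisson_factor_comparable_large by blast
  have h: "0 < ?h" by (rule Beta_pos[OF ab])
  obtain C3 where C3: "comparable C3 (inverse ?h) 1"
    using comparableI[of "inverse ?h" 1 "inverse ?h" ?h] h by auto
  have c: "comparable (C2 * C1 * C3) (aux_jacobi_poisson_kernel a b t \<theta> \<phi>) (exp (- t * ((a + b + 1) / 2)))"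
    if t: "1 \<le> t" and tp: "\<theta> \<in> {0..pi}" "\<phi> \<in> {0..pi}" for t \<theta> \<phi>
  proof -
    have t': "0 < t" using t by simp
    show ?thesis
      using comparable_mult[OF comparable_mult[OF C2[OF t] C1[OF exp_ratio_bounds(3)[OF t'] exp_large_bounds(2)[OF t] tp]] C3]
      unfolding aux_jacobi_poisson_kernel_eq[OF ab t' tp] divide_inverse[of _ ?h] by simp
  qed
  moreover have "1 \<le> C2 * C1 * C3" using c[of 1 0 0] by (simp add: comparable_def)
  ultimately show ?thesis by blast
qed

subsection \<open>The Poisson kernel for negative index\<close>

text \<open>The right side is convex in \<open>d\<close> and vanishes at \<open>d = 1\<close>; the
  left side is its tangent line there. It bounds from below what remains of the kernel when Bailey's
  sum is replaced by its first term 1.\<close>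

lemma poisson_gap_ge:
  fixes r d :: real
  assumes r: "0 < r" "r < 1"
  shows "(1 - d) * (- (r * ln r) - (1 - r) * ln (1 + r)) \<le> (1 - r) * (1 + r) powr (d - 1) - 1 + r powr d"
proof -
  have p: "1 + (d - 1) * ln x \<le> x powr (d - 1)" if "0 < x" for x
    unfolding powr_def using that exp_ge_add_one_self[of "(d - 1) * ln x"] by simp
  have "(1 - r) * (1 + (d - 1) * ln (1 + r)) \<le> (1 - r) * (1 + r) powr (d - 1)"
    using r by (intro mult_left_mono p) auto
  moreover have "r * (1 + (d - 1) * ln r) \<le> r * r powr (d - 1)"
    using r by (intro mult_left_mono p) auto
  moreover have "r * r powr (d - 1) = r powr d"
    using powr_add[of r 1 "d - 1"] r by simp
  ultimately show ?thesis by (simp add: algebra_simps)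
qed

text \<open>A fixed margin in \<open>ln (1 + r) \<le> r\<close>, available because \<open>r\<close>
  stays away from 0; \<open>1/3\<close> is the lower bound of \<open>exp (- t)\<close> for
  \<open>t \<le> 1\<close>.\<close>

lemma ln_one_plus_le_third:
  fixes r :: real
  assumes "1 / 3 \<le> r"
  shows "ln (1 + r) \<le> r - 1 / 36"
proof -
  have "1 / 3 * r \<le> r * r" using assms by (intro mult_right_mono) auto
  \<comment> \<open>Cleared of denominators this reads \<open>2 + 2 * r \<le> 35 * r^2\<close>,
    which \<open>r * r \<ge> r / 3\<close> makes linear.\<close>
  then have "(1 + r) \<le> (1 + r + r\<^sup>2 / 2) * (1 - 1 / 36)"
    unfolding power2_eq_square using assms by argo
  also have "\<dots> \<le> exp r * exp (- (1 / 36))"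
  proof (intro mult_mono)
    show "1 + r + r\<^sup>2 / 2 \<le> exp r" using assms by (intro exp_lower_Taylor_quadratic) simp
    show "1 - 1 / 36 \<le> exp (- (1 / 36) :: real)" using exp_ge_add_one_self[of "- (1 / 36) :: real"] by argo
  qed auto
  also have "\<dots> = exp (r - 1 / 36)" by (simp flip: exp_add)
  finally have "ln (1 + r) \<le> ln (exp (r - 1 / 36))" using assms by (intro ln_mono) auto
  then show ?thesis by simp
qed

text \<open>Both sides tend to 0 as \<open>r\<close> approaches 1, so a factor greater than 1 is
  required. The tangent bound leaves a gap of \<open>(1 - d) * (1 - r) / 36\<close>, and
  \<open>1 - r powr d \<le> 1 - r\<close> absorbs the factor into it.\<close>

lemma poisson_gap_small:
  fixes r d :: real
  assumes r: "1 / 3 \<le> r" "r < 1" and d: "0 < d" "d < 1"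
  shows "(1 + (1 - d) / 36) * (1 - r powr d) \<le> (1 - r) * (1 + r) powr (d - 1)"
proof -
  have "ln r \<le> r - 1" using r by (intro ln_le_minus_one) auto
  then have "r * ln r \<le> r * (r - 1)" using r by (intro mult_left_mono) auto
  moreover have "(1 - r) * ln (1 + r) \<le> (1 - r) * (r - 1 / 36)"
    using r by (intro mult_left_mono ln_one_plus_le_third) auto
  moreover have "(1 - r) * (r - 1 / 36) + r * (r - 1) = - ((1 - r) / 36)" by (simp add: algebra_simps)
  ultimately have "(1 - r) / 36 \<le> - (r * ln r) - (1 - r) * ln (1 + r)" by argo
  then have "(1 - d) * ((1 - r) / 36) \<le> (1 - d) * (- (r * ln r) - (1 - r) * ln (1 + r))"
    using d by (intro mult_left_mono) auto
  also have "\<dots> \<le> (1 - r) * (1 + r) powr (d - 1) - 1 + r powr d"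
    using r by (intro poisson_gap_ge) auto
  finally have 1: "(1 - d) * ((1 - r) / 36) \<le> (1 - r) * (1 + r) powr (d - 1) - 1 + r powr d" .
  have "r powr 1 \<le> r powr d" using r d by (intro powr_mono') auto
  then have "(1 - d) * ((1 - r powr d) / 36) \<le> (1 - d) * ((1 - r) / 36)"
    using r d by (intro mult_left_mono divide_right_mono) auto
  with 1 have "(1 - d) * ((1 - r powr d) / 36) + (1 - r powr d) \<le> (1 - r) * (1 + r) powr (d - 1)" by argo
  then show ?thesis by (simp add: algebra_simps add_divide_distrib diff_divide_distrib)
qed

text \<open>For small \<open>r\<close> the gap is about \<open>r powr d - (2 - d) * r\<close>, and
  the first power dominates. For \<open>r\<close> bounded below the tangent bound applies: since
  \<open>- ln r \<ge> 1\<close>, it gives at least \<open>(1 - d) * r^2\<close>.\<close>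

lemma poisson_gap_large:
  fixes d :: real
  assumes d: "0 < d" "d < 1"
  shows "\<exists>c>0. \<forall>t\<ge>1. c * exp (- t) powr d \<le> (1 - exp (- t)) * (1 + exp (- t)) powr (d - 1) - 1 + exp (- t) powr d"
proof -
  define e where "e = 1 - d"
  have e: "0 < e" "e < 1" using d by (auto simp: e_def)
  \<comment> \<open>The threshold at which \<open>(1 + e) * r powr e = 1/2\<close>; below it
    \<open>(1 + e) * r\<close> is at most half of \<open>r powr d\<close>.\<close>
  define k where "k = (1 / (2 * (1 + e))) powr (1 / e)"
  have k: "0 < k" "k powr e = 1 / (2 * (1 + e))" using e by (auto simp: k_def powr_powr)
  have "min (1 / 2) (e * k\<^sup>2) * r powr d \<le> (1 - r) * (1 + r) powr (d - 1) - 1 + r powr d"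
    if t: "1 \<le> t" and r_def: "r = exp (- t)" for t r
  proof -
    have r: "0 < r" "r < 1" and ln_r: "ln r = - t" using t by (auto simp: r_def)
    have rd: "r powr d \<le> 1" using r d by (intro powr_le1) auto
    have ln1: "ln (1 + r) \<le> r" using r by (intro ln_add_one_self_le_self) auto
    have A: "(1 - d) * (- (r * ln r) - (1 - r) * ln (1 + r)) \<le> (1 - r) * (1 + r) powr (d - 1) - 1 + r powr d"
      using r by (rule poisson_gap_ge)
    show ?thesis
    proof (cases "k \<le> r")
      case True
      have "r * 1 \<le> r * t" using t r by (intro mult_left_mono) auto
      moreover have "(1 - r) * ln (1 + r) \<le> (1 - r) * r" using r ln1 by (intro mult_left_mono) auto
      moreover have "(1 - r) * r = r - r\<^sup>2" by (simp add: power2_eq_square left_diff_distrib)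
      moreover have "r * ln r = - (r * t)" by (simp add: ln_r)
      ultimately have "r\<^sup>2 \<le> - (r * ln r) - (1 - r) * ln (1 + r)" by argo
      then have "e * r\<^sup>2 \<le> (1 - d) * (- (r * ln r) - (1 - r) * ln (1 + r))"
        unfolding e_def using d by (intro mult_left_mono) auto
      moreover have "e * k\<^sup>2 \<le> e * r\<^sup>2" using True k e by (intro mult_left_mono power_mono) auto
      moreover have "min (1 / 2) (e * k\<^sup>2) * r powr d \<le> (e * k\<^sup>2) * 1"
        using rd e k by (intro mult_mono) auto
      ultimately show ?thesis using A by argo
    next
      case False
      have "1 + (d - 1) * ln (1 + r) \<le> (1 + r) powr (d - 1)"
        unfolding powr_def using r exp_ge_add_one_self[of "(d - 1) * ln (1 + r)"] by simp
      moreover have "(1 - d) * ln (1 + r) \<le> (1 - d) * r" using ln1 d by (intro mult_left_mono) auto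
      moreover have "(d - 1) * ln (1 + r) = - ((1 - d) * ln (1 + r))" by (simp add: algebra_simps)
      ultimately have "1 - e * r \<le> (1 + r) powr (d - 1)" unfolding e_def by argo
      then have "(1 - r) * (1 - e * r) \<le> (1 - r) * (1 + r) powr (d - 1)" using r by (intro mult_left_mono) auto
      moreover have "(1 - r) * (1 - e * r) = 1 - (1 + e) * r + e * (r * r)" by (simp add: algebra_simps)
      moreover have "0 \<le> e * (r * r)" using e r by simp
      ultimately have B: "r powr d - (1 + e) * r \<le> (1 - r) * (1 + r) powr (d - 1) - 1 + r powr d" by argo
      have "r powr e \<le> k powr e" using False r e by (intro powr_mono2) auto
      then have "(1 + e) * (r powr d * r powr e) \<le> (1 + e) * (r powr d * (1 / (2 * (1 + e))))"
        unfolding k(2) using e by (intro mult_left_mono) auto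
      moreover have "r powr d * r powr e = r" using r by (simp add: e_def flip: powr_add)
      moreover have "(1 + e) * (r powr d * (1 / (2 * (1 + e)))) = r powr d / 2" using e by (simp add: field_simps)
      ultimately have "(1 + e) * r \<le> r powr d / 2" by (simp only:)
      moreover have "min (1 / 2) (e * k\<^sup>2) * r powr d \<le> (1 / 2) * r powr d" by (intro mult_right_mono) auto
      ultimately show ?thesis using B by argo
    qed
  qed
  moreover have "0 < min (1 / 2) (e * k\<^sup>2)" using e k by simp
  ultimately show ?thesis by blast
qed

text \<open>The constant term is 1 and the other coefficients are nonnegative, so on
  \<open>z \<le> 2/9\<close> the remainder is at most \<open>z / (2/9)\<close> times its value at
  \<open>2/9\<close>.\<close>

lemma bailey_sum_minus_1_le:
  assumes ab: "a > -1" "b > -1"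
  shows "\<exists>C\<ge>0. \<forall>z \<theta> \<phi>. 0 \<le> z \<longrightarrow> z \<le> 2 / 9 \<longrightarrow> \<theta> \<in> {0..pi} \<longrightarrow> \<phi> \<in> {0..pi} \<longrightarrow>
    bailey_sum a b z \<theta> \<phi> \<le> 1 + C * z"
proof -
  obtain C1 where C1: "\<And>z \<theta> \<phi>. 0 \<le> z \<Longrightarrow> z \<le> 2 / 9 \<Longrightarrow> \<theta> \<in> {0..pi} \<Longrightarrow> \<phi> \<in> {0..pi} \<Longrightarrow>
    comparable C1 (bailey_sum a b z \<theta> \<phi>) 1"
    using bailey_sum_comparable_1[OF ab] by blast
  have C0: "0 \<le> C1" using C1[of 0 0 0] by (simp add: comparable_def)
  have "bailey_sum a b z \<theta> \<phi> \<le> 1 + (9 / 2 * C1) * z"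
    if z: "0 \<le> z" "z \<le> 2 / 9" and tp: "\<theta> \<in> {0..pi}" "\<phi> \<in> {0..pi}" for z \<theta> \<phi>
  proof -
    define e where "e N = poly (bailey_poly a b N ((sin (\<phi> / 2))\<^sup>2)) ((sin (\<theta> / 2))\<^sup>2)" for N
    have e0: "e 0 = 1" by (simp add: e_def poly_bailey_poly_0)
    have en: "0 \<le> e N" for N
      unfolding e_def by (intro bailey_poly_nonneg ab sin_sq_le_one zero_le_power2)
    have sm: "summable (\<lambda>N. y ^ N * e N)" if "0 \<le> y" "y \<le> 2 / 9" for y
      unfolding e_def using that by (intro summable_bailey_sum ab tp) auto
    have split: "bailey_sum a b y \<theta> \<phi> = 1 + (\<Sum>N. y ^ Suc N * e (Suc N))" if "0 \<le> y" "y \<le> 2 / 9" for y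
      using suminf_split_head[OF sm[OF that]] by (simp add: bailey_sum_def e_def[symmetric] e0)
    have smS: "summable (\<lambda>N. y ^ Suc N * e (Suc N))" if "0 \<le> y" "y \<le> 2 / 9" for y
      using sm[OF that] by (subst summable_Suc_iff)
    have z1: "0 \<le> (2 / 9 :: real)" "2 / 9 \<le> (2 / 9 :: real)" by auto
    have "(\<Sum>N. z ^ Suc N * e (Suc N)) \<le> (\<Sum>N. 9 / 2 * z * ((2 / 9) ^ Suc N * e (Suc N)))"
    proof (rule suminf_le[OF _ smS[OF z] summable_mult[OF smS[OF z1]]])
      fix N
      have "z ^ N \<le> (2 / 9) ^ N" using z by (intro power_mono) auto
      then have "z * z ^ N * e (Suc N) \<le> z * (2 / 9) ^ N * e (Suc N)"
        using z en by (intro mult_right_mono mult_left_mono) auto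
      then show "z ^ Suc N * e (Suc N) \<le> 9 / 2 * z * ((2 / 9) ^ Suc N * e (Suc N))" by (simp add: ac_simps)
    qed
    also have "\<dots> = 9 / 2 * z * (\<Sum>N. (2 / 9) ^ Suc N * e (Suc N))" by (rule suminf_mult[OF smS[OF z1]])
    also have "\<dots> \<le> 9 / 2 * z * C1"
    proof (rule mult_left_mono)
      have "bailey_sum a b (2 / 9) \<theta> \<phi> \<le> C1" using C1[OF z1 tp] by (simp add: comparable_def)
      then show "(\<Sum>N. (2 / 9) ^ Suc N * e (Suc N)) \<le> C1" unfolding split[OF z1] by linarith
    qed (use z in simp)
    finally show ?thesis unfolding split[OF z] by (simp add: ac_simps)
  qed
  moreover have "0 \<le> 9 / 2 * C1" using C0 by simp
  ultimately show ?thesis by blast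
qed

section \<open>Comparison of the Poisson kernel for either sign of the index\<close>

lemma jacobi_poisson_kernel_nonneg_index:
  assumes "a > -1" "b > -1" "0 < t" "\<theta> \<in> {0..pi}" "\<phi> \<in> {0..pi}" "0 \<le> a + b + 1"
  shows "jacobi_poisson_kernel a b t \<theta> \<phi> = aux_jacobi_poisson_kernel a b t \<theta> \<phi>"
  unfolding jacobi_poisson_kernel_eq[OF assms(1-5)] abs_of_nonneg[OF assms(6)] by simp

lemma jacobi_poisson_kernel_neg_index:
  assumes ab: "a > -1" "b > -1" and t: "0 < t" and tp: "\<theta> \<in> {0..pi}" "\<phi> \<in> {0..pi}"
    and d: "d = - (a + b + 1)" "0 < d" and r: "r = exp (- t)"
  shows "jacobi_poisson_kernel a b t \<theta> \<phi> = exp (t * (d / 2)) / Beta (a + 1) (b + 1) *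
      ((1 - r) * (1 + r) powr (d - 1) * bailey_sum a b (r / (1 + r)\<^sup>2) \<theta> \<phi> - (1 - r powr d))"
    and "aux_jacobi_poisson_kernel a b t \<theta> \<phi> = exp (t * (d / 2)) / Beta (a + 1) (b + 1) *
      ((1 - r) * (1 + r) powr (d - 1) * bailey_sum a b (r / (1 + r)\<^sup>2) \<theta> \<phi>)"
    and "exp (- t * (\<bar>a + b + 1\<bar> / 2)) = exp (t * (d / 2)) * r powr d"
proof -
  have s: "a + b + 1 = - d" "\<bar>a + b + 1\<bar> = d" using d by auto
  have p: "- (- d + 1) = d - 1" "- t * (- d / 2) = t * (d / 2)" by simp_all
  show 1: "aux_jacobi_poisson_kernel a b t \<theta> \<phi> = exp (t * (d / 2)) / Beta (a + 1) (b + 1) *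
      ((1 - r) * (1 + r) powr (d - 1) * bailey_sum a b (r / (1 + r)\<^sup>2) \<theta> \<phi>)"
    unfolding aux_jacobi_poisson_kernel_eq[OF ab t tp] s(1) poisson_factor_def p r by simp
  have "r powr d = exp (d * (- t))" unfolding r powr_def by simp
  then have "exp (t * (d / 2)) * r powr d = exp (t * (d / 2) + d * (- t))" by (simp only: exp_add)
  also have "t * (d / 2) + d * (- t) = - t * (d / 2)" by (simp add: field_simps)
  finally have e: "exp (- t * (d / 2)) = exp (t * (d / 2)) * r powr d" by (rule sym)
  then show "exp (- t * (\<bar>a + b + 1\<bar> / 2)) = exp (t * (d / 2)) * r powr d" unfolding s(2) .
  have alg: "g / h * X + (g * y - g) / h = g / h * (X - (1 - y))" for g h X y :: real
    by (simp add: diff_divide_distrib add_divide_distrib algebra_simps)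
  show "jacobi_poisson_kernel a b t \<theta> \<phi> = exp (t * (d / 2)) / Beta (a + 1) (b + 1) *
      ((1 - r) * (1 + r) powr (d - 1) * bailey_sum a b (r / (1 + r)\<^sup>2) \<theta> \<phi> - (1 - r powr d))"
    unfolding jacobi_poisson_kernel_eq[OF ab t tp] 1 s(2) e unfolding s(1) p by (rule alg)
qed

text \<open>For negative index the subtracted \<open>1 - r powr d\<close> is at most the fraction
  \<open>1 / (1 + e)\<close> of the auxiliary term \<open>B * S\<close>, so at least the fraction
  \<open>e / (1 + e)\<close> survives.\<close>

lemma jacobi_poisson_kernel_comparable_small:
  assumes ab: "a > -1" "b > -1"
  shows "comparable_on {0<..1} (jacobi_poisson_kernel a b) (aux_jacobi_poisson_kernel a b)"
proof (cases "0 \<le> a + b + 1")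
  case True
  have "0 \<le> aux_jacobi_poisson_kernel a b t \<theta> \<phi>" if "t \<in> {0<..1}" "\<theta> \<in> {0..pi}" "\<phi> \<in> {0..pi}" for t \<theta> \<phi>
  proof -
    have t: "0 < t" using that by simp
    have "1 \<le> bailey_sum a b (exp (- t) / (1 + exp (- t))\<^sup>2) \<theta> \<phi>"
      by (intro bailey_sum_ge_1 ab that exp_ratio_bounds t)
    then show ?thesis
      unfolding aux_jacobi_poisson_kernel_eq[OF ab t that(2,3)] poisson_factor_def
      using Beta_pos[OF ab] exp_ratio_bounds(2)[OF t]
      by (intro divide_nonneg_pos mult_nonneg_nonneg) auto
  qed
  then show ?thesis
    using True by (intro comparable_onI[where C = 1]) (simp_all add: jacobi_poisson_kernel_nonneg_index[OF ab] comparable_refl)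
next
  case False
  define d where "d = - (a + b + 1)"
  have d: "0 < d" "d < 1" using False ab by (auto simp: d_def)
  let ?h = "Beta (a + 1) (b + 1)"
  define e where "e = (1 - d) / 36"
  have e: "0 < e" using d by (simp add: e_def)
  show ?thesis
  proof (rule comparable_onI[where C = "(1 + e) / e"])
    show "1 \<le> (1 + e) / e" using e by simp
    fix t \<theta> \<phi> :: real
    assume t: "t \<in> {0<..1}" and tp: "\<theta> \<in> {0..pi}" "\<phi> \<in> {0..pi}"
    then have t': "0 < t" "t \<le> 1" by auto
    define r where "r = exp (- t)"
    define S where "S = bailey_sum a b (r / (1 + r)\<^sup>2) \<theta> \<phi>"
    define B where "B = (1 - r) * (1 + r) powr (d - 1)"
    define G where "G = exp (t * (d / 2)) / ?h"
    note b = exp_ratio_bounds[OF t'(1), folded r_def]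
    have S: "1 \<le> S" unfolding S_def by (intro bailey_sum_ge_1 ab tp b)
    have G: "0 < G" using Beta_pos[OF ab] by (simp add: G_def)
    have B0: "0 \<le> B" unfolding B_def using b by simp
    have "(1 + e) * (1 - r powr d) \<le> B"
      unfolding e_def B_def by (rule poisson_gap_small) (use one_minus_exp_bounds(3)[OF t'] b d in \<open>auto simp: r_def\<close>)
    also have "B \<le> B * S" using B0 S by (simp add: mult_le_cancel_left1)
    finally have "(1 + e) * (1 - r powr d) \<le> B * S" .
    then have "B * S \<le> (1 + e) * (B * S - (1 - r powr d)) / e"
      using e by (simp add: field_simps)
    then have lo: "B * S \<le> (1 + e) / e * (B * S - (1 - r powr d))" by simp
    have "r powr d \<le> 1" using b d by (intro powr_le1) auto
    then have up: "B * S - (1 - r powr d) \<le> B * S" by simp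
    have BS: "0 \<le> B * S" using B0 S by simp
    have nn: "0 \<le> B * S - (1 - r powr d)"
    proof (rule ccontr)
      assume "\<not> ?thesis"
      then have "(1 + e) / e * (B * S - (1 - r powr d)) < 0" using e by (intro mult_pos_neg) auto
      then show False using lo BS by simp
    qed
    have "comparable ((1 + e) / e) (B * S - (1 - r powr d)) (B * S)"
      unfolding comparable_def
    proof (intro conjI nn BS lo)
      show "1 \<le> (1 + e) / e" using e by simp
      then have "1 * (B * S) \<le> (1 + e) / e * (B * S)" using BS by (intro mult_right_mono)
      then show "B * S - (1 - r powr d) \<le> (1 + e) / e * (B * S)" using up by simp
    qed
    from comparable_mult[OF comparable_refl[of G] this]
    show "comparable ((1 + e) / e) (jacobi_poisson_kernel a b t \<theta> \<phi>) (aux_jacobi_poisson_kernel a b t \<theta> \<phi>)"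
      using G unfolding jacobi_poisson_kernel_neg_index[OF ab t'(1) tp d_def d(1) r_def] S_def B_def G_def by simp
  qed
qed

text \<open>For negative index the auxiliary kernel has the wrong order, since the leading 1 cancels
  in \<open>B * S - (1 - y)\<close>. What remains has order \<open>y = r powr d\<close>: from above
  because \<open>B \<le> 1\<close> and \<open>S - 1\<close> is at most a multiple of
  \<open>r \<le> y\<close>, from below by \<open>poisson_gap_large\<close> and
  \<open>S \<ge> 1\<close>.\<close>

lemma jacobi_poisson_kernel_comparable_large:
  assumes ab: "a > -1" "b > -1"
  shows "comparable_on {1..} (jacobi_poisson_kernel a b) (\<lambda>t \<theta> \<phi>. exp (- t * (\<bar>a + b + 1\<bar> / 2)))"
proof (cases "0 \<le> a + b + 1")
  case True
  obtain C where C: "1 \<le> C" "\<And>t \<theta> \<phi>. 1 \<le> t \<Longrightarrow> \<theta> \<in> {0..pi} \<Longrightarrow> \<phi> \<in> {0..pi} \<Longrightarrow>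
     comparable C (aux_jacobi_poisson_kernel a b t \<theta> \<phi>) (exp (- t * ((a + b + 1) / 2)))"
    using aux_jacobi_poisson_kernel_comparable_large[OF ab] by blast
  show ?thesis
  proof (rule comparable_onI[OF _ C(1)])
    fix t \<theta> \<phi> :: real assume t: "t \<in> {1..}" and tp: "\<theta> \<in> {0..pi}" "\<phi> \<in> {0..pi}"
    then have "0 < t" "1 \<le> t" by auto
    then show "comparable C (jacobi_poisson_kernel a b t \<theta> \<phi>) (exp (- t * (\<bar>a + b + 1\<bar> / 2)))"
      unfolding abs_of_nonneg[OF True] jacobi_poisson_kernel_nonneg_index[OF ab \<open>0 < t\<close> tp True]
      by (intro C tp)
  qed
next
  case False
  define d where "d = - (a + b + 1)"
  have d: "0 < d" "d < 1" using False ab by (auto simp: d_def)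
  let ?h = "Beta (a + 1) (b + 1)"
  have h: "0 < ?h" by (rule Beta_pos[OF ab])
  obtain c where c: "0 < c" "\<And>t. 1 \<le> t \<Longrightarrow> c * exp (- t) powr d \<le> (1 - exp (- t)) * (1 + exp (- t)) powr (d - 1) - 1 + exp (- t) powr d"
    using poisson_gap_large[OF d] by blast
  obtain K where K: "0 \<le> K" "\<And>z \<theta> \<phi>. 0 \<le> z \<Longrightarrow> z \<le> 2 / 9 \<Longrightarrow> \<theta> \<in> {0..pi} \<Longrightarrow> \<phi> \<in> {0..pi} \<Longrightarrow>
    bailey_sum a b z \<theta> \<phi> \<le> 1 + K * z"
    using bailey_sum_minus_1_le[OF ab] by blast
  show ?thesis
  proof (rule comparable_onI[where C = "max 1 (max ((K + 1) / ?h) (?h / c))"])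
    fix t \<theta> \<phi> :: real
    assume t: "t \<in> {1..}" and tp: "\<theta> \<in> {0..pi}" "\<phi> \<in> {0..pi}"
    then have t': "0 < t" "1 \<le> t" by auto
    define r where "r = exp (- t)"
    define S where "S = bailey_sum a b (r / (1 + r)\<^sup>2) \<theta> \<phi>"
    define B where "B = (1 - r) * (1 + r) powr (d - 1)"
    define g where "g = exp (t * (d / 2))"
    define y where "y = r powr d"
    note b = exp_ratio_bounds[OF t'(1), folded r_def] and l = exp_large_bounds[OF t'(2), folded r_def]
    have S: "1 \<le> S" unfolding S_def by (intro bailey_sum_ge_1 ab tp b)
    have B0: "0 \<le> B" unfolding B_def using b by simp
    have "(1 + r) powr (d - 1) \<le> (1 + r) powr 0" using b d by (intro powr_mono) auto
    then have "B \<le> 1 * 1" unfolding B_def using b by (intro mult_mono) auto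
    then have B1: "B \<le> 1" by simp
    have g: "0 < g" and y: "0 < y" using b by (auto simp: g_def y_def)
    have "r powr 1 \<le> y" unfolding y_def using b d by (intro powr_mono') auto
    then have ry: "r \<le> y" using b by simp
    have "B * S \<le> 1 * S" using B1 S by (intro mult_right_mono) auto
    also have "S \<le> 1 + K * (r / (1 + r)\<^sup>2)" unfolding S_def by (rule K(2)[OF b(3) l(2) tp])
    also have "K * (r / (1 + r)\<^sup>2) \<le> K * y" using b(6) ry K(1) by (intro mult_left_mono) auto
    finally have up: "B * S - (1 - y) \<le> (K + 1) * y" by (simp add: algebra_simps)
    have "c * y \<le> B - 1 + y" using c(2)[OF t'(2)] unfolding B_def y_def r_def .
    moreover have "B \<le> B * S" using B0 S by (simp add: mult_le_cancel_left1)
    ultimately have lo: "c * y \<le> B * S - (1 - y)" by argo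
    have H: "jacobi_poisson_kernel a b t \<theta> \<phi> = g / ?h * (B * S - (1 - y))"
      and T: "exp (- t * (\<bar>a + b + 1\<bar> / 2)) = g * y"
      unfolding jacobi_poisson_kernel_neg_index[OF ab t'(1) tp d_def d(1) r_def] S_def B_def g_def y_def by simp_all
    show "comparable (max 1 (max ((K + 1) / ?h) (?h / c))) (jacobi_poisson_kernel a b t \<theta> \<phi>) (exp (- t * (\<bar>a + b + 1\<bar> / 2)))"
      unfolding H T
    proof (rule comparableI)
      have cy: "0 \<le> c * y" using c y by simp
      show "0 \<le> g / ?h * (B * S - (1 - y))" using g h lo cy by (intro mult_nonneg_nonneg) auto
      show "0 \<le> g * y" using g y by simp
      have "g / ?h * (B * S - (1 - y)) \<le> g / ?h * ((K + 1) * y)" using up g h by (intro mult_left_mono) auto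
      then show "g / ?h * (B * S - (1 - y)) \<le> (K + 1) / ?h * (g * y)" by (simp add: ac_simps)
      have "g / c * (c * y) \<le> g / c * (B * S - (1 - y))" using lo g c by (intro mult_left_mono) auto
      then show "g * y \<le> ?h / c * (g / ?h * (B * S - (1 - y)))" using c h by simp
    qed
  qed simp
qed

theorem theorem6p1:
  fixes \<alpha> \<beta> :: real
  assumes "\<alpha> > -1" and "\<beta> > -1"
  shows
    "comparable_on {0<..1} (jacobi_poisson_kernel \<alpha> \<beta>) (aux_jacobi_poisson_kernel \<alpha> \<beta>) \<and>
     comparable_on {0<..1} (aux_jacobi_poisson_kernel \<alpha> \<beta>)
       (\<lambda>t \<theta> \<phi>. (t\<^sup>2 + \<theta>\<^sup>2 + \<phi>\<^sup>2) powr (- \<alpha> - 1/2) *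
                (t\<^sup>2 + (pi - \<theta>)\<^sup>2 + (pi - \<phi>)\<^sup>2) powr (- \<beta> - 1/2) *
                (t / (t\<^sup>2 + (\<theta> - \<phi>)\<^sup>2))) \<and>
     comparable_on {1..} (jacobi_poisson_kernel \<alpha> \<beta>)
       (\<lambda>t \<theta> \<phi>. exp (- t * (\<bar>\<alpha> + \<beta> + 1\<bar> / 2))) \<and>
     comparable_on {1..} (aux_jacobi_poisson_kernel \<alpha> \<beta>)
       (\<lambda>t \<theta> \<phi>. exp (- t * ((\<alpha> + \<beta> + 1) / 2)))"
proof (intro conjI)
  obtain C where "1 \<le> C" "\<And>t \<theta> \<phi>. 1 \<le> t \<Longrightarrow> \<theta> \<in> {0..pi} \<Longrightarrow> \<phi> \<in> {0..pi} \<Longrightarrow>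
     comparable C (aux_jacobi_poisson_kernel \<alpha> \<beta> t \<theta> \<phi>) (exp (- t * ((\<alpha> + \<beta> + 1) / 2)))"
    using aux_jacobi_poisson_kernel_comparable_large[OF assms] by blast
  then show "comparable_on {1..} (aux_jacobi_poisson_kernel \<alpha> \<beta>) (\<lambda>t \<theta> \<phi>. exp (- t * ((\<alpha> + \<beta> + 1) / 2)))"
    by (intro comparable_onI[where C = C]) auto
qed (rule jacobi_poisson_kernel_comparable_small[OF assms] jacobi_poisson_kernel_comparable_large[OF assms]
    aux_jacobi_poisson_kernel_comparable_small[OF assms])+

end
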